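(* For an arbitrary matroid $M$, $\mathrm{stair}(M)\cap 1_M=\mathrm{csm}(M)$, where $\mathrm{stair}(M)\in A^*(M)$ is the staircase class of $M$ and $\mathrm{csm}(M)\in MW_*(B(M))$ is the Chern-Schwartz-MacPherson cycle of $M$.
   Context: Let $M$ be a matroid on a finite non-empty set $E$ with rank function $\mathrm{rk}$. $\mathcal{L}(M)$ denotes the set of non-empty flats of $M$ (including $E$) and $\hat{\mathcal{L}}(M)=\mathcal{L}(M)\setminus\{E\}$. Chow ring: $A^*(M)=\mathbb{Z}[x_F\mid F\in\mathcal{L}(M)]/(I_M+J_M)$, where $I_M$ is generated by the products $x_Fx_{F'}$ with $F,F'$ incomparable under inclusion, and $J_M$ is generated by the linear forms $\sum_{F\in\mathcal{L}(M),\,F\ni i}x_F$ for $i\in E$. Staircase class: for $M$ loopless, $\mathrm{stair}(M)=\prod_{r=1}^{\mathrm{rk}(E)}\bigl(1-\sum_{F\in\mathcal{L}(M),\,\mathrm{rk}(F)\ge r}x_F\bigr)\in A^*(M)$; if $M$ has a loop, $\mathrm{stair}(M)=0$. Bergman fan: for $M$ loopless, $B(M)$ is the unimodular fan in $\mathbb{R}^E/\mathbb{R}e_E$ (lattice $\mathbb{Z}^E/\mathbb{Z}e_E$, $e_S=\sum_{i\in S}e_i$) with cones $\sigma_{\mathcal{F}}$ generated by the images of $e_{F_1},\dots,e_{F_k}$, for all flags $\mathcal{F}=\{F_1\subsetneq\dots\subsetneq F_k\}$ of flats in $\hat{\mathcal{L}}(M)$. It is pure of dimension $d=\mathrm{rk}(E)-1$.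 $MW_k(B(M))$ is the group of balanced functions $\omega$ from the $k$-dimensional cones to $\mathbb{Z}$, i.e. for every $(k-1)$-dimensional cone $\tau$, $\sum_{\sigma>\tau}\omega(\sigma)v_{\sigma/\tau}\in\mathrm{span}(\tau)$, where the sum is over $k$-dimensional cones $\sigma$ containing $\tau$ and $v_{\sigma/\tau}$ is the primitive generator of the ray of $\sigma$ not in $\tau$. $MW_*=\bigoplus_k MW_k$. Poincaré duality: let $\deg:A^d(M)\to\mathbb{Z}$ be the unique isomorphism with $\deg(x_{F_1}\cdots x_{F_d})=1$ for every maximal flag in $\hat{\mathcal{L}}(M)$. The isomorphism $\_\cap 1_M:A^k(M)\to MW_{d-k}(B(M))$ sends $\alpha$ to the weight $\sigma_{\mathcal{F}}\mapsto\deg(\alpha\prod_{F\in\mathcal{F}}x_F)$; it is extended additively to $A^*(M)$. ($1_M$ is the weight equal to $1$ on every maximal cone.) CSM cycle (López de Medrano–Rincón–Shaw): the beta invariant of a matroid $N$ on a set $E_N$ is $\beta(N)=(-1)^{\mathrm{rk}(N)}\sum_{S\subseteq E_N}(-1)^{|S|}\mathrm{rk}_N(S)$. For $M$ loopless and $0\le k\le d$, $\mathrm{csm}_k(M)\in MW_k(B(M))$ has weight on $\sigma_{\mathcal{F}}$, $\mathcal{F}=\{F_1\subsetneq\dots\subsetneq F_k\}$, equal to $(-1)^{d-k}\prod_{i=0}^{k}\beta\bigl((M|_{F_{i+1}})/F_i\bigr)$, where $F_0=\emptyset$, $F_{k+1}=E$, $M|_{F_{i+1}}$ is restriction and $/F_i$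 is contraction. Then $\mathrm{csm}(M)=\sum_{k=0}^d\mathrm{csm}_k(M)$. If $M$ has a loop, $\mathrm{csm}(M)=0$ and both sides of the claimed equality are by convention $0$. *)

theory Defs
  imports
    "HOL-Algebra.QuotRing"
    "HOL-Algebra.Elementary_Groups"
    "HOL-Library.Poly_Mapping"
    "HOL-Library.Indicator_Function"
begin

section \<open>Matroids\<close>

text \<open>Only the values of the rank function on subsets of the ground set are meaningful.\<close>

record 'a matroid =
  ground :: "'a set"
  rk :: "'a set \<Rightarrow> nat"

locale matroid =
  fixes M :: "'a matroid"
  assumes finite_ground: "finite (ground M)"
    and rk_le_card: "\<And>S. S \<subseteq> ground M \<Longrightarrow> rk M S \<le> card S"
    and rk_mono: "\<And>S T. S \<subseteq> T \<Longrightarrow> T \<subseteq> ground M \<Longrightarrow> rk M S \<le> rk M T"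
    and rk_submodular: "\<And>S T. S \<subseteq> ground M \<Longrightarrow> T \<subseteq> ground M \<Longrightarrow>
           rk M (S \<union> T) + rk M (S \<inter> T) \<le> rk M S + rk M T"

definition restriction :: "'a matroid \<Rightarrow> 'a set \<Rightarrow> 'a matroid" where
  "restriction M T = \<lparr>ground = T, rk = rk M\<rparr>"

definition contraction :: "'a matroid \<Rightarrow> 'a set \<Rightarrow> 'a matroid" where
  "contraction M T = \<lparr>ground = ground M - T, rk = (\<lambda>S. rk M (S \<union> T) - rk M T)\<rparr>"

definition loopless :: "'a matroid \<Rightarrow> bool" where
  "loopless M \<longleftrightarrow> (\<forall>i\<in>ground M. rk M {i} \<noteq> 0)"

definition flat :: "'a matroid \<Rightarrow> 'a set \<Rightarrow> bool" where
  "flat M F \<longleftrightarrow> F \<subseteq> ground M \<and> (\<forall>i\<in>ground M - F. rk M F < rk M (insert i F))"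

definition flats :: "'a matroid \<Rightarrow> 'a set set" where
  "flats M = {F. flat M F \<and> F \<noteq> {}}"

definition proper_flats :: "'a matroid \<Rightarrow> 'a set set" where
  "proper_flats M = flats M - {ground M}"

definition beta :: "'a matroid \<Rightarrow> int" where
  "beta N = (-1) ^ rk N (ground N) *
     (\<Sum>S\<in>Pow (ground N). (-1) ^ card S * int (rk N S))"


section \<open>Polynomial rings over the integers\<close>

text \<open>
  A monomial is a finitely supported exponent function, and a polynomial is a finitely
  supported function from monomials to coefficients; the type class multiplication on
  \<open>Poly_Mapping\<close> is the convolution product.
\<close>

type_synonym 'v int_poly = "('v \<Rightarrow>\<^sub>0 nat) \<Rightarrow>\<^sub>0 int"

definition var :: "'v \<Rightarrow> 'v int_poly" where
  "var v = Poly_Mapping.single (Poly_Mapping.single v 1) 1"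

definition poly_ring :: "'v set \<Rightarrow> 'v int_poly ring" where
  "poly_ring V =
     \<lparr>carrier = {p. \<forall>m\<in>Poly_Mapping.keys p. Poly_Mapping.keys m \<subseteq> V},
      mult = (*), one = 1, zero = 0, add = (+)\<rparr>"

definition mon_degree :: "('v \<Rightarrow>\<^sub>0 nat) \<Rightarrow> nat" where
  "mon_degree m = (\<Sum>v\<in>Poly_Mapping.keys m. Poly_Mapping.lookup m v)"

definition homogeneous :: "nat \<Rightarrow> 'v int_poly \<Rightarrow> bool" where
  "homogeneous k p \<longleftrightarrow> (\<forall>m\<in>Poly_Mapping.keys p. mon_degree m = k)"

definition hom_part :: "nat \<Rightarrow> 'v int_poly \<Rightarrow> 'v int_poly" where
  "hom_part k p = (\<Sum>m\<in>{m \<in> Poly_Mapping.keys p. mon_degree m = k}.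
     Poly_Mapping.single m (Poly_Mapping.lookup p m))"


section \<open>The Chow ring\<close>

definition chow_poly :: "'a matroid \<Rightarrow> 'a set int_poly ring" where
  "chow_poly M = poly_ring (flats M)"

definition ideal_I :: "'a matroid \<Rightarrow> 'a set int_poly set" where
  "ideal_I M = genideal (chow_poly M)
     {var F * var F' | F F'. F \<in> flats M \<and> F' \<in> flats M \<and> \<not> F \<subseteq> F' \<and> \<not> F' \<subseteq> F}"

definition ideal_J :: "'a matroid \<Rightarrow> 'a set int_poly set" where
  "ideal_J M = genideal (chow_poly M)
     {\<Sum>F\<in>{F \<in> flats M. i \<in> F}. var F | i. i \<in> ground M}"

definition chow_ideal :: "'a matroid \<Rightarrow> 'a set int_poly set" where
  "chow_ideal M = ideal_I M <+>\<^bsub>chow_poly M\<^esub> ideal_J M"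

definition chow_ring :: "'a matroid \<Rightarrow> 'a set int_poly set ring" where
  "chow_ring M = chow_poly M Quot chow_ideal M"

definition chow_class :: "'a matroid \<Rightarrow> 'a set int_poly \<Rightarrow> 'a set int_poly set" where
  "chow_class M p = chow_ideal M +>\<^bsub>chow_poly M\<^esub> p"

definition chow_graded :: "'a matroid \<Rightarrow> nat \<Rightarrow> 'a set int_poly set set" where
  "chow_graded M k = chow_class M ` {p \<in> carrier (chow_poly M). homogeneous k p}"

text \<open>
  The component of degree \<open>k\<close> of a class is the class of the homogeneous part of degree
  \<open>k\<close> of any representative.  The ideal is homogeneous, so the image below is a singleton.
\<close>

definition chow_component ::
    "'a matroid \<Rightarrow> nat \<Rightarrow> 'a set int_poly set \<Rightarrow> 'a set int_poly set" where
  "chow_component M k \<alpha> = the_elem ((\<lambda>p. chow_class M (hom_part k p)) ` \<alpha>)"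

definition stair :: "'a matroid \<Rightarrow> 'a set int_poly set" where
  "stair M =
     (if loopless M
      then chow_class M (\<Prod>r = 1..rk M (ground M).
             1 - (\<Sum>F\<in>{F \<in> flats M. r \<le> rk M F}. var F))
      else \<zero>\<^bsub>chow_ring M\<^esub>)"


section \<open>The Bergman fan and Minkowski weights\<close>

definition fan_dim :: "'a matroid \<Rightarrow> nat" where
  "fan_dim M = rk M (ground M) - 1"

definition flags :: "'a matroid \<Rightarrow> 'a set set set" where
  "flags M = {\<F>. \<F> \<subseteq> proper_flats M \<and> (\<forall>F\<in>\<F>. \<forall>G\<in>\<F>. F \<subseteq> G \<or> G \<subseteq> F)}"

definition maximal_flags :: "'a matroid \<Rightarrow> 'a set set set" where
  "maximal_flags M = {\<F> \<in> flags M. \<forall>\<G>\<in>flags M. \<F> \<subseteq> \<G> \<longrightarrow> \<G> = \<F>}"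

text \<open>
  A cone of the Bergman fan is encoded by its flag, that is by the set of flats indexing its
  rays.  Since the fan is simplicial, the dimension of a cone is the cardinality of the flag
  and the faces of a cone are given by the subsets of its flag.  For a matroid with a loop the
  fan has no cones, so that its only weight is \<open>0\<close>.
\<close>

definition cones :: "'a matroid \<Rightarrow> nat \<Rightarrow> 'a set set set" where
  "cones M k = (if loopless M then {\<F> \<in> flags M. card \<F> = k} else {})"

text \<open>
  For a facet \<open>\<tau>\<close> of \<open>\<sigma>\<close>, the vector \<open>v\<close> attached to \<open>\<sigma>/\<tau>\<close> is the image of \<open>e_F\<close>, with \<open>F\<close>
  the unique element of \<open>\<sigma> - \<tau>\<close>.  Membership in the span of \<open>\<tau>\<close> in the quotient of the space
  of real vectors indexed by the ground set \<open>E\<close> by the line through \<open>e_E\<close> is written as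
  membership, upstairs, in the span of \<open>e_E\<close> and all \<open>e_G\<close> with \<open>G \<in> \<tau>\<close>.
\<close>

definition balanced_at ::
    "'a matroid \<Rightarrow> nat \<Rightarrow> ('a set set \<Rightarrow> int) \<Rightarrow> 'a set set \<Rightarrow> bool" where
  "balanced_at M k \<omega> \<tau> \<longleftrightarrow>
     (\<exists>(c :: 'a set \<Rightarrow> real) (c\<^sub>E :: real). \<forall>i\<in>ground M.
        (\<Sum>\<sigma>\<in>{\<sigma> \<in> cones M k. \<tau> \<subseteq> \<sigma>}. of_int (\<omega> \<sigma>) * indicator (the_elem (\<sigma> - \<tau>)) i)
        = (\<Sum>G\<in>\<tau>. c G * indicator G i) + c\<^sub>E * indicator (ground M) i)"

text \<open>Weights are functions on flags vanishing outside the cones in question.\<close>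

definition MW :: "'a matroid \<Rightarrow> nat \<Rightarrow> ('a set set \<Rightarrow> int) set" where
  "MW M k = {\<omega>. (\<forall>\<sigma>. \<sigma> \<notin> cones M k \<longrightarrow> \<omega> \<sigma> = 0) \<and>
                 (\<forall>j \<tau>. Suc j = k \<longrightarrow> \<tau> \<in> cones M j \<longrightarrow> balanced_at M k \<omega> \<tau>)}"

text \<open>
  As weights of different dimensions have disjoint supports and there are no cones of
  dimension greater than \<open>fan_dim M\<close>, the direct sum of the groups \<open>MW M k\<close> is realised
  inside the group of all functions on flags.
\<close>

definition MW_star :: "'a matroid \<Rightarrow> ('a set set \<Rightarrow> int) set" where
  "MW_star M = {\<omega>. \<exists>w. (\<forall>k\<le>fan_dim M. w k \<in> MW M k) \<and>
                        \<omega> = (\<lambda>\<sigma>. \<Sum>k\<le>fan_dim M. w k \<sigma>)}"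


section \<open>The degree map and the cap product with the fundamental weight\<close>

definition chow_group :: "'a matroid \<Rightarrow> nat \<Rightarrow> 'a set int_poly set monoid" where
  "chow_group M k = \<lparr>carrier = chow_graded M k, mult = add (chow_ring M),
                     one = \<zero>\<^bsub>chow_ring M\<^esub>\<rparr>"

text \<open>The extensionality clause only fixes the junk value outside the top degree part.\<close>

definition chow_deg :: "'a matroid \<Rightarrow> 'a set int_poly set \<Rightarrow> int" where
  "chow_deg M = (THE f. f \<in> iso (chow_group M (fan_dim M)) integer_group \<and>
     f \<in> extensional (chow_graded M (fan_dim M)) \<and>
     (\<forall>\<F>\<in>maximal_flags M. f (chow_class M (\<Prod>F\<in>\<F>. var F)) = 1))"

definition cap_graded ::
    "'a matroid \<Rightarrow> nat \<Rightarrow> 'a set int_poly set \<Rightarrow> 'a set set \<Rightarrow> int" where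
  "cap_graded M k \<alpha> = (\<lambda>\<F>. if \<F> \<in> cones M (fan_dim M - k)
     then chow_deg M (\<alpha> \<otimes>\<^bsub>chow_ring M\<^esub> chow_class M (\<Prod>F\<in>\<F>. var F)) else 0)"

text \<open>
  The additive extension of \<open>cap_graded\<close>.  Degrees above \<open>fan_dim M\<close> contribute nothing,
  as there are no cones of negative dimension.
\<close>

definition cap :: "'a matroid \<Rightarrow> 'a set int_poly set \<Rightarrow> 'a set set \<Rightarrow> int" where
  "cap M \<alpha> = (\<lambda>\<F>. \<Sum>k\<le>fan_dim M. cap_graded M k (chow_component M k \<alpha>) \<F>)"


section \<open>The Chern-Schwartz-MacPherson cycle\<close>

text \<open>
  The successor of a member of the extended flag
  \<open>{} = F_0 \<subset> F_1 \<subset> \<dots> \<subset> F_k \<subset> F_{k+1} = E\<close> is the intersection of all its strictly larger members.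
\<close>

definition flag_succ :: "'a matroid \<Rightarrow> 'a set set \<Rightarrow> 'a set \<Rightarrow> 'a set" where
  "flag_succ M \<F> F = \<Inter>{G \<in> insert (ground M) \<F>. F \<subset> G}"

definition csm_k :: "'a matroid \<Rightarrow> nat \<Rightarrow> 'a set set \<Rightarrow> int" where
  "csm_k M k = (\<lambda>\<F>. if \<F> \<in> cones M k
     then (-1) ^ (fan_dim M - k) *
          (\<Prod>F\<in>insert {} \<F>. beta (contraction (restriction M (flag_succ M \<F> F)) F))
     else 0)"

definition csm :: "'a matroid \<Rightarrow> 'a set set \<Rightarrow> int" where
  "csm M = (\<lambda>\<F>. \<Sum>k\<le>fan_dim M. csm_k M k \<F>)"

end

theory Submission
  imports Defs "HOL-Library.Multiset"
begin

text \<open>The Chow ring acts on weights, and the cap product is this action.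

A flag of proper flats is stored together with \<open>E = ground M\<close>, as a chain containing \<open>E\<close>, and a
weight is an integer function on such chains.  On balanced weights the variable \<open>x\<^sub>F\<close> acts by
intersection with the tropical divisor of the piecewise linear function that is \<open>1\<close> at \<open>e\<^sub>F\<close> and
\<open>0\<close> at every other ray: at a chain not containing \<open>F\<close> it reads off the weight of the chain
extended by \<open>F\<close>, and at a chain containing \<open>F\<close> the function is first moved off the chain by a linear
form.  Balancing makes the result independent of the form.  These operators preserve balancing
(\<open>X_balanced\<close>) and commute (\<open>X_commute\<close>), and the generators of the ideals \<open>I\<close> and \<open>J\<close> act as
zero, so classes in the Chow ring act on balanced weights.

Let \<open>unit_weight\<close> be \<open>1\<close> on every maximal cone.  Acting on it and reading off the value at the chain
\<open>{E}\<close> is a functional with value \<open>1\<close> on maximal flags.  It is the degree map, because the top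
degree part of the Chow ring is generated by the class of \<open>(- x\<^sub>E) ^ d\<close>, to which every maximal flag
monomial is congruent (\<open>full_chain_product\<close>, \<open>top_degree_multiple\<close>, \<open>chow_deg_class\<close>).  Since the
monomial of a flag acts by moving the point of evaluation from \<open>{E}\<close> to that flag, the weight
\<open>\<alpha> \<inter> 1\<^sub>M\<close> is just \<open>\<alpha>\<close> acting on \<open>unit_weight\<close> (\<open>cap_chow_class\<close>).

It remains to apply the factors of the staircase class to \<open>unit_weight\<close>, beginning with the one of
largest rank.  After all factors of rank larger than \<open>t\<close> have been applied, the weight at a chain is
known explicitly: it vanishes unless the chain, together with the empty set, has flats of all ranks
below \<open>t\<close>, and then it is the product of the signed beta invariants of the gaps that start at
rank at least \<open>t\<close> (\<open>partial_stair\<close>).  The next factor only sees the gap \<open>F \<subset> G\<close> in which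
the rank \<open>t + 1\<close> falls, and the required equality reduces to the identity
\<open>\<Sum>\<^sub>H b(H, G) = 1\<close>, where \<open>i \<in> G - F\<close> is fixed, \<open>H\<close> runs over the flats between \<open>F\<close> and \<open>G\<close> that
miss \<open>i\<close>, and \<open>b\<close> is the signed beta invariant (\<open>sum_signed_beta\<close>).  For \<open>t = 0\<close> the formula is the
weight of the Chern-Schwartz-MacPherson cycle.  Its balancing comes for free, because polynomials
act on balanced weights.  If there is a loop, both sides are zero.\<close>

section \<open>Finite sums\<close>

lemma sum_Pow_split:
  fixes g :: "'b set \<Rightarrow> 'c::comm_monoid_add"
  assumes "finite A" "i \<in> A"
  shows "sum g (Pow A) = (\<Sum>S\<in>Pow (A - {i}). g S + g (insert i S))"
proof -
  have A: "A = insert i (A - {i})" using assms by auto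
  have fin: "finite (Pow (A - {i}))" using assms by auto
  have disj: "Pow (A - {i}) \<inter> insert i ` Pow (A - {i}) = {}" by auto
  have inj: "inj_on (insert i) (Pow (A - {i}))" by (rule inj_onI) blast
  have "sum g (Pow A) = sum g (Pow (A - {i}) \<union> insert i ` Pow (A - {i}))"
    by (subst A, subst Pow_insert) simp
  also have "\<dots> = sum g (Pow (A - {i})) + sum g (insert i ` Pow (A - {i}))"
    using fin disj by (intro sum.union_disjoint) auto
  also have "sum g (insert i ` Pow (A - {i})) = (\<Sum>S\<in>Pow (A - {i}). g (insert i S))"
    using inj by (simp add: sum.reindex)
  finally show ?thesis by (simp add: sum.distrib)
qed

lemma alternating_sum_Pow:
  assumes "finite A" "A \<noteq> {}"
  shows "(\<Sum>S\<in>Pow A. (-1) ^ card S) = (0::int)"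
proof -
  obtain i where i: "i \<in> A" using assms by auto
  have "(\<Sum>S\<in>Pow A. (-1) ^ card S) = (\<Sum>S\<in>Pow (A - {i}). (-1) ^ card S + (-1::int) ^ card (insert i S))"
    by (rule sum_Pow_split) (use assms i in auto)
  also have "\<dots> = 0"
  proof (rule sum.neutral, rule ballI)
    fix S assume S: "S \<in> Pow (A - {i})"
    hence "finite S" "i \<notin> S" using assms by (auto intro: finite_subset)
    thus "(-1) ^ card S + (-1::int) ^ card (insert i S) = 0" by simp
  qed
  finally show ?thesis .
qed

text \<open>A double sum over distinct indices becomes one over a product set, to which the exchange of
summations applies.\<close>

lemma sum_off_diagonal:
  fixes f :: "'b \<Rightarrow> 'b \<Rightarrow> int"
  assumes "finite A"
  shows "(\<Sum>x\<in>A. \<Sum>y\<in>A - {x}. f x y) = (\<Sum>x\<in>A. \<Sum>y\<in>A. of_bool (x \<noteq> y) * f x y)"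
  using assms by (intro sum.cong refl sum.mono_neutral_cong_left) auto

section \<open>Closure and flats\<close>

context matroid
begin

abbreviation E :: "'a set" where "E \<equiv> ground M"

abbreviation r :: "'a set \<Rightarrow> nat" where "r \<equiv> rk M"

definition cl :: "'a set \<Rightarrow> 'a set" where
  "cl S = {i \<in> E. r (insert i S) = r S}"

lemma finite_sub: "S \<subseteq> E \<Longrightarrow> finite S"
  using finite_ground finite_subset by blast

lemma rk_empty [simp]: "r {} = 0"
  using rk_le_card[of "{}"] by simp

lemma rk_insert_le:
  assumes "S \<subseteq> E" "i \<in> E"
  shows "r (insert i S) \<le> Suc (r S)"
proof -
  have "r (S \<union> {i}) + r (S \<inter> {i}) \<le> r S + r {i}"
    using assms by (intro rk_submodular) auto
  moreover have "r {i} \<le> card {i}" using assms by (intro rk_le_card) auto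
  ultimately show ?thesis by simp
qed

text \<open>Submodularity for \<open>insert i S\<close> and \<open>T\<close>, whose intersection is \<open>S\<close> if \<open>i \<notin> T\<close>.\<close>

lemma rk_insert_eq_mono:
  assumes "S \<subseteq> T" "T \<subseteq> E" "i \<in> E" "r (insert i S) = r S"
  shows "r (insert i T) = r T"
proof (cases "i \<in> T")
  case False
  have "r (insert i S \<union> T) + r (insert i S \<inter> T) \<le> r (insert i S) + r T"
    using assms by (intro rk_submodular) auto
  moreover have "insert i S \<union> T = insert i T" "insert i S \<inter> T = S" using assms False by auto
  moreover have "r T \<le> r (insert i T)" using assms by (intro rk_mono) auto
  ultimately show ?thesis using assms by simp
qed (simp add: insert_absorb)

lemma cl_subset: "cl S \<subseteq> E"
  by (auto simp: cl_def)

lemma subset_cl: "S \<subseteq> E \<Longrightarrow> S \<subseteq> cl S"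
  by (auto simp: cl_def insert_absorb)

lemma rk_cl:
  assumes "S \<subseteq> E"
  shows "r (cl S) = r S"
proof -
  have "r (S \<union> T) = r S" if "finite T" "T \<subseteq> cl S" for T
    using that
  proof (induction T rule: finite_induct)
    case (insert x T)
    have T: "T \<subseteq> cl S" using insert by auto
    have x: "x \<in> E" "r (insert x S) = r S" using insert by (auto simp: cl_def)
    have "r (insert x (S \<union> T)) = r (S \<union> T)"
      by (rule rk_insert_eq_mono[of S]) (use assms T cl_subset[of S] x in auto)
    then show ?case using insert T by simp
  qed simp
  from this[of "cl S"] subset_cl[OF assms] finite_sub[OF cl_subset] show ?thesis
    by (simp add: Un_absorb1)
qed

lemma flat_cl:
  assumes "S \<subseteq> E"
  shows "flat M (cl S)"
proof -
  have "r (cl S) < r (insert i (cl S))" if "i \<in> E - cl S" for i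
  proof -
    have "r S \<le> r (insert i S)" using that assms by (intro rk_mono) auto
    moreover have "r (insert i S) \<noteq> r S" using that by (auto simp: cl_def)
    ultimately have "r S < r (insert i S)" by simp
    also have "\<dots> \<le> r (insert i (cl S))"
      using that assms subset_cl[OF assms] cl_subset by (intro rk_mono) auto
    finally show ?thesis using rk_cl[OF assms] by simp
  qed
  then show ?thesis using cl_subset by (auto simp: flat_def)
qed

lemma flat_subset: "flat M F \<Longrightarrow> F \<subseteq> E"
  by (simp add: flat_def)

lemma cl_least:
  assumes "flat M F" "S \<subseteq> F"
  shows "cl S \<subseteq> F"
proof
  fix i assume "i \<in> cl S"
  hence i: "i \<in> E" "r (insert i S) = r S" by (auto simp: cl_def)
  have "r (insert i F) = r F"
    by (rule rk_insert_eq_mono[of S]) (use assms i flat_subset in auto)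
  then show "i \<in> F" using assms i by (force simp: flat_def)
qed

lemma flat_rk_less:
  assumes "flat M F" "F \<subset> T" "T \<subseteq> E"
  shows "r F < r T"
proof -
  obtain i where i: "i \<in> T - F" using assms by auto
  have "r F < r (insert i F)" using assms i by (auto simp: flat_def)
  also have "\<dots> \<le> r T" using assms i by (intro rk_mono) auto
  finally show ?thesis .
qed

lemma rk_cl_insert:
  assumes "flat M F" "i \<in> E - F"
  shows "r (cl (insert i F)) = Suc (r F)"
proof -
  have "r F < r (insert i F)" using assms by (auto simp: flat_def)
  moreover have "r (insert i F) \<le> Suc (r F)"
    using assms flat_subset by (intro rk_insert_le) auto
  moreover have "r (cl (insert i F)) = r (insert i F)"
    using assms flat_subset[of F] by (intro rk_cl) auto
  ultimately show ?thesis by simp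
qed

lemma cl_insert_eq:
  assumes "flat M F" "flat M H" "F \<subseteq> H" "r H = Suc (r F)" "i \<in> H - F"
  shows "cl (insert i F) = H"
proof (rule ccontr)
  assume ne: "cl (insert i F) \<noteq> H"
  have i: "i \<in> E - F" and sub: "insert i F \<subseteq> E" using assms flat_subset by auto
  have "cl (insert i F) \<subseteq> H" using assms by (intro cl_least) auto
  hence "r (cl (insert i F)) < r H"
    using ne flat_cl[OF sub] flat_subset[OF assms(2)] by (intro flat_rk_less) auto
  then show False using rk_cl_insert[OF assms(1) i] assms by simp
qed

lemma flat_ground: "flat M E"
  by (simp add: flat_def)

lemma finite_flat: "finite {F. flat M F}"
  by (rule finite_subset[of _ "Pow E"]) (auto simp: flat_def finite_ground)

lemma finite_flats: "finite (flats M)"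
  by (rule finite_subset[OF _ finite_flat]) (auto simp: flats_def)

section \<open>Beta invariants of minors\<close>

text \<open>Up to sign this is the beta invariant of the minor of \<open>G\<close> by \<open>F\<close>; the sign is the one for which the
weights of the Chern-Schwartz-MacPherson cycle become plain products.  Replacing the rank of the minor
by the rank of \<open>S \<union> F\<close> does no harm if \<open>F \<noteq> G\<close>, since the constant \<open>r F\<close> is killed by the alternating sum.\<close>

definition signed_beta :: "'a set \<Rightarrow> 'a set \<Rightarrow> int" where
  "signed_beta F G = - (\<Sum>S\<in>Pow (G - F). (-1) ^ card S * int (r (S \<union> F)))"

lemma signed_beta_eq:
  assumes "F \<subset> G" "G \<subseteq> E"
  shows "(-1) ^ (r F + r G + 1) * beta (contraction (restriction M G) F) = signed_beta F G"
proof -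
  have rk: "r F \<le> r G" using assms by (intro rk_mono) auto
  have fin: "finite (G - F)" using assms finite_sub by auto
  have "beta (contraction (restriction M G) F) =
      (-1) ^ (r G - r F) * (\<Sum>S\<in>Pow (G - F). (-1) ^ card S * int (r (S \<union> F) - r F))"
    using assms by (simp add: beta_def contraction_def restriction_def Un_absorb2)
  also have "(\<Sum>S\<in>Pow (G - F). (-1) ^ card S * int (r (S \<union> F) - r F)) =
      (\<Sum>S\<in>Pow (G - F). (-1) ^ card S * int (r (S \<union> F)) - (-1) ^ card S * int (r F))"
  proof (rule sum.cong)
    fix S assume "S \<in> Pow (G - F)"
    hence "r F \<le> r (S \<union> F)" using assms by (intro rk_mono) auto
    thus "(-1) ^ card S * int (r (S \<union> F) - r F) =
        (-1) ^ card S * int (r (S \<union> F)) - (-1) ^ card S * int (r F)"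
      by (simp add: of_nat_diff algebra_simps)
  qed simp
  also have "\<dots> = - signed_beta F G - (\<Sum>S\<in>Pow (G - F). (-1) ^ card S) * int (r F)"
    by (simp add: sum_subtractf signed_beta_def sum_distrib_right)
  also have "(\<Sum>S\<in>Pow (G - F). (-1) ^ card S) = (0::int)"
    using assms fin by (intro alternating_sum_Pow) auto
  finally have "beta (contraction (restriction M G) F) = (-1) ^ (r G - r F) * - signed_beta F G"
    by simp
  moreover have "(-1) ^ (r F + r G + 1) * (-1) ^ (r G - r F) = (-1::int)"
  proof -
    have "(-1::int) ^ (r F + r G + 1) * (-1) ^ (r G - r F) = (-1) ^ (r F + r G + 1 + (r G - r F))"
      by (simp only: power_add)
    also have "r F + r G + 1 + (r G - r F) = 2 * r G + 1" using rk by simp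
    finally show ?thesis by simp
  qed
  moreover have "u * x = b" if "x = v * - b" "u * v = - 1" for u v x b :: int
    using that by (simp flip: mult.assoc)
  ultimately show ?thesis by blast
qed

text \<open>Pair \<open>S\<close> with \<open>insert i S\<close>: the two ranks differ by \<open>1\<close> if \<open>i\<close> is outside the closure of \<open>S \<union> F\<close>, and
agree otherwise.\<close>

lemma signed_beta_closure:
  assumes "F \<subseteq> G" "G \<subseteq> E" "i \<in> G - F"
  shows "signed_beta F G = (\<Sum>S\<in>{S \<in> Pow (G - F). i \<notin> cl (S \<union> F)}. (-1) ^ card S)"
proof -
  have fin: "finite (G - F)" using assms finite_sub by auto
  have iE: "i \<in> E" using assms by auto
  have "signed_beta F G = (\<Sum>S\<in>Pow (G - F). - ((-1) ^ card S * int (r (S \<union> F))))"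
    by (simp add: signed_beta_def sum_negf)
  also have "\<dots> = (\<Sum>S\<in>Pow (G - F - {i}). - ((-1) ^ card S * int (r (S \<union> F))) +
      - ((-1) ^ card (insert i S) * int (r (insert i S \<union> F))))"
    using assms fin by (intro sum_Pow_split) auto
  also have "\<dots> = (\<Sum>S\<in>Pow (G - F - {i}). if i \<notin> cl (S \<union> F) then (-1) ^ card S else 0)"
  proof (rule sum.cong)
    fix S assume S: "S \<in> Pow (G - F - {i})"
    hence "finite S" "i \<notin> S" and SE: "S \<union> F \<subseteq> E" using assms by (auto intro: finite_sub)
    hence card: "card (insert i S) = Suc (card S)" by simp
    have ge: "r (S \<union> F) \<le> r (insert i (S \<union> F))" using SE iE by (intro rk_mono) auto
    have le: "r (insert i (S \<union> F)) \<le> Suc (r (S \<union> F))" using SE iE by (rule rk_insert_le)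
    show "- ((-1) ^ card S * int (r (S \<union> F))) + - ((-1) ^ card (insert i S) * int (r (insert i S \<union> F)))
        = (if i \<notin> cl (S \<union> F) then (-1) ^ card S else 0)"
    proof (cases "r (insert i (S \<union> F)) = r (S \<union> F)")
      case True then show ?thesis using iE card by (simp add: cl_def)
    next
      case False
      hence "r (insert i (S \<union> F)) = Suc (r (S \<union> F))" using le ge by simp
      then show ?thesis using iE card by (simp add: cl_def algebra_simps)
    qed
  qed simp
  also have "\<dots> = (\<Sum>S\<in>{S \<in> Pow (G - F - {i}). i \<notin> cl (S \<union> F)}. (-1) ^ card S)"
    using fin by (intro sum.inter_filter[symmetric]) auto
  also have "{S \<in> Pow (G - F - {i}). i \<notin> cl (S \<union> F)} = {S \<in> Pow (G - F). i \<notin> cl (S \<union> F)}"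
    using iE by (auto simp: cl_def insert_absorb)
  finally show ?thesis .
qed

text \<open>Downward induction on \<open>F\<close>.  In the closure formula for \<open>signed_beta F G\<close> the empty set contributes \<open>1\<close>.
For a non-empty \<open>S\<close>, the induction hypothesis at the closure of \<open>S \<union> F\<close> writes \<open>1\<close> as the sum of
\<open>signed_beta H G\<close> over the flats \<open>H\<close> missing \<open>i\<close> and containing \<open>S \<union> F\<close>.  After exchanging the two
sums, each \<open>H \<noteq> F\<close> gets the coefficient \<open>-1\<close>, the alternating sum over the non-empty subsets of
\<open>H - F\<close>, which cancels its own term.\<close>

lemma sum_signed_beta:
  assumes "flat M F" "flat M G" "F \<subseteq> G" "i \<in> G - F"
  shows "(\<Sum>H\<in>{H. flat M H \<and> F \<subseteq> H \<and> H \<subseteq> G \<and> i \<notin> H}. signed_beta H G) = 1"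
  using assms
proof (induction "card (G - F)" arbitrary: F rule: less_induct)
  case less
  define P where "P F = {H. flat M H \<and> F \<subseteq> H \<and> H \<subseteq> G \<and> i \<notin> H}" for F
  define Q where "Q = {S \<in> Pow (G - F). i \<notin> cl (S \<union> F)}"
  have GE: "G \<subseteq> E" using less flat_subset by auto
  have finP: "finite (P F)" unfolding P_def by (rule finite_subset[OF _ finite_flat]) auto
  have finGF: "finite (G - F)" using GE finite_sub by auto
  hence finQ: "finite Q" unfolding Q_def by auto
  have F: "F \<in> P F" using less by (auto simp: P_def)
  have clF: "cl F = F" using cl_least[of F F] subset_cl[of F] less flat_subset by auto
  have Q0: "{} \<in> Q" using clF less by (auto simp: Q_def)
  \<comment> \<open>a non-empty S has closure strictly above F, where the induction hypothesis applies\<close>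
  have IH: "(\<Sum>H\<in>{H \<in> P F - {F}. S \<subseteq> H}. signed_beta H G) = 1" if "S \<in> Q - {{}}" for S
  proof -
    have S: "S \<subseteq> G - F" "S \<noteq> {}" "i \<notin> cl (S \<union> F)" using that by (auto simp: Q_def)
    have SE: "S \<union> F \<subseteq> E" using S GE less by auto
    have sub: "S \<union> F \<subseteq> cl (S \<union> F)" using SE by (rule subset_cl)
    have clG: "cl (S \<union> F) \<subseteq> G" using S less by (intro cl_least) auto
    have "G - cl (S \<union> F) \<subset> G - F" using S sub by blast
    hence "card (G - cl (S \<union> F)) < card (G - F)" using finGF by (intro psubset_card_mono)
    hence "(\<Sum>H\<in>P (cl (S \<union> F)). signed_beta H G) = 1"
      unfolding P_def using less S clG flat_cl[OF SE] by (intro less.hyps) auto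
    moreover have "P (cl (S \<union> F)) = {H \<in> P F - {F}. S \<subseteq> H}"
    proof
      show "P (cl (S \<union> F)) \<subseteq> {H \<in> P F - {F}. S \<subseteq> H}"
        using sub S by (auto simp: P_def)
      show "{H \<in> P F - {F}. S \<subseteq> H} \<subseteq> P (cl (S \<union> F))"
        using cl_least[of _ "S \<union> F"] by (auto simp: P_def)
    qed
    ultimately show ?thesis by simp
  qed
  have "signed_beta F G = (\<Sum>S\<in>Q. (-1) ^ card S)"
    unfolding Q_def using less GE by (intro signed_beta_closure) auto
  also have "\<dots> = 1 + (\<Sum>S\<in>Q - {{}}. (-1) ^ card S)"
    using sum.remove[OF finQ Q0, of "\<lambda>S. (-1::int) ^ card S"] by simp
  also have "(\<Sum>S\<in>Q - {{}}. (-1) ^ card S) =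
      (\<Sum>S\<in>Q - {{}}. \<Sum>H\<in>{H \<in> P F - {F}. S \<subseteq> H}. (-1) ^ card S * signed_beta H G)"
    by (rule sum.cong[OF refl]) (simp only: sum_distrib_left[symmetric] IH mult_1_right)
  also have "\<dots> = (\<Sum>H\<in>P F - {F}. \<Sum>S\<in>{S \<in> Q - {{}}. S \<subseteq> H}. (-1) ^ card S * signed_beta H G)"
    using finQ finP by (intro sum.swap_restrict) auto
  also have "\<dots> = (\<Sum>H\<in>P F - {F}. - signed_beta H G)"
  proof (rule sum.cong)
    fix H assume H: "H \<in> P F - {F}"
    have HF: "finite (H - F)" "H - F \<noteq> {}"
      using H finite_subset[OF _ finGF, of "H - F"] by (auto simp: P_def)
    have "{S \<in> Q - {{}}. S \<subseteq> H} = Pow (H - F) - {{}}"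
    proof
      show "Pow (H - F) - {{}} \<subseteq> {S \<in> Q - {{}}. S \<subseteq> H}"
      proof
        fix S assume S: "S \<in> Pow (H - F) - {{}}"
        hence "cl (S \<union> F) \<subseteq> H" using H by (intro cl_least) (auto simp: P_def)
        thus "S \<in> {S \<in> Q - {{}}. S \<subseteq> H}" using S H by (auto simp: P_def Q_def)
      qed
    qed (auto simp: Q_def)
    moreover have "(\<Sum>S\<in>Pow (H - F) - {{}}. (-1) ^ card S) = (-1::int)"
      using sum.remove[of "Pow (H - F)" "{}" "\<lambda>S. (-1::int) ^ card S"] alternating_sum_Pow[OF HF] HF
      by simp
    ultimately show "(\<Sum>S\<in>{S \<in> Q - {{}}. S \<subseteq> H}. (-1) ^ card S * signed_beta H G) = - signed_beta H G"
      by (simp flip: sum_distrib_right)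
  qed simp
  finally have "signed_beta F G = 1 - (\<Sum>H\<in>P F - {F}. signed_beta H G)"
    by (simp add: sum_negf)
  then have "(\<Sum>H\<in>P F. signed_beta H G) = 1"
    using sum.remove[OF finP F, of "\<lambda>H. signed_beta H G"] by simp
  then show ?case by (simp add: P_def)
qed

end

section \<open>Chains of flats and linear forms\<close>

locale loopless_matroid = matroid +
  assumes loopless: "loopless M" and ground_nonempty: "ground M \<noteq> {}"
begin

abbreviation L :: "'a set set" where "L \<equiv> flats M"

lemma flat_empty: "flat M {}"
  using loopless by (auto simp: flat_def loopless_def)

lemma ground_in_flats: "E \<in> L"
  using flat_ground ground_nonempty by (simp add: flats_def)

lemma flatsD: assumes "F \<in> L" shows "flat M F" "F \<noteq> {}" "F \<subseteq> E"
  using assms flat_subset by (auto simp: flats_def)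

lemma rk_flats_pos: assumes "F \<in> L" shows "0 < r F"
  using flat_rk_less[OF flat_empty, of F] flatsD[OF assms] by (auto simp: psubset_eq)

lemma rk_ground_pos: "0 < r E"
  using rk_flats_pos ground_in_flats by simp

text \<open>A chain \<open>\<tau>\<close> stands for the cone of the flag \<open>\<tau> - {E}\<close>.  Keeping \<open>E\<close> in it avoids the quotient by
\<open>e\<^sub>E\<close>: linear forms live on the whole space, and \<open>e\<^sub>E\<close> is one more vector at which their values are
prescribed.  A linear form is a function \<open>a\<close> on the ground set, and its value at \<open>e\<^sub>F\<close> is \<open>sum a F\<close>.\<close>

definition chains :: "'a set set set" where
  "chains = {\<tau>. \<tau> \<subseteq> L \<and> E \<in> \<tau> \<and> (\<forall>F\<in>\<tau>. \<forall>G\<in>\<tau>. F \<subseteq> G \<or> G \<subseteq> F)}"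

lemma chainsD:
  assumes "\<tau> \<in> chains"
  shows "\<tau> \<subseteq> L" "E \<in> \<tau>" "F \<in> \<tau> \<Longrightarrow> G \<in> \<tau> \<Longrightarrow> F \<subseteq> G \<or> G \<subseteq> F" "finite \<tau>" "{} \<notin> \<tau>"
  using assms finite_flats by (auto simp: chains_def flats_def intro: finite_subset)

lemma chain_flat: "\<tau> \<in> chains \<Longrightarrow> F \<in> insert {} \<tau> \<Longrightarrow> flat M F"
  using chainsD(1) flat_empty flatsD(1) by blast

lemma insert_chains_iff:
  assumes "\<tau> \<in> chains"
  shows "insert H \<tau> \<in> chains \<longleftrightarrow> H \<in> L \<and> (\<forall>G\<in>\<tau>. H \<subseteq> G \<or> G \<subseteq> H)"
  using assms by (auto simp: chains_def)

lemma chains_subset: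
  assumes "\<sigma> \<in> chains" "\<tau> \<subseteq> \<sigma>" "E \<in> \<tau>"
  shows "\<tau> \<in> chains"
  using assms unfolding chains_def by (simp add: subset_iff)

lemma chain_rk_less:
  assumes "\<tau> \<in> chains" "F \<in> insert {} \<tau>" "G \<in> insert {} \<tau>" "F \<subset> G"
  shows "r F < r G"
proof -
  have "flat M F" using assms(2) chainsD(1)[OF assms(1)] flatsD(1) flat_empty by auto
  moreover have "G \<subseteq> E" using assms(3) chainsD(1)[OF assms(1)] flatsD(3)[of G] by auto
  ultimately
  show ?thesis using assms flat_rk_less by auto
qed

lemma chain_rk_inj:
  assumes "\<tau> \<in> chains"
  shows "inj_on r (insert {} \<tau>)"
proof (rule inj_onI)
  fix F G assume FG: "F \<in> insert {} \<tau>" "G \<in> insert {} \<tau>" "r F = r G"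
  hence "F \<subseteq> G \<or> G \<subseteq> F" using chainsD(3)[OF assms] by auto
  then show "F = G" using FG chain_rk_less[OF assms, of F G] chain_rk_less[OF assms, of G F] by auto
qed

lemma rk_image_chain:
  assumes "\<tau> \<in> chains"
  shows "r ` \<tau> \<subseteq> {1..r E}" "card (r ` \<tau>) = card \<tau>"
proof -
  show "r ` \<tau> \<subseteq> {1..r E}"
  proof
    fix x assume "x \<in> r ` \<tau>"
    then obtain F where F: "F \<in> L" "x = r F" using chainsD(1)[OF assms] by auto
    then show "x \<in> {1..r E}"
      using rk_flats_pos[of F] flatsD(3)[of F] rk_mono[of F E] by auto
  qed
  have "inj_on r \<tau>" using chain_rk_inj[OF assms] by (rule inj_on_subset) auto
  then show "card (r ` \<tau>) = card \<tau>" by (rule card_image)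
qed

lemma card_chain_le: "\<tau> \<in> chains \<Longrightarrow> card \<tau> \<le> r E"
  using rk_image_chain[of \<tau>] card_mono[of "{1..r E}" "r ` \<tau>"] by simp

lemma full_chain_iff:
  assumes "\<tau> \<in> chains"
  shows "r ` \<tau> = {1..r E} \<longleftrightarrow> card \<tau> = r E"
  using rk_image_chain[OF assms] card_subset_eq[of "{1..r E}" "r ` \<tau>"] by auto

text \<open>The rank \<open>s\<close> falls into exactly one gap of the chain; \<open>F\<close> and \<open>G\<close> are the flats on its two sides, where
\<open>F\<close> may be empty.\<close>

lemma chain_gap:
  assumes \<tau>: "\<tau> \<in> chains" and s: "0 < s" "s \<le> r E"
  obtains F G where "F \<in> insert {} \<tau>" "G \<in> \<tau>" "r F < s" "s \<le> r G" "F \<subset> G"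
    "\<And>K. K \<in> insert {} \<tau> \<Longrightarrow> r K < s \<Longrightarrow> K \<subseteq> F"
    "\<And>K. K \<in> insert {} \<tau> \<Longrightarrow> s \<le> r K \<Longrightarrow> G \<subseteq> K"
proof -
  let ?A = "{K \<in> insert {} \<tau>. r K < s}" and ?B = "{K \<in> insert {} \<tau>. s \<le> r K}"
  have fin: "finite ?A" "finite ?B" using chainsD(4)[OF \<tau>] by auto
  have lin: "K \<subseteq> K' \<or> K' \<subseteq> K" if "K \<in> insert {} \<tau>" "K' \<in> insert {} \<tau>" for K K'
    using that chainsD(3)[OF \<tau>] by auto
  have "{} \<in> ?A" "E \<in> ?B" using s chainsD(2)[OF \<tau>] by auto
  hence ne: "?A \<noteq> {}" "?B \<noteq> {}" by blast+
  obtain F where F: "F \<in> ?A" "\<forall>K\<in>?A. F \<subseteq> K \<longrightarrow> F = K"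
    using finite_has_maximal[OF fin(1) ne(1)] by blast
  obtain G where G: "G \<in> ?B" "\<forall>K\<in>?B. K \<subseteq> G \<longrightarrow> G = K"
    using finite_has_minimal[OF fin(2) ne(2)] by blast
  have "G \<in> \<tau>" using G s by auto
  moreover have "F \<subset> G"
  proof -
    have "\<not> G \<subseteq> F" using F G rk_mono[of G F] chainsD(1)[OF \<tau>] flatsD(3) by fastforce
    then show ?thesis using lin F G by blast
  qed
  moreover have "K \<subseteq> F" if "K \<in> insert {} \<tau>" "r K < s" for K
    using F lin[of K F] that by blast
  moreover have "G \<subseteq> K" if "K \<in> insert {} \<tau>" "s \<le> r K" for K
    using G lin[of K G] that by blast
  ultimately show ?thesis using F G by (intro that) auto
qed

text \<open>Any \<open>i \<in> G - F\<close>, for the gap \<open>F \<subset> G\<close> at rank \<open>s\<close>: on the chain, the coordinate at \<open>i\<close> is the step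
function at rank \<open>s\<close>.\<close>

lemma chain_step:
  assumes "\<tau> \<in> chains" "0 < s" "s \<le> r E"
  obtains i where "i \<in> E" "\<And>K. K \<in> \<tau> \<Longrightarrow> i \<in> K \<longleftrightarrow> s \<le> r K"
proof -
  obtain F G where FG: "F \<in> insert {} \<tau>" "G \<in> \<tau>" "r F < s" "s \<le> r G" "F \<subset> G"
    "\<And>K. K \<in> insert {} \<tau> \<Longrightarrow> r K < s \<Longrightarrow> K \<subseteq> F"
    "\<And>K. K \<in> insert {} \<tau> \<Longrightarrow> s \<le> r K \<Longrightarrow> G \<subseteq> K"
    by (rule chain_gap[OF assms]) blast
  obtain i where i: "i \<in> G - F" using FG by auto
  show ?thesis
  proof (rule that)
    have "G \<in> L" using FG(2) chainsD(1)[OF assms(1)] by auto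
    then show "i \<in> E" using i flatsD(3) by auto
    show "i \<in> K \<longleftrightarrow> s \<le> r K" if "K \<in> \<tau>" for K
      using FG(6)[of K] FG(7)[of K] that i by (cases "s \<le> r K") auto
  qed
qed

lemma sum_unit_form:
  assumes "K \<subseteq> E"
  shows "sum (\<lambda>j. of_bool (j = i)) K = (of_bool (i \<in> K) :: int)"
  using assms finite_sub[OF assms] by (simp add: of_bool_def)

text \<open>The difference of the step functions at the ranks \<open>r F\<close> and \<open>r F + 1\<close>; for \<open>F = E\<close> the second one is
absent.  This is where the fan is seen to be unimodular.\<close>

lemma dual_form_exists:
  assumes \<tau>: "\<tau> \<in> chains" and F: "F \<in> \<tau>"
  shows "\<exists>a :: 'a \<Rightarrow> int. \<forall>G\<in>\<tau>. sum a G = of_bool (G = F)"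
proof -
  have sub: "K \<subseteq> E" if "K \<in> \<tau>" for K using that chainsD(1)[OF \<tau>] flatsD(3) by auto
  have eq: "K = F \<longleftrightarrow> r K = r F" if "K \<in> \<tau>" for K
    using chain_rk_inj[OF \<tau>] that F by (auto dest: inj_onD)
  have le: "r K \<le> r E" if "K \<in> \<tau>" for K
    using sub[OF that] by (intro rk_mono) auto
  obtain i where i: "i \<in> E" "\<And>K. K \<in> \<tau> \<Longrightarrow> i \<in> K \<longleftrightarrow> r F \<le> r K"
    using chain_step[OF \<tau>, of "r F"] rk_flats_pos chainsD(1)[OF \<tau>] F le[OF F] by (metis subsetD)
  show ?thesis
  proof (cases "r F = r E")
    case True
    show ?thesis
    proof (intro exI[of _ "\<lambda>j. of_bool (j = i)"] ballI)
      fix K assume K: "K \<in> \<tau>"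
      show "sum (\<lambda>j. of_bool (j = i)) K = (of_bool (K = F) :: int)"
        using sum_unit_form[OF sub[OF K]] i(2)[OF K] eq[OF K] le[OF K] True by auto
    qed
  next
    case False
    obtain j where j: "j \<in> E" "\<And>K. K \<in> \<tau> \<Longrightarrow> j \<in> K \<longleftrightarrow> Suc (r F) \<le> r K"
      using chain_step[OF \<tau>, of "Suc (r F)"] False le[OF F] by (metis Suc_leI le_neq_implies_less zero_less_Suc)
    show ?thesis
    proof (intro exI[of _ "\<lambda>x. of_bool (x = i) - of_bool (x = j)"] ballI)
      fix K assume K: "K \<in> \<tau>"
      show "sum (\<lambda>x. of_bool (x = i) - of_bool (x = j)) K = (of_bool (K = F) :: int)"
        using sum_unit_form[OF sub[OF K]] i(2)[OF K] j(2)[OF K] eq[OF K] by (auto simp: sum_subtractf)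
    qed
  qed
qed

definition dual_form :: "'a set set \<Rightarrow> 'a set \<Rightarrow> 'a \<Rightarrow> int" where
  "dual_form \<tau> F = (SOME a. \<forall>G\<in>\<tau>. sum a G = of_bool (G = F))"

lemma dual_form:
  assumes "\<tau> \<in> chains" "F \<in> \<tau>" "G \<in> \<tau>"
  shows "sum (dual_form \<tau> F) G = of_bool (G = F)"
  using someI_ex[OF dual_form_exists[OF assms(1,2)]] assms(3) by (auto simp: dual_form_def)

section \<open>Divisors acting on balanced weights\<close>

text \<open>The sum over \<open>\<sigma> > \<tau>\<close> lies in the span of \<open>\<tau>\<close> if and only if every linear form vanishing on \<open>\<tau>\<close>
vanishes on it.  Flats \<open>H\<close> that do not extend \<open>\<tau>\<close> to a chain are harmless in the sum, as weights vanish
off \<open>chains\<close>.\<close>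

definition balanced :: "('a set set \<Rightarrow> int) \<Rightarrow> bool" where
  "balanced w \<longleftrightarrow> (\<forall>\<tau>. \<tau> \<notin> chains \<longrightarrow> w \<tau> = 0) \<and>
     (\<forall>\<tau>\<in>chains. \<forall>a. (\<forall>G\<in>\<tau>. sum a G = 0) \<longrightarrow>
        (\<Sum>H\<in>L - \<tau>. sum a H * w (insert H \<tau>)) = 0)"

text \<open>Intersection with the divisor \<open>x\<^sub>F\<close>.  At a chain containing \<open>F\<close> it uses that \<open>x\<^sub>F\<close> is linearly
equivalent to a combination of the divisors of flats outside the chain.  The value \<open>0\<close> on weights
that are not balanced lets the operators commute without any hypothesis, as a fold over a multiset
requires.\<close>

definition X :: "'a set \<Rightarrow> ('a set set \<Rightarrow> int) \<Rightarrow> 'a set set \<Rightarrow> int" where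
  "X F w = (\<lambda>\<tau>. if \<tau> \<in> chains \<and> balanced w then
       (if F \<in> \<tau> then - (\<Sum>H\<in>L - \<tau>. sum (dual_form \<tau> F) H * w (insert H \<tau>))
        else w (insert F \<tau>))
     else 0)"

lemma balanced_support: "balanced w \<Longrightarrow> \<tau> \<notin> chains \<Longrightarrow> w \<tau> = 0"
  by (simp add: balanced_def)

lemma balanced_zero_form:
  "balanced w \<Longrightarrow> \<tau> \<in> chains \<Longrightarrow> (\<And>G. G \<in> \<tau> \<Longrightarrow> sum a G = 0) \<Longrightarrow>
    (\<Sum>H\<in>L - \<tau>. sum a H * w (insert H \<tau>)) = 0"
  by (simp add: balanced_def)

lemma X_notin:
  assumes "balanced w" "E \<in> \<tau>" "F \<notin> \<tau>"
  shows "X F w \<tau> = w (insert F \<tau>)"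
proof (cases "\<tau> \<in> chains")
  case False
  hence "insert F \<tau> \<notin> chains" using chains_subset[of "insert F \<tau>" \<tau>] assms by auto
  then show ?thesis using False assms by (simp add: X_def balanced_support)
qed (use assms in \<open>simp add: X_def\<close>)

lemma X_in:
  assumes "balanced w" "\<tau> \<in> chains" "F \<in> \<tau>"
  shows "X F w \<tau> = - (\<Sum>H\<in>L - \<tau>. sum (dual_form \<tau> F) H * w (insert H \<tau>))"
  using assms by (simp add: X_def)

text \<open>The divisor of the piecewise linear function with values \<open>\<phi>\<close> on the rays, evaluated by subtracting any
linear form that agrees with it on \<open>\<tau>\<close>.  Both the linear relations of the Chow ring and the effect
of a staircase factor are instances.\<close>

lemma X_weighted_sum:
  assumes w: "balanced w" and \<tau>: "\<tau> \<in> chains"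
    and a: "\<And>G. G \<in> \<tau> \<Longrightarrow> sum a G = \<phi> G"
  shows "(\<Sum>F\<in>L. \<phi> F * X F w \<tau>) = (\<Sum>H\<in>L - \<tau>. (\<phi> H - sum a H) * w (insert H \<tau>))"
proof -
  have fin: "finite \<tau>" and sub: "\<tau> \<subseteq> L" and E: "E \<in> \<tau>" using chainsD[OF \<tau>] by auto
  define c where "c i = (\<Sum>F\<in>\<tau>. \<phi> F * dual_form \<tau> F i)" for i
  have c: "sum c H = (\<Sum>F\<in>\<tau>. \<phi> F * sum (dual_form \<tau> F) H)" for H
    unfolding c_def by (subst sum.swap) (simp add: sum_distrib_left)
  have cG: "sum c G = sum a G" if "G \<in> \<tau>" for G
    using that fin by (simp add: c a dual_form[OF \<tau>] of_bool_def if_distrib[of "\<lambda>x. _ * x"] cong: if_cong)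
  have "(\<Sum>F\<in>\<tau>. \<phi> F * X F w \<tau>) =
      - (\<Sum>F\<in>\<tau>. \<Sum>H\<in>L - \<tau>. \<phi> F * sum (dual_form \<tau> F) H * w (insert H \<tau>))"
    by (simp add: X_in[OF w \<tau>] sum_distrib_left[of "\<phi> _" _ "L - \<tau>"] sum_negf mult.assoc)
  also have "\<dots> = - (\<Sum>H\<in>L - \<tau>. sum c H * w (insert H \<tau>))"
    by (subst sum.swap) (simp add: c sum_distrib_right)
  also have "(\<Sum>H\<in>L - \<tau>. sum c H * w (insert H \<tau>)) = (\<Sum>H\<in>L - \<tau>. sum a H * w (insert H \<tau>))"
    using balanced_zero_form[OF w \<tau>, of "\<lambda>i. c i - a i"] cG
    by (simp add: sum_subtractf left_diff_distrib)
  finally have 1: "(\<Sum>F\<in>\<tau>. \<phi> F * X F w \<tau>) = - (\<Sum>H\<in>L - \<tau>. sum a H * w (insert H \<tau>))" .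
  have "(\<Sum>F\<in>L. \<phi> F * X F w \<tau>) = (\<Sum>F\<in>L - \<tau>. \<phi> F * X F w \<tau>) + (\<Sum>F\<in>\<tau>. \<phi> F * X F w \<tau>)"
    using sub finite_flats by (intro sum.subset_diff)
  also have "(\<Sum>F\<in>L - \<tau>. \<phi> F * X F w \<tau>) = (\<Sum>H\<in>L - \<tau>. \<phi> H * w (insert H \<tau>))"
    using E by (intro sum.cong refl) (simp add: X_notin[OF w])
  finally show ?thesis using 1 by (simp add: sum_subtractf left_diff_distrib)
qed

lemma X_linear_relation:
  assumes "balanced w"
  shows "(\<Sum>F\<in>L. sum a F * X F w \<tau>) = 0"
proof (cases "\<tau> \<in> chains")
  case True
  then show ?thesis using X_weighted_sum[OF assms, of \<tau> a "sum a"] by simp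
qed (simp add: X_def)

text \<open>The linear relation at the chain \<open>insert H \<tau>\<close>, solved for the flats of \<open>\<tau>\<close>.\<close>

lemma X_linear_relation_insert:
  assumes w: "balanced w" and \<tau>: "\<tau> \<in> chains" and H: "H \<in> L - \<tau>"
  shows "(\<Sum>G\<in>\<tau>. sum a G * X G w (insert H \<tau>)) = - sum a H * X H w (insert H \<tau>)
    - (\<Sum>K\<in>L - insert H \<tau>. sum a K * w (insert K (insert H \<tau>)))"
proof -
  have fin: "finite \<tau>" and sub: "insert H \<tau> \<subseteq> L" and E: "E \<in> \<tau>" using chainsD[OF \<tau>] H by auto
  have "0 = (\<Sum>F\<in>L - insert H \<tau>. sum a F * X F w (insert H \<tau>)) + (\<Sum>F\<in>insert H \<tau>. sum a F * X F w (insert H \<tau>))"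
    using sum.subset_diff[OF sub finite_flats, of "\<lambda>F. sum a F * X F w (insert H \<tau>)"]
      X_linear_relation[OF w, of a "insert H \<tau>"] by simp
  also have "(\<Sum>F\<in>L - insert H \<tau>. sum a F * X F w (insert H \<tau>)) =
      (\<Sum>K\<in>L - insert H \<tau>. sum a K * w (insert K (insert H \<tau>)))"
    using E by (intro sum.cong refl) (simp add: X_notin[OF w])
  finally show ?thesis using fin H by simp
qed

lemma X_dual_insert:
  assumes w: "balanced w" and \<tau>: "\<tau> \<in> chains" and H: "H \<in> L - \<tau>" and F: "F \<in> \<tau>"
  shows "X F w (insert H \<tau>) = - sum (dual_form \<tau> F) H * X H w (insert H \<tau>)
    - (\<Sum>K\<in>L - insert H \<tau>. sum (dual_form \<tau> F) K * w (insert K (insert H \<tau>)))"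
proof -
  have "(\<Sum>G\<in>\<tau>. sum (dual_form \<tau> F) G * X G w (insert H \<tau>)) = X F w (insert H \<tau>)"
    using chainsD(4)[OF \<tau>] F by (simp add: dual_form[OF \<tau> F] of_bool_def if_distrib[of "\<lambda>x. x * _"] cong: if_cong)
  then show ?thesis using X_linear_relation_insert[OF w \<tau> H, of "dual_form \<tau> F"] by simp
qed

text \<open>At a chain \<open>\<tau>\<close> not containing \<open>F\<close>, balancing of \<open>X F w\<close> is the linear relation for \<open>w\<close> at
\<open>insert F \<tau>\<close>.  If \<open>F \<in> \<tau>\<close>, the sum runs over ordered pairs of flats extending \<open>\<tau>\<close>, the weight is
symmetric in the pair, and the coefficient turns out to be antisymmetric.\<close>

lemma X_balanced:
  assumes w: "balanced w"
  shows "balanced (X F w)"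
  unfolding balanced_def
proof (intro conjI allI ballI impI)
  show "X F w \<tau> = 0" if "\<tau> \<notin> chains" for \<tau>
    using that by (simp add: X_def)
next
  fix \<tau> a assume \<tau>: "\<tau> \<in> chains" and a: "\<forall>G\<in>\<tau>. sum a G = (0::int)"
  have E: "E \<in> \<tau>" using chainsD(2)[OF \<tau>] .
  show "(\<Sum>H\<in>L - \<tau>. sum a H * X F w (insert H \<tau>)) = 0"
  proof (cases "F \<in> \<tau>")
    case True
    define d where "d = dual_form \<tau> F"
    define T where "T H K = w (insert K (insert H \<tau>))" for H K
    have T: "T H K = T K H" for H K by (simp add: T_def insert_commute)
    have "sum a H * X F w (insert H \<tau>) =
        (\<Sum>K\<in>L - \<tau> - {H}. (sum d H * sum a K - sum a H * sum d K) * T H K)" if H: "H \<in> L - \<tau>" for H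
    proof -
      have Leq: "L - insert H \<tau> = L - \<tau> - {H}" by auto
      have "(\<Sum>K\<in>L - \<tau> - {H}. sum a K * T H K) = - sum a H * X H w (insert H \<tau>)"
        using X_linear_relation_insert[OF w \<tau> H, of a] a by (simp add: T_def Leq)
      moreover have "X F w (insert H \<tau>) = - sum d H * X H w (insert H \<tau>)
          - (\<Sum>K\<in>L - \<tau> - {H}. sum d K * T H K)"
        using X_dual_insert[OF w \<tau> H True] by (simp add: T_def d_def Leq)
      moreover have "x * y = (\<Sum>K\<in>A. (p * u K - x * v K) * t K)"
        if "(\<Sum>K\<in>A. u K * t K) = - x * z" "y = - p * z - (\<Sum>K\<in>A. v K * t K)"
        for x y z p :: int and u v t :: "'a set \<Rightarrow> int" and A
      proof -
        have "(\<Sum>K\<in>A. (p * u K - x * v K) * t K) =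
            p * (\<Sum>K\<in>A. u K * t K) - x * (\<Sum>K\<in>A. v K * t K)"
          by (simp add: left_diff_distrib sum_subtractf sum_distrib_left mult.assoc)
        also have "\<dots> = x * y" unfolding that by (simp add: algebra_simps)
        finally show ?thesis by simp
      qed
      ultimately show ?thesis by blast
    qed
    hence "(\<Sum>H\<in>L - \<tau>. sum a H * X F w (insert H \<tau>)) =
        (\<Sum>H\<in>L - \<tau>. \<Sum>K\<in>L - \<tau>. of_bool (H \<noteq> K) * ((sum d H * sum a K - sum a H * sum d K) * T H K))"
      using finite_flats by (simp add: sum_off_diagonal)
    also have "\<dots> = (\<Sum>H\<in>L - \<tau>. \<Sum>K\<in>L - \<tau>. of_bool (H \<noteq> K) * (sum d H * sum a K * T H K)) -
        (\<Sum>H\<in>L - \<tau>. \<Sum>K\<in>L - \<tau>. of_bool (H \<noteq> K) * (sum a H * sum d K * T H K))"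
      by (simp add: left_diff_distrib right_diff_distrib sum_subtractf)
    also have "\<dots> = 0"
      by (subst sum.swap) (simp add: T mult.commute eq_commute)
    finally show ?thesis .
  next
    case False
    show ?thesis
    proof (cases "insert F \<tau> \<in> chains")
      case True
      hence FL: "F \<in> L - \<tau>" using False chainsD(1) by auto
      have Leq: "L - \<tau> - {F} = L - insert F \<tau>" by auto
      have "(\<Sum>H\<in>L - \<tau>. sum a H * X F w (insert H \<tau>)) =
          sum a F * X F w (insert F \<tau>) + (\<Sum>H\<in>L - insert F \<tau>. sum a H * X F w (insert H \<tau>))"
        using sum.remove[OF _ FL, of "\<lambda>H. sum a H * X F w (insert H \<tau>)"] finite_flats Leq by simp
      also have "(\<Sum>H\<in>L - insert F \<tau>. sum a H * X F w (insert H \<tau>)) =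
          (\<Sum>H\<in>L - insert F \<tau>. sum a H * w (insert H (insert F \<tau>)))"
      proof (rule sum.cong[OF refl])
        fix H assume "H \<in> L - insert F \<tau>"
        hence "X F w (insert H \<tau>) = w (insert F (insert H \<tau>))"
          using False E by (intro X_notin[OF w]) auto
        then show "sum a H * X F w (insert H \<tau>) = sum a H * w (insert H (insert F \<tau>))"
          by (simp add: insert_commute)
      qed
      finally show ?thesis
        using X_linear_relation_insert[OF w \<tau> FL, of a] a by simp
    next
      case notin: False
      have "X F w (insert H \<tau>) = 0" for H
      proof (cases "H = F")
        case False
        hence "X F w (insert H \<tau>) = w (insert F (insert H \<tau>))"
          using \<open>F \<notin> \<tau>\<close> E by (intro X_notin[OF w]) auto
        moreover have "insert F (insert H \<tau>) \<notin> chains"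
          using notin chains_subset[of "insert F (insert H \<tau>)" "insert F \<tau>"] E by auto
        ultimately show ?thesis using w by (simp add: balanced_support)
      qed (use notin in \<open>simp add: X_def\<close>)
      then show ?thesis by simp
    qed
  qed
qed

lemma balanced_linear_combination:
  assumes "\<And>i. i \<in> I \<Longrightarrow> balanced (w i)"
  shows "balanced (\<lambda>\<tau>. \<Sum>i\<in>I. c i * w i \<tau>)"
  unfolding balanced_def
proof (intro conjI allI ballI impI)
  show "(\<Sum>i\<in>I. c i * w i \<tau>) = 0" if "\<tau> \<notin> chains" for \<tau>
    using that assms by (intro sum.neutral) (auto simp: balanced_support)
next
  fix \<tau> a assume \<tau>: "\<tau> \<in> chains" and a: "\<forall>G\<in>\<tau>. sum a G = (0::int)"
  have "(\<Sum>H\<in>L - \<tau>. sum a H * (\<Sum>i\<in>I. c i * w i (insert H \<tau>))) =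
      (\<Sum>i\<in>I. c i * (\<Sum>H\<in>L - \<tau>. sum a H * w i (insert H \<tau>)))"
    unfolding sum_distrib_left by (subst sum.swap) (simp only: mult.left_commute)
  also have "\<dots> = 0"
    using assms \<tau> a by (intro sum.neutral) (auto simp: balanced_zero_form)
  finally show "(\<Sum>H\<in>L - \<tau>. sum a H * (\<Sum>i\<in>I. c i * w i (insert H \<tau>))) = 0" .
qed

lemma X_linear_combination:
  assumes w: "\<And>i. i \<in> I \<Longrightarrow> balanced (w i)"
  shows "X F (\<lambda>\<tau>. \<Sum>i\<in>I. c i * w i \<tau>) = (\<lambda>\<tau>. \<Sum>i\<in>I. c i * X F (w i) \<tau>)"
proof
  fix \<tau>
  have bal: "balanced (\<lambda>\<tau>. \<Sum>i\<in>I. c i * w i \<tau>)" using w by (rule balanced_linear_combination)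
  show "X F (\<lambda>\<tau>. \<Sum>i\<in>I. c i * w i \<tau>) \<tau> = (\<Sum>i\<in>I. c i * X F (w i) \<tau>)"
  proof (cases "\<tau> \<in> chains \<and> F \<in> \<tau>")
    case True
    have "(\<Sum>H\<in>L - \<tau>. sum (dual_form \<tau> F) H * (\<Sum>i\<in>I. c i * w i (insert H \<tau>))) =
      (\<Sum>i\<in>I. c i * (\<Sum>H\<in>L - \<tau>. sum (dual_form \<tau> F) H * w i (insert H \<tau>)))"
      unfolding sum_distrib_left by (subst sum.swap) (simp only: mult.left_commute)
    then show ?thesis using True w by (simp add: X_in bal sum_negf)
  next
    case False
    then show ?thesis using w bal by (auto simp: X_def)
  qed
qed

text \<open>Both sides are sums over the flats and over the ordered pairs of flats extending \<open>\<tau>\<close>.  The first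
sum is symmetric in \<open>F\<close> and \<open>G\<close>, and the second becomes so after exchanging the two members of the pair.\<close>

lemma X_commute_in:
  assumes w: "balanced w" and \<tau>: "\<tau> \<in> chains" and F: "F \<in> \<tau>" and G: "G \<in> \<tau>"
  shows "X F (X G w) \<tau> = X G (X F w) \<tau>"
proof -
  define T where "T H K = w (insert K (insert H \<tau>))" for H K
  have T: "T H K = T K H" for H K by (simp add: T_def insert_commute)
  define d where "d F H = sum (dual_form \<tau> F) H" for F H
  have expand: "X F (X G w) \<tau> = (\<Sum>H\<in>L - \<tau>. d F H * d G H * X H w (insert H \<tau>)) +
      (\<Sum>H\<in>L - \<tau>. \<Sum>K\<in>L - \<tau>. of_bool (H \<noteq> K) * (d F H * d G K * T H K))"
    if F: "F \<in> \<tau>" and G: "G \<in> \<tau>" for F G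
  proof -
    have Leq: "L - insert H \<tau> = L - \<tau> - {H}" for H by auto
    have "X F (X G w) \<tau> = - (\<Sum>H\<in>L - \<tau>. d F H * X G w (insert H \<tau>))"
      unfolding d_def by (rule X_in[OF X_balanced[OF w] \<tau> F])
    also have "\<dots> = (\<Sum>H\<in>L - \<tau>. d F H * d G H * X H w (insert H \<tau>) +
        (\<Sum>K\<in>L - \<tau> - {H}. d F H * d G K * T H K))"
      unfolding sum_negf[symmetric]
    proof (rule sum.cong[OF refl])
      fix H assume "H \<in> L - \<tau>"
      hence "X G w (insert H \<tau>) = - d G H * X H w (insert H \<tau>) - (\<Sum>K\<in>L - \<tau> - {H}. d G K * T H K)"
        using X_dual_insert[OF w \<tau> _ G] by (simp add: T_def d_def Leq)
      then show "- (d F H * X G w (insert H \<tau>)) = d F H * d G H * X H w (insert H \<tau>) +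
          (\<Sum>K\<in>L - \<tau> - {H}. d F H * d G K * T H K)"
        by (simp add: right_diff_distrib sum_distrib_left mult.assoc)
    qed
    finally show ?thesis using finite_flats by (simp add: sum.distrib sum_off_diagonal)
  qed
  have "(\<Sum>H\<in>L - \<tau>. \<Sum>K\<in>L - \<tau>. of_bool (H \<noteq> K) * (d F H * d G K * T H K)) =
     (\<Sum>H\<in>L - \<tau>. \<Sum>K\<in>L - \<tau>. of_bool (H \<noteq> K) * (d G H * d F K * T H K))"
    by (subst sum.swap) (simp add: T mult.commute eq_commute)
  then show ?thesis using expand[OF F G] expand[OF G F] by (simp add: mult.commute)
qed

text \<open>Both sides are the value of \<open>X G w\<close> at \<open>insert F \<tau>\<close>.  The right-hand side computes it with the dual
form of \<open>\<tau>\<close>, whose value at \<open>F\<close> is accounted for by the linear relation at \<open>insert F \<tau>\<close>.\<close>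

lemma X_commute_notin_in:
  assumes w: "balanced w" and \<tau>: "\<tau> \<in> chains" and F: "F \<notin> \<tau>" and G: "G \<in> \<tau>"
  shows "X F (X G w) \<tau> = X G (X F w) \<tau>"
proof -
  have E: "E \<in> \<tau>" using chainsD(2)[OF \<tau>] .
  have lhs: "X F (X G w) \<tau> = X G w (insert F \<tau>)"
    using X_notin[OF X_balanced[OF w] E F] .
  have rhs: "X G (X F w) \<tau> = - (\<Sum>H\<in>L - \<tau>. sum (dual_form \<tau> G) H * X F w (insert H \<tau>))"
    by (rule X_in[OF X_balanced[OF w] \<tau> G])
  have off: "X F w (insert H \<tau>) = w (insert H (insert F \<tau>))" if "H \<noteq> F" for H
    using that E F by (simp add: X_notin[OF w] insert_commute)
  show ?thesis
  proof (cases "F \<in> L")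
    case True
    hence FL: "F \<in> L - \<tau>" using F by auto
    have Leq: "L - \<tau> - {F} = L - insert F \<tau>" by auto
    have "(\<Sum>H\<in>L - \<tau>. sum (dual_form \<tau> G) H * X F w (insert H \<tau>)) =
        sum (dual_form \<tau> G) F * X F w (insert F \<tau>) +
        (\<Sum>H\<in>L - insert F \<tau>. sum (dual_form \<tau> G) H * X F w (insert H \<tau>))"
      using sum.remove[OF _ FL, of "\<lambda>H. sum (dual_form \<tau> G) H * X F w (insert H \<tau>)"] finite_flats Leq
      by simp
    also have "(\<Sum>H\<in>L - insert F \<tau>. sum (dual_form \<tau> G) H * X F w (insert H \<tau>)) =
        (\<Sum>H\<in>L - insert F \<tau>. sum (dual_form \<tau> G) H * w (insert H (insert F \<tau>)))"
      by (intro sum.cong refl) (auto simp: off)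
    finally show ?thesis using X_dual_insert[OF w \<tau> FL G] lhs rhs by simp
  next
    case False
    hence no: "insert F \<sigma> \<notin> chains" for \<sigma> using chainsD(1) by blast
    have "X F w (insert H \<tau>) = 0" if "H \<in> L - \<tau>" for H
    proof -
      have "X F w (insert H \<tau>) = w (insert F (insert H \<tau>))"
        using that E F False by (intro X_notin[OF w]) auto
      then show ?thesis using w no by (simp add: balanced_support)
    qed
    then show ?thesis using lhs rhs no by (simp add: X_def)
  qed
qed

lemma X_commute: "X F (X G w) = X G (X F w)"
proof (cases "balanced w")
  case w: True
  show ?thesis
  proof
    fix \<tau>
    show "X F (X G w) \<tau> = X G (X F w) \<tau>"
    proof (cases "\<tau> \<in> chains")
      case \<tau>: True
      have E: "E \<in> \<tau>" using chainsD(2)[OF \<tau>] .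
      show ?thesis
      proof (cases "F = G \<or> F \<in> \<tau> \<or> G \<in> \<tau>")
        case True
        then show ?thesis
          using X_commute_in[OF w \<tau>] X_commute_notin_in[OF w \<tau>] by metis
      next
        case False
        have "X F (X G w) \<tau> = w (insert G (insert F \<tau>))" if "F \<notin> \<tau>" "G \<notin> \<tau>" "F \<noteq> G" for F G
          using X_notin[OF X_balanced[OF w] E, of F] X_notin[OF w, of "insert F \<tau>" G] that E by simp
        from this[of F G] this[of G F] False show ?thesis by (metis insert_commute)
      qed
    qed (simp add: X_def)
  qed
next
  case False
  hence 0: "X H w = (\<lambda>_. 0)" for H by (auto simp: X_def)
  have "X H (\<lambda>_. 0) = (\<lambda>_. 0)" for H by (auto simp: X_def)
  then show ?thesis by (simp add: 0)
qed

lemma X_incomparable: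
  assumes w: "balanced w" and FG: "\<not> F \<subseteq> G" "\<not> G \<subseteq> F"
  shows "X F (X G w) = (\<lambda>_. 0)"
proof
  fix \<tau>
  have no: "\<sigma> \<notin> chains" if "F \<in> \<sigma>" "G \<in> \<sigma>" for \<sigma>
    using that FG chainsD(3)[of \<sigma> F G] by auto
  have notin: "X F (X G w) \<tau> = 0"
    if "F \<notin> \<tau>" "E \<in> \<tau>" "F \<noteq> G" and no: "\<And>\<sigma>. F \<in> \<sigma> \<Longrightarrow> G \<in> \<sigma> \<Longrightarrow> \<sigma> \<notin> chains" for F G
  proof -
    have "X F (X G w) \<tau> = X G w (insert F \<tau>)" using that by (simp add: X_notin X_balanced w)
    also have "\<dots> = 0"
    proof (cases "G \<in> \<tau>")
      case True then show ?thesis using no[of "insert F \<tau>"] by (simp add: X_def)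
    next
      case False
      then show ?thesis using that no[of "insert G (insert F \<tau>)"]
        by (simp add: X_notin w balanced_support)
    qed
    finally show ?thesis .
  qed
  show "X F (X G w) \<tau> = 0"
  proof (cases "\<tau> \<in> chains")
    case True
    hence "E \<in> \<tau>" "F \<notin> \<tau> \<or> G \<notin> \<tau>" using chainsD(2) no by auto
    then show ?thesis
      using notin[of F G] notin[of G F] no FG by (metis X_commute subset_refl)
  qed (simp add: X_def)
qed

end

section \<open>Polynomial rings and homogeneous parts\<close>

lemma poly_mapping_sum_single:
  fixes p :: "'b \<Rightarrow>\<^sub>0 'c::comm_monoid_add"
  shows "p = (\<Sum>m\<in>Poly_Mapping.keys p. Poly_Mapping.single m (Poly_Mapping.lookup p m))"
proof (rule poly_mapping_eqI)
  fix k
  have "Poly_Mapping.lookup (\<Sum>m\<in>Poly_Mapping.keys p. Poly_Mapping.single m (Poly_Mapping.lookup p m)) k =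
      (\<Sum>m\<in>Poly_Mapping.keys p. if m = k then Poly_Mapping.lookup p k else 0)"
    by (auto simp: lookup_sum lookup_single when_def intro!: sum.cong)
  also have "\<dots> = Poly_Mapping.lookup p k" by (auto simp: in_keys_iff)
  finally show "Poly_Mapping.lookup p k =
      Poly_Mapping.lookup (\<Sum>m\<in>Poly_Mapping.keys p. Poly_Mapping.single m (Poly_Mapping.lookup p m)) k"
    by simp
qed

text \<open>Monomials as multisets of variables, so that a monomial can act by a fold of commuting operators.\<close>

definition mon_mset :: "('v \<Rightarrow>\<^sub>0 nat) \<Rightarrow> 'v multiset" where
  "mon_mset m = Abs_multiset (Poly_Mapping.lookup m)"

lemma count_mon_mset: "count (mon_mset m) v = Poly_Mapping.lookup m v"
proof -
  have "{v. 0 < Poly_Mapping.lookup m v} = Poly_Mapping.keys m" by (auto simp: in_keys_iff)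
  then show ?thesis by (simp add: mon_mset_def count_Abs_multiset)
qed

lemma mon_mset_zero: "mon_mset 0 = {#}"
  by (rule multiset_eqI) (simp add: count_mon_mset)

lemma mon_mset_add: "mon_mset (m + n) = mon_mset m + mon_mset n"
  by (rule multiset_eqI) (simp add: count_mon_mset lookup_add)

lemma mon_mset_single: "mon_mset (Poly_Mapping.single v 1) = {#v#}"
  by (rule multiset_eqI) (auto simp: count_mon_mset lookup_single when_def)

lemma mon_degree_size: "mon_degree m = size (mon_mset m)"
proof -
  have "set_mset (mon_mset m) = Poly_Mapping.keys m"
    by (auto simp: set_mset_def count_mon_mset in_keys_iff)
  then show ?thesis by (simp add: mon_degree_def size_multiset_overloaded_eq count_mon_mset)
qed

lemma mon_degree_zero: "mon_degree 0 = 0"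
  by (simp add: mon_degree_def)

lemma mon_degree_add: "mon_degree (m + n) = mon_degree m + mon_degree n"
  by (simp add: mon_degree_size mon_mset_add)

lemma mon_degree_single: "mon_degree (Poly_Mapping.single v 1) = 1"
  by (simp add: mon_degree_size mon_mset_single del: One_nat_def)

lemma carrier_poly_ring:
  "p \<in> carrier (poly_ring V) \<longleftrightarrow> (\<forall>m\<in>Poly_Mapping.keys p. Poly_Mapping.keys m \<subseteq> V)"
  by (simp add: poly_ring_def)

lemma poly_ring_simps:
  "\<zero>\<^bsub>poly_ring V\<^esub> = 0" "\<one>\<^bsub>poly_ring V\<^esub> = 1" "p \<oplus>\<^bsub>poly_ring V\<^esub> q = p + q" "p \<otimes>\<^bsub>poly_ring V\<^esub> q = p * q"
  by (simp_all add: poly_ring_def)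

lemma poly_carrier_zero: "0 \<in> carrier (poly_ring V)"
  by (simp add: carrier_poly_ring)

lemma poly_carrier_add:
  "p \<in> carrier (poly_ring V) \<Longrightarrow> q \<in> carrier (poly_ring V) \<Longrightarrow> p + q \<in> carrier (poly_ring V)"
  using keys_add[of p q] by (auto simp: carrier_poly_ring)

lemma poly_carrier_uminus: "p \<in> carrier (poly_ring V) \<Longrightarrow> - p \<in> carrier (poly_ring V)"
  by (simp add: carrier_poly_ring)

lemma poly_carrier_diff:
  "p \<in> carrier (poly_ring V) \<Longrightarrow> q \<in> carrier (poly_ring V) \<Longrightarrow> p - q \<in> carrier (poly_ring V)"
  using poly_carrier_add[of p V "- q"] poly_carrier_uminus[of q V] by simp

lemma poly_carrier_mult:
  assumes "p \<in> carrier (poly_ring V)" "q \<in> carrier (poly_ring V)"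
  shows "p * q \<in> carrier (poly_ring V)"
  unfolding carrier_poly_ring
proof
  fix m assume "m \<in> Poly_Mapping.keys (p * q)"
  then obtain a b where "m = a + b" "a \<in> Poly_Mapping.keys p" "b \<in> Poly_Mapping.keys q"
    using keys_mult[of p q] by auto
  moreover from this have "Poly_Mapping.keys a \<subseteq> V" "Poly_Mapping.keys b \<subseteq> V"
    using assms by (auto simp: carrier_poly_ring)
  ultimately show "Poly_Mapping.keys m \<subseteq> V" using keys_add[of a b] by blast
qed

lemma poly_carrier_single:
  "Poly_Mapping.keys m \<subseteq> V \<Longrightarrow> Poly_Mapping.single m c \<in> carrier (poly_ring V)"
  by (simp add: carrier_poly_ring)

lemma poly_carrier_one: "1 \<in> carrier (poly_ring V)"
  by (simp add: carrier_poly_ring)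

lemma single_zero_int: "Poly_Mapping.single 0 c = (of_int c :: 'v int_poly)"
  by (metis of_int_eq_id id_apply single_of_int)

lemma poly_carrier_of_int: "of_int c \<in> carrier (poly_ring V)"
  using poly_carrier_single[of 0 V c] by (simp add: single_zero_int)

lemma poly_carrier_var: "v \<in> V \<Longrightarrow> var v \<in> carrier (poly_ring V)"
  by (simp add: var_def poly_carrier_single)

lemma poly_carrier_sum:
  "(\<And>i. i \<in> I \<Longrightarrow> f i \<in> carrier (poly_ring V)) \<Longrightarrow> (\<Sum>i\<in>I. f i) \<in> carrier (poly_ring V)"
  by (induction I rule: infinite_finite_induct) (auto simp: poly_carrier_zero poly_carrier_add)

lemma poly_carrier_prod:
  "(\<And>i. i \<in> I \<Longrightarrow> f i \<in> carrier (poly_ring V)) \<Longrightarrow> (\<Prod>i\<in>I. f i) \<in> carrier (poly_ring V)"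
  by (induction I rule: infinite_finite_induct) (auto simp: poly_carrier_one poly_carrier_mult)

lemma poly_carrier_power: "p \<in> carrier (poly_ring V) \<Longrightarrow> p ^ k \<in> carrier (poly_ring V)"
  by (induction k) (auto simp: poly_carrier_one poly_carrier_mult)

lemma cring_poly_ring: "cring (poly_ring V)"
proof (rule cringI)
  show "abelian_group (poly_ring V)"
  proof (rule abelian_groupI)
    fix p assume "p \<in> carrier (poly_ring V)"
    then show "\<exists>q\<in>carrier (poly_ring V). q \<oplus>\<^bsub>poly_ring V\<^esub> p = \<zero>\<^bsub>poly_ring V\<^esub>"
      by (intro bexI[of _ "- p"]) (simp_all add: poly_ring_simps poly_carrier_uminus)
  qed (simp_all add: poly_ring_simps poly_carrier_zero poly_carrier_add algebra_simps)
  show "comm_monoid (poly_ring V)"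
    by (rule comm_monoidI)
      (simp_all add: poly_ring_simps poly_carrier_one poly_carrier_mult algebra_simps)
qed (simp add: poly_ring_simps algebra_simps)

lemma poly_ring_minus:
  assumes "p \<in> carrier (poly_ring V)" "q \<in> carrier (poly_ring V)"
  shows "p \<ominus>\<^bsub>poly_ring V\<^esub> q = p - q"
proof -
  interpret cring "poly_ring V" by (rule cring_poly_ring)
  have "\<ominus>\<^bsub>poly_ring V\<^esub> q = - q"
    using assms by (intro minus_equality) (simp_all add: poly_ring_simps poly_carrier_uminus)
  then show ?thesis by (simp add: a_minus_def poly_ring_simps)
qed

lemma ideal_poly_ringI:
  assumes sub: "I \<subseteq> carrier (poly_ring V)" and zero: "0 \<in> I"
    and add: "\<And>p q. p \<in> I \<Longrightarrow> q \<in> I \<Longrightarrow> p + q \<in> I"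
    and mult: "\<And>p q. p \<in> I \<Longrightarrow> q \<in> carrier (poly_ring V) \<Longrightarrow> q * p \<in> I"
  shows "ideal I (poly_ring V)"
proof (rule idealI)
  show "ring (poly_ring V)" using cring_poly_ring by (rule cring.axioms(1))
  interpret cring "poly_ring V" by (rule cring_poly_ring)
  show "subgroup I (add_monoid (poly_ring V))"
  proof
    fix p assume p: "p \<in> I"
    have "inv\<^bsub>add_monoid (poly_ring V)\<^esub> p = - p"
      using p sub minus_equality[of "- p" p] poly_carrier_uminus[of p V]
      by (auto simp: a_inv_def poly_ring_simps)
    then show "inv\<^bsub>add_monoid (poly_ring V)\<^esub> p \<in> I"
      using mult[OF p, of "- 1"] by (simp add: poly_carrier_uminus poly_carrier_one)
  qed (use sub zero add in \<open>auto simp: poly_ring_simps\<close>)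
  show "x \<otimes>\<^bsub>poly_ring V\<^esub> a \<in> I" "a \<otimes>\<^bsub>poly_ring V\<^esub> x \<in> I"
    if "a \<in> I" "x \<in> carrier (poly_ring V)" for a x
    using mult[OF that] by (simp_all add: poly_ring_simps mult.commute)
qed

lemma lookup_hom_part:
  "Poly_Mapping.lookup (hom_part k p) m = (if mon_degree m = k then Poly_Mapping.lookup p m else 0)"
proof -
  have "Poly_Mapping.lookup (hom_part k p) m =
      (\<Sum>n\<in>{n \<in> Poly_Mapping.keys p. mon_degree n = k}. if n = m then Poly_Mapping.lookup p m else 0)"
    unfolding hom_part_def lookup_sum by (intro sum.cong) (auto simp: lookup_single when_def)
  also have "\<dots> = (if mon_degree m = k then Poly_Mapping.lookup p m else 0)"
    by (auto simp: in_keys_iff)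
  finally show ?thesis .
qed

lemma hom_part_add: "hom_part k (p + q) = hom_part k p + hom_part k q"
  by (rule poly_mapping_eqI) (simp add: lookup_hom_part lookup_add)

lemma hom_part_zero: "hom_part k 0 = 0"
  by (rule poly_mapping_eqI) (simp add: lookup_hom_part)

lemma hom_part_sum: "hom_part k (\<Sum>i\<in>I. f i) = (\<Sum>i\<in>I. hom_part k (f i))"
  by (induction I rule: infinite_finite_induct) (simp_all add: hom_part_zero hom_part_add)

lemma hom_part_single:
  "hom_part k (Poly_Mapping.single m c) = (if mon_degree m = k then Poly_Mapping.single m c else 0)"
  by (rule poly_mapping_eqI) (auto simp: lookup_hom_part lookup_single when_def)

lemma hom_part_homogeneous:
  "homogeneous j p \<Longrightarrow> hom_part k p = (if k = j then p else 0)"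
  by (rule poly_mapping_eqI) (auto simp: lookup_hom_part homogeneous_def in_keys_iff)

lemma homogeneous_hom_part: "homogeneous k (hom_part k p)"
  by (auto simp: homogeneous_def in_keys_iff lookup_hom_part split: if_splits)

lemma poly_carrier_hom_part: "p \<in> carrier (poly_ring V) \<Longrightarrow> hom_part k p \<in> carrier (poly_ring V)"
  by (fastforce simp: carrier_poly_ring in_keys_iff lookup_hom_part split: if_splits)

lemma hom_part_single_mult:
  "hom_part k (Poly_Mapping.single m c * p) =
     (if mon_degree m \<le> k then Poly_Mapping.single m c * hom_part (k - mon_degree m) p else 0)"
proof -
  let ?s = "\<lambda>n. Poly_Mapping.single n (Poly_Mapping.lookup p n)"
  have p: "p = (\<Sum>n\<in>Poly_Mapping.keys p. ?s n)" by (rule poly_mapping_sum_single)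
  have "hom_part k (Poly_Mapping.single m c * p) =
      (\<Sum>n\<in>Poly_Mapping.keys p. hom_part k (Poly_Mapping.single m c * ?s n))"
    by (subst p) (simp add: sum_distrib_left hom_part_sum)
  also have "\<dots> = (\<Sum>n\<in>Poly_Mapping.keys p. if mon_degree m \<le> k
      then Poly_Mapping.single m c * hom_part (k - mon_degree m) (?s n) else 0)"
    by (intro sum.cong refl) (auto simp: mult_single hom_part_single mon_degree_add)
  also have "\<dots> = (if mon_degree m \<le> k then Poly_Mapping.single m c *
      hom_part (k - mon_degree m) (\<Sum>n\<in>Poly_Mapping.keys p. ?s n) else 0)"
    by (simp add: hom_part_sum sum_distrib_left)
  finally show ?thesis by (simp flip: p)
qed

lemma homogeneous_zero: "homogeneous k 0"
  by (simp add: homogeneous_def)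

lemma homogeneous_add: "homogeneous k p \<Longrightarrow> homogeneous k q \<Longrightarrow> homogeneous k (p + q)"
  using keys_add[of p q] by (auto simp: homogeneous_def)

lemma homogeneous_sum: "(\<And>i. i \<in> I \<Longrightarrow> homogeneous k (f i)) \<Longrightarrow> homogeneous k (\<Sum>i\<in>I. f i)"
  by (induction I rule: infinite_finite_induct) (auto simp: homogeneous_zero homogeneous_add)

lemma homogeneous_mult:
  assumes "homogeneous j p" "homogeneous k q"
  shows "homogeneous (j + k) (p * q)"
  unfolding homogeneous_def
proof
  fix m assume "m \<in> Poly_Mapping.keys (p * q)"
  then obtain a b where "m = a + b" "a \<in> Poly_Mapping.keys p" "b \<in> Poly_Mapping.keys q"
    using keys_mult[of p q] by auto
  then show "mon_degree m = j + k" using assms by (simp add: homogeneous_def mon_degree_add)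
qed

lemma homogeneous_var: "homogeneous 1 (var v)"
  by (simp add: homogeneous_def var_def mon_degree_single del: One_nat_def)

lemma homogeneous_of_int: "homogeneous 0 (of_int c :: 'v int_poly)"
proof -
  have "homogeneous 0 (Poly_Mapping.single 0 c :: 'v int_poly)"
    by (simp add: homogeneous_def mon_degree_zero)
  then show ?thesis by (simp add: single_zero_int)
qed

lemma homogeneous_prod_var: "finite S \<Longrightarrow> homogeneous (card S) (\<Prod>v\<in>S. var v)"
proof (induction S rule: finite_induct)
  case empty
  then show ?case using homogeneous_of_int[of 1] by simp
next
  case (insert v S)
  then show ?case using homogeneous_mult[OF homogeneous_var[of v] insert.IH] by simp
qed

lemma homogeneous_power: "homogeneous j p \<Longrightarrow> homogeneous (j * k) (p ^ k)"
proof (induction k)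
  case 0
  then show ?case using homogeneous_of_int[of 1] by simp
next
  case (Suc k)
  then show ?case using homogeneous_mult[of j p "j * k" "p ^ k"] by simp
qed

lemma single_var_add:
  "Poly_Mapping.single (Poly_Mapping.single v 1 + m) 1 = var v * (Poly_Mapping.single m 1 :: 'v int_poly)"
  by (simp add: var_def mult_single)

context loopless_matroid
begin

section \<open>The unit weight\<close>

text \<open>The fundamental weight: full chains have a flat of each positive rank.\<close>

definition unit_weight :: "'a set set \<Rightarrow> int" where
  "unit_weight \<tau> = of_bool (\<tau> \<in> chains \<and> r ` \<tau> = {1..r E})"

text \<open>A chain that becomes full by adding one flat misses a single rank \<open>s\<close>, in a gap \<open>F \<subset> G\<close> of length two.
The flats that fill it partition \<open>G - F\<close>, so a form vanishing at \<open>F\<close> and \<open>G\<close> sums to zero over them.\<close>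

lemma balanced_unit_weight: "balanced unit_weight"
  unfolding balanced_def
proof (intro conjI allI ballI impI)
  show "unit_weight \<tau> = 0" if "\<tau> \<notin> chains" for \<tau>
    using that by (simp add: unit_weight_def)
next
  fix \<tau> a assume \<tau>: "\<tau> \<in> chains" and a: "\<forall>G\<in>\<tau>. sum a G = (0::int)"
  define N where "N = {H \<in> L - \<tau>. insert H \<tau> \<in> chains \<and> r ` insert H \<tau> = {1..r E}}"
  have finN: "finite N" using finite_flats by (simp add: N_def)
  have "(\<Sum>H\<in>L - \<tau>. sum a H * unit_weight (insert H \<tau>)) = (\<Sum>H\<in>L - \<tau>. if H \<in> N then sum a H else 0)"
    by (intro sum.cong) (auto simp: unit_weight_def N_def)
  also have "\<dots> = (\<Sum>H\<in>N. sum a H)"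
    using finite_flats by (simp add: N_def flip: sum.inter_filter)
  also have "\<dots> = 0"
  proof (cases "N = {}")
    case False
    then obtain H0 where H0: "H0 \<in> N" by auto
    define s where "s = r H0"
    have ran: "insert s (r ` \<tau>) = {1..r E}" using H0 by (simp add: N_def s_def)
    have s\<tau>: "s \<notin> r ` \<tau>"
    proof
      assume "s \<in> r ` \<tau>"
      then obtain K where K: "K \<in> \<tau>" "r K = r H0" by (auto simp: s_def)
      have "inj_on r (insert {} (insert H0 \<tau>))" using H0 by (intro chain_rk_inj) (simp add: N_def)
      hence "K = H0" by (rule inj_onD) (use K in auto)
      then show False using K H0 by (simp add: N_def)
    qed
    have r\<tau>: "r ` \<tau> = {1..r E} - {s}" using ran s\<tau> by blast
    have "s \<in> {1..r E}" using ran by blast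
    hence s: "0 < s" "s \<le> r E" by auto
    obtain F G where FG: "F \<in> insert {} \<tau>" "G \<in> \<tau>" "r F < s" "s \<le> r G" "F \<subset> G"
      and below: "\<And>K. K \<in> insert {} \<tau> \<Longrightarrow> r K < s \<Longrightarrow> K \<subseteq> F"
      and above: "\<And>K. K \<in> insert {} \<tau> \<Longrightarrow> s \<le> r K \<Longrightarrow> G \<subseteq> K"
      by (rule chain_gap[OF \<tau> s]) blast
    have flF: "flat M F" using FG(1) flat_empty flatsD(1) chainsD(1)[OF \<tau>] by auto
    have flG: "flat M G" using FG(2) flatsD(1) chainsD(1)[OF \<tau>] by auto
    have rF: "Suc (r F) = s"
    proof -
      obtain K where K: "K \<in> insert {} \<tau>" "r K = s - 1"
      proof (cases "s = 1")
        case False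
        hence "s - 1 \<in> r ` \<tau>" using s by (auto simp: r\<tau>)
        then obtain K where "K \<in> \<tau>" "r K = s - 1" by (metis imageE)
        then show thesis using that by blast
      qed (use that[of "{}"] in simp)
      hence "r K \<le> r F" using below[of K] s flF flat_subset by (intro rk_mono) auto
      then show ?thesis using K FG(3) by simp
    qed
    have N: "N = {H. flat M H \<and> F \<subseteq> H \<and> H \<subseteq> G \<and> r H = s}"
    proof (intro equalityI subsetI)
      fix H assume H: "H \<in> N"
      then have HL: "H \<in> L" and ch: "insert H \<tau> \<in> chains" and ran': "insert (r H) (r ` \<tau>) = {1..r E}"
        by (auto simp: N_def)
      have "flat M H" using HL flatsD by simp
      have "s \<in> insert (r H) (r ` \<tau>)" unfolding ran' ran[symmetric] by simp
      then have rH: "r H = s" using s\<tau> by blast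
      have "F \<subseteq> H \<or> H \<subseteq> F" using FG(1) chainsD(3)[OF ch, of F H] by auto
      moreover have "\<not> H \<subseteq> F" using rk_mono[of H F] FG(3) rH flat_subset[OF flF] by auto
      ultimately have "F \<subseteq> H" by simp
      have "G \<subseteq> H \<or> H \<subseteq> G" using FG(2) chainsD(3)[OF ch, of G H] by auto
      moreover have "H = G" if "G \<subseteq> H"
        using rk_mono[of G H] FG(4) rH flatsD(3)[OF HL] that flat_rk_less[OF flG, of H] by auto
      ultimately have "H \<subseteq> G" by auto
      then show "H \<in> {H. flat M H \<and> F \<subseteq> H \<and> H \<subseteq> G \<and> r H = s}"
        using \<open>flat M H\<close> rH \<open>F \<subseteq> H\<close> by simp
    next
      fix H assume "H \<in> {H. flat M H \<and> F \<subseteq> H \<and> H \<subseteq> G \<and> r H = s}"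
      hence H: "flat M H" "F \<subseteq> H" "H \<subseteq> G" "r H = s" by auto
      have HL: "H \<in> L" using H s by (auto simp: flats_def)
      moreover have "H \<notin> \<tau>" using H s\<tau> by auto
      moreover have "insert H \<tau> \<in> chains"
      proof -
        have "H \<subseteq> K \<or> K \<subseteq> H" if "K \<in> \<tau>" for K
          using below[of K] above[of K] that H by (cases "r K < s") auto
        then show ?thesis using HL by (simp add: insert_chains_iff[OF \<tau>])
      qed
      ultimately show "H \<in> N" using ran H by (simp add: N_def)
    qed
    have eqcl: "H = cl (insert i F)" if "H \<in> N" "i \<in> H - F" for H i
      using that rF flF by (intro cl_insert_eq[symmetric]) (auto simp: N)
    have "(\<Union>H\<in>N. H - F) = G - F"
    proof (intro equalityI subsetI)
      fix i assume i: "i \<in> G - F"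
      hence iE: "i \<in> E - F" and sub: "insert i F \<subseteq> E"
        using flat_subset[OF flG] flat_subset[OF flF] by auto
      have "cl (insert i F) \<in> N"
        using flat_cl[OF sub] rk_cl_insert[OF flF iE] rF subset_cl[OF sub] cl_least[OF flG, of "insert i F"] FG(5) i
        by (auto simp: N)
      then show "i \<in> (\<Union>H\<in>N. H - F)" using i subset_cl[OF sub] by auto
    qed (auto simp: N)
    moreover have "(\<Sum>H\<in>N. sum a (H - F)) = sum a (\<Union>H\<in>N. H - F)"
    proof (rule sum.UNION_disjoint[symmetric, OF finN])
      show "\<forall>H\<in>N. finite (H - F)" using finite_sub flat_subset by (auto simp: N)
      show "\<forall>H\<in>N. \<forall>H'\<in>N. H \<noteq> H' \<longrightarrow> (H - F) \<inter> (H' - F) = {}" using eqcl by blast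
    qed
    moreover have "sum a (H - F) = sum a H" if "F \<subseteq> H" "H \<subseteq> E" for H
      using that sum_diff[of H F a] finite_sub FG(1) a by auto
    ultimately have "(\<Sum>H\<in>N. sum a H) = sum a G"
      using FG(5) flat_subset[OF flG] flat_subset by (simp add: N)
    then show ?thesis using a FG(2) by simp
  qed simp
  finally show "(\<Sum>H\<in>L - \<tau>. sum a H * unit_weight (insert H \<tau>)) = 0" .
qed

text \<open>The grading: weights of codimension \<open>k\<close>, where the cone of \<open>\<tau>\<close> has dimension \<open>card \<tau> - 1\<close>.\<close>

definition supported :: "nat \<Rightarrow> ('a set set \<Rightarrow> int) \<Rightarrow> bool" where
  "supported k w \<longleftrightarrow> (\<forall>\<tau>. w \<tau> \<noteq> 0 \<longrightarrow> card \<tau> + k = r E)"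

lemma supported_unit_weight: "supported 0 unit_weight"
proof -
  have "card \<tau> = r E" if "\<tau> \<in> chains" "r ` \<tau> = {1..r E}" for \<tau>
  proof -
    have "inj_on r \<tau>" using chain_rk_inj[OF that(1)] by (rule inj_on_subset) auto
    then show ?thesis using that(2) card_image by fastforce
  qed
  then show ?thesis by (simp add: supported_def unit_weight_def)
qed

lemma supported_X:
  assumes "supported k w"
  shows "supported (Suc k) (X F w)"
  unfolding supported_def
proof (intro allI impI)
  fix \<tau> assume nz: "X F w \<tau> \<noteq> 0"
  hence \<tau>: "\<tau> \<in> chains" by (rule contrapos_np) (simp add: X_def)
  have "\<exists>H. H \<notin> \<tau> \<and> w (insert H \<tau>) \<noteq> 0"
  proof (rule ccontr)
    assume "\<not> ?thesis"
    hence "w (insert H \<tau>) = 0" if "H \<notin> \<tau>" for H using that by blast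
    hence "X F w \<tau> = 0" by (simp add: X_def)
    then show False using nz by simp
  qed
  then obtain H where "H \<notin> \<tau>" "w (insert H \<tau>) \<noteq> 0" by blast
  then show "card \<tau> + Suc k = r E"
    using assms chainsD(4)[OF \<tau>] by (fastforce simp: supported_def)
qed

section \<open>The action of polynomials on weights\<close>

definition mon_act :: "('a set \<Rightarrow>\<^sub>0 nat) \<Rightarrow> ('a set set \<Rightarrow> int) \<Rightarrow> 'a set set \<Rightarrow> int" where
  "mon_act m w = fold_mset X w (mon_mset m)"

definition poly_act :: "'a set int_poly \<Rightarrow> ('a set set \<Rightarrow> int) \<Rightarrow> 'a set set \<Rightarrow> int" where
  "poly_act p w = (\<lambda>\<tau>. \<Sum>m\<in>Poly_Mapping.keys p. Poly_Mapping.lookup p m * mon_act m w \<tau>)"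

lemma comp_fun_commute_X: "comp_fun_commute X"
  by standard (simp add: fun_eq_iff X_commute)

lemma fold_X_add_mset: "fold_mset X w (add_mset F A) = X F (fold_mset X w A)"
  using comp_fun_commute.fold_mset_add_mset[OF comp_fun_commute_X] .

lemma mon_act_zero: "mon_act 0 w = w"
  by (simp add: mon_act_def mon_mset_zero)

lemma mon_act_add: "mon_act (m + n) w = mon_act m (mon_act n w)"
proof -
  have "mon_act (m + n) w = fold_mset X w (mon_mset n + mon_mset m)"
    by (simp add: mon_act_def mon_mset_add add.commute)
  then show ?thesis
    by (simp add: mon_act_def comp_fun_commute.fold_mset_union[OF comp_fun_commute_X])
qed

lemma mon_act_single: "mon_act (Poly_Mapping.single F 1) w = X F w"
  by (simp add: mon_act_def mon_mset_single del: One_nat_def)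

lemma balanced_fold_X: "balanced w \<Longrightarrow> balanced (fold_mset X w A)"
  by (induction A) (simp_all add: fold_X_add_mset X_balanced)

lemma balanced_mon_act: "balanced w \<Longrightarrow> balanced (mon_act m w)"
  by (simp add: mon_act_def balanced_fold_X)

lemma balanced_poly_act: "balanced w \<Longrightarrow> balanced (poly_act p w)"
  unfolding poly_act_def by (intro balanced_linear_combination balanced_mon_act)

lemma fold_X_linear_combination:
  assumes "\<And>i. i \<in> I \<Longrightarrow> balanced (w i)"
  shows "fold_mset X (\<lambda>\<tau>. \<Sum>i\<in>I. c i * w i \<tau>) A = (\<lambda>\<tau>. \<Sum>i\<in>I. c i * fold_mset X (w i) A \<tau>)"
  by (induction A) (simp_all add: fold_X_add_mset X_linear_combination balanced_fold_X assms)

lemma mon_act_linear_combination: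
  assumes "\<And>i. i \<in> I \<Longrightarrow> balanced (w i)"
  shows "mon_act m (\<lambda>\<tau>. \<Sum>i\<in>I. c i * w i \<tau>) = (\<lambda>\<tau>. \<Sum>i\<in>I. c i * mon_act m (w i) \<tau>)"
  unfolding mon_act_def using assms by (rule fold_X_linear_combination)

lemma supported_fold_X: "supported k w \<Longrightarrow> supported (k + size A) (fold_mset X w A)"
  by (induction A) (simp_all add: fold_X_add_mset supported_X)

lemma poly_act_superset:
  assumes "finite A" "Poly_Mapping.keys p \<subseteq> A"
  shows "poly_act p w \<tau> = (\<Sum>m\<in>A. Poly_Mapping.lookup p m * mon_act m w \<tau>)"
  unfolding poly_act_def using assms by (intro sum.mono_neutral_left) (auto simp: in_keys_iff)

lemma poly_act_zero: "poly_act 0 w = (\<lambda>_. 0)"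
  by (simp add: poly_act_def)

lemma poly_act_add: "poly_act (p + q) w \<tau> = poly_act p w \<tau> + poly_act q w \<tau>"
proof -
  let ?A = "Poly_Mapping.keys p \<union> Poly_Mapping.keys q"
  have "Poly_Mapping.keys (p + q) \<subseteq> ?A" by (rule keys_add)
  then show ?thesis
    by (simp add: poly_act_superset[of ?A] lookup_add distrib_right sum.distrib)
qed

lemma poly_act_minus: "poly_act (- p) w \<tau> = - poly_act p w \<tau>"
  using poly_act_add[of p "- p" w \<tau>] by (simp add: poly_act_zero)

lemma poly_act_diff: "poly_act (p - q) w \<tau> = poly_act p w \<tau> - poly_act q w \<tau>"
  using poly_act_add[of p "- q" w \<tau>] by (simp add: poly_act_minus)

lemma poly_act_sum: "poly_act (\<Sum>i\<in>I. f i) w \<tau> = (\<Sum>i\<in>I. poly_act (f i) w \<tau>)"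
  by (induction I rule: infinite_finite_induct) (simp_all add: poly_act_zero poly_act_add)

lemma poly_act_single: "poly_act (Poly_Mapping.single m c) w \<tau> = c * mon_act m w \<tau>"
  using poly_act_superset[of "{m}" "Poly_Mapping.single m c"] by simp

lemma poly_act_var: "poly_act (var F) w = X F w"
  by (rule ext) (simp add: var_def poly_act_single mon_act_single del: One_nat_def)

lemma poly_act_one: "poly_act 1 w = w"
  by (rule ext) (simp add: poly_act_single mon_act_zero flip: single_one)

lemma poly_act_mult:
  assumes w: "balanced w"
  shows "poly_act (p * q) w = poly_act p (poly_act q w)"
proof
  fix \<tau>
  let ?s = "\<lambda>p m. Poly_Mapping.single m (Poly_Mapping.lookup p m)"
  have "p * q = (\<Sum>m\<in>Poly_Mapping.keys p. ?s p m) * (\<Sum>n\<in>Poly_Mapping.keys q. ?s q n)"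
    by (simp flip: poly_mapping_sum_single)
  also have "\<dots> = (\<Sum>m\<in>Poly_Mapping.keys p. \<Sum>n\<in>Poly_Mapping.keys q.
      Poly_Mapping.single (m + n) (Poly_Mapping.lookup p m * Poly_Mapping.lookup q n))"
    by (simp add: sum_product mult_single)
  finally have "poly_act (p * q) w \<tau> = (\<Sum>m\<in>Poly_Mapping.keys p. \<Sum>n\<in>Poly_Mapping.keys q.
      Poly_Mapping.lookup p m * Poly_Mapping.lookup q n * mon_act m (mon_act n w) \<tau>)"
    by (simp only: poly_act_sum poly_act_single mon_act_add)
  also have "\<dots> = (\<Sum>m\<in>Poly_Mapping.keys p. Poly_Mapping.lookup p m *
      mon_act m (\<lambda>\<tau>. \<Sum>n\<in>Poly_Mapping.keys q. Poly_Mapping.lookup q n * mon_act n w \<tau>) \<tau>)"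
    by (simp add: mon_act_linear_combination balanced_mon_act w sum_distrib_left mult.assoc)
  finally show "poly_act (p * q) w \<tau> = poly_act p (poly_act q w) \<tau>"
    by (simp only: poly_act_def)
qed

end

section \<open>The Chow ideal\<close>

context matroid
begin

abbreviation R :: "'a set int_poly ring" where "R \<equiv> chow_poly M"

abbreviation \<I> :: "'a set int_poly set" where "\<I> \<equiv> chow_ideal M"

lemmas chow_poly_eq = chow_poly_def[of M]

definition incomparable_products :: "'a set int_poly set" where
  "incomparable_products =
     {var F * var F' | F F'. F \<in> flats M \<and> F' \<in> flats M \<and> \<not> F \<subseteq> F' \<and> \<not> F' \<subseteq> F}"

definition linear_forms :: "'a set int_poly set" where
  "linear_forms = {\<Sum>F\<in>{F \<in> flats M. i \<in> F}. var F | i. i \<in> E}"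

lemma cring_R: "cring R"
  by (simp add: chow_poly_def cring_poly_ring)

lemma generators_carrier: "incomparable_products \<subseteq> carrier R" "linear_forms \<subseteq> carrier R"
  by (auto simp: incomparable_products_def linear_forms_def chow_poly_def
      intro!: poly_carrier_mult poly_carrier_var poly_carrier_sum)

lemma ideal_IJ: "ideal (ideal_I M) R" "ideal (ideal_J M) R"
proof -
  interpret cring R by (rule cring_R)
  show "ideal (ideal_I M) R" "ideal (ideal_J M) R"
    using genideal_ideal generators_carrier
    by (simp_all add: ideal_I_def ideal_J_def incomparable_products_def linear_forms_def)
qed

lemma ideal_chow_ideal: "ideal \<I> R"
proof -
  interpret cring R by (rule cring_R)
  show ?thesis using add_ideals ideal_IJ by (simp add: chow_ideal_def)
qed

lemma chow_ideal_subset: "p \<in> \<I> \<Longrightarrow> p \<in> carrier R"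
  using ideal.Icarr[OF ideal_chow_ideal] .

lemma chow_ideal_zero: "0 \<in> \<I>"
  using additive_subgroup.zero_closed[OF ideal.axioms(1)[OF ideal_chow_ideal]]
  by (simp add: chow_poly_def poly_ring_simps)

lemma chow_ideal_add: "p \<in> \<I> \<Longrightarrow> q \<in> \<I> \<Longrightarrow> p + q \<in> \<I>"
  using additive_subgroup.a_closed[OF ideal.axioms(1)[OF ideal_chow_ideal]]
  by (simp add: chow_poly_def poly_ring_simps)

lemma chow_ideal_mult: "p \<in> \<I> \<Longrightarrow> q \<in> carrier R \<Longrightarrow> q * p \<in> \<I>"
  using ideal.I_l_closed[OF ideal_chow_ideal] by (simp add: chow_poly_def poly_ring_simps)

lemma chow_ideal_uminus: "p \<in> \<I> \<Longrightarrow> - p \<in> \<I>"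
  using chow_ideal_mult[of p "- 1"] by (simp add: chow_poly_def poly_carrier_uminus poly_carrier_one)

lemma chow_ideal_diff: "p \<in> \<I> \<Longrightarrow> q \<in> \<I> \<Longrightarrow> p - q \<in> \<I>"
  using chow_ideal_add[of p "- q"] chow_ideal_uminus[of q] by simp

lemma chow_ideal_sum: "(\<And>i. i \<in> A \<Longrightarrow> f i \<in> \<I>) \<Longrightarrow> (\<Sum>i\<in>A. f i) \<in> \<I>"
  by (induction A rule: infinite_finite_induct) (auto simp: chow_ideal_zero chow_ideal_add)

lemma generators_in_chow_ideal: "incomparable_products \<subseteq> \<I>" "linear_forms \<subseteq> \<I>"
proof -
  interpret cring R by (rule cring_R)
  have I: "incomparable_products \<subseteq> ideal_I M" and J: "linear_forms \<subseteq> ideal_J M"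
    using genideal_self[OF generators_carrier(1)] genideal_self[OF generators_carrier(2)]
    by (simp_all add: ideal_I_def ideal_J_def incomparable_products_def linear_forms_def)
  have z: "0 \<in> ideal_I M" "0 \<in> ideal_J M"
    using additive_subgroup.zero_closed[OF ideal.axioms(1)[OF ideal_IJ(1)]]
      additive_subgroup.zero_closed[OF ideal.axioms(1)[OF ideal_IJ(2)]]
    by (simp_all add: chow_poly_def poly_ring_simps)
  have K: "p + q \<in> \<I>" if "p \<in> ideal_I M" "q \<in> ideal_J M" for p q
    using that by (auto simp: chow_ideal_def set_add_def' chow_poly_def poly_ring_simps)
  show "incomparable_products \<subseteq> \<I>"
  proof
    fix p assume "p \<in> incomparable_products"
    then show "p \<in> \<I>" using K[of p 0] I z by auto
  qed
  show "linear_forms \<subseteq> \<I>"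
  proof
    fix p assume "p \<in> linear_forms"
    then show "p \<in> \<I>" using K[of 0 p] J z by auto
  qed
qed

text \<open>The universal property through which statements about all elements of the Chow ideal are proved: the
polynomials with the desired property form an ideal, and it contains the generators.\<close>

lemma chow_ideal_least:
  assumes I: "ideal I R" and gens: "incomparable_products \<subseteq> I" "linear_forms \<subseteq> I"
  shows "\<I> \<subseteq> I"
proof
  interpret cring R by (rule cring_R)
  fix x assume "x \<in> \<I>"
  then obtain p q where pq: "p \<in> ideal_I M" "q \<in> ideal_J M" "x = p \<oplus>\<^bsub>R\<^esub> q"
    by (auto simp: chow_ideal_def set_add_def')
  have "ideal_I M \<subseteq> I" "ideal_J M \<subseteq> I"
    using genideal_minimal[OF I] gens
    by (simp_all add: ideal_I_def ideal_J_def incomparable_products_def linear_forms_def)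
  then show "x \<in> I"
    using pq additive_subgroup.a_closed[OF ideal.axioms(1)[OF I]] by blast
qed

lemma chow_ideal_incomparable:
  assumes "F \<in> flats M" "G \<in> flats M" "\<not> F \<subseteq> G" "\<not> G \<subseteq> F"
  shows "var F * var G \<in> \<I>"
  using generators_in_chow_ideal(1) assms by (auto simp: incomparable_products_def)

text \<open>Integer combinations of the generators of \<open>J\<close>: every linear form on the ambient space gives a relation.\<close>

lemma chow_ideal_linear: "(\<Sum>F\<in>flats M. of_int (sum a F) * var F) \<in> \<I>"
proof -
  have "(\<Sum>i\<in>E. of_int (a i) * (\<Sum>F\<in>{F \<in> flats M. i \<in> F}. var F)) =
      (\<Sum>i\<in>E. \<Sum>F\<in>{F \<in> flats M. i \<in> F}. of_int (a i) * (var F :: 'a set int_poly))"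
    by (simp add: sum_distrib_left)
  also have "\<dots> = (\<Sum>F\<in>flats M. \<Sum>i\<in>{i \<in> E. i \<in> F}. of_int (a i) * var F)"
    by (rule sum.swap_restrict[OF finite_ground finite_flats])
  also have "\<dots> = (\<Sum>F\<in>flats M. of_int (sum a F) * var F)"
  proof (rule sum.cong[OF refl])
    fix F assume "F \<in> flats M"
    hence "{i \<in> E. i \<in> F} = F" using flat_subset by (auto simp: flats_def)
    then show "(\<Sum>i\<in>{i \<in> E. i \<in> F}. of_int (a i) * var F) = of_int (sum a F) * (var F :: 'a set int_poly)"
      by (simp add: sum_distrib_right)
  qed
  finally have eq: "(\<Sum>F\<in>flats M. of_int (sum a F) * var F) =
      (\<Sum>i\<in>E. of_int (a i) * (\<Sum>F\<in>{F \<in> flats M. i \<in> F}. var F) :: 'a set int_poly)" by simp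
  show ?thesis unfolding eq
  proof (rule chow_ideal_sum, rule chow_ideal_mult)
    fix i assume "i \<in> E"
    then show "(\<Sum>F\<in>{F \<in> flats M. i \<in> F}. var F) \<in> \<I>"
      using generators_in_chow_ideal(2) by (auto simp: linear_forms_def)
  qed (simp add: chow_poly_def poly_carrier_of_int)
qed

lemma chow_class_eq_iff:
  assumes "p \<in> carrier R" "q \<in> carrier R"
  shows "chow_class M p = chow_class M q \<longleftrightarrow> p - q \<in> \<I>"
proof -
  interpret cring R by (rule cring_R)
  show ?thesis
    using quotient_eq_iff_same_a_r_cos[OF ideal_chow_ideal assms] poly_ring_minus[of p "flats M" q] assms
    by (simp add: chow_class_def chow_poly_def)
qed

lemma chow_class_add:
  assumes "p \<in> carrier R" "q \<in> carrier R"
  shows "chow_class M p \<oplus>\<^bsub>chow_ring M\<^esub> chow_class M q = chow_class M (p + q)"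
  using ideal.a_rcos_sum[OF ideal_chow_ideal assms]
  by (simp add: chow_class_def chow_ring_def FactRing_def chow_poly_def poly_ring_simps)

lemma chow_class_mult:
  assumes "p \<in> carrier R" "q \<in> carrier R"
  shows "chow_class M p \<otimes>\<^bsub>chow_ring M\<^esub> chow_class M q = chow_class M (p * q)"
  using ideal.rcoset_mult_add[OF ideal_chow_ideal assms]
  by (simp add: chow_class_def chow_ring_def FactRing_def chow_poly_def poly_ring_simps)

lemma mem_chow_class_iff:
  assumes "p \<in> carrier R"
  shows "q \<in> chow_class M p \<longleftrightarrow> q - p \<in> \<I>"
proof -
  have "q \<in> chow_class M p \<longleftrightarrow> (\<exists>k\<in>\<I>. q = k + p)"
    by (auto simp: chow_class_def a_r_coset_def' chow_poly_def poly_ring_simps)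
  also have "\<dots> \<longleftrightarrow> q - p \<in> \<I>" by (metis add_diff_cancel_right' diff_add_cancel)
  finally show ?thesis .
qed

lemma chow_class_carrier: "p \<in> carrier R \<Longrightarrow> chow_class M p \<in> carrier (chow_ring M)"
  using ring_hom_closed[OF ideal.rcos_ring_hom[OF ideal_chow_ideal]] by (simp add: chow_class_def chow_ring_def)

lemma chow_ring_zero: "\<zero>\<^bsub>chow_ring M\<^esub> = chow_class M 0"
proof -
  interpret cring R by (rule cring_R)
  have "\<zero>\<^bsub>chow_ring M\<^esub> = \<I>" by (simp add: chow_ring_def FactRing_def)
  also have "\<I> = chow_class M 0"
    using a_rcos_zero[OF ideal_chow_ideal, of 0] chow_ideal_zero by (simp add: chow_class_def)
  finally show ?thesis .
qed

text \<open>The Chow ideal is homogeneous, because its generators are and because the polynomials all of whose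
homogeneous parts lie in it form an ideal.\<close>

lemma chow_ideal_hom_part:
  assumes "p \<in> \<I>"
  shows "hom_part k p \<in> \<I>"
proof -
  define I where "I = {p \<in> carrier R. \<forall>k. hom_part k p \<in> \<I>}"
  have homog: "p \<in> I" if "p \<in> \<I>" "homogeneous j p" for p j
    using that chow_ideal_subset by (auto simp: I_def hom_part_homogeneous chow_ideal_zero)
  have "ideal I R" unfolding chow_poly_eq
  proof (rule ideal_poly_ringI)
    show "I \<subseteq> carrier (poly_ring (flats M))" by (auto simp: I_def chow_poly_def)
    show "0 \<in> I" using homog[OF chow_ideal_zero] by (simp add: homogeneous_zero)
    show "p + q \<in> I" if "p \<in> I" "q \<in> I" for p q
      using that by (auto simp: I_def hom_part_add chow_ideal_add chow_poly_def poly_carrier_add)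
    show "q * p \<in> I" if p: "p \<in> I" and q: "q \<in> carrier (poly_ring (flats M))" for p q
    proof -
      let ?s = "\<lambda>m. Poly_Mapping.single m (Poly_Mapping.lookup q m)"
      have "hom_part k (q * p) \<in> \<I>" for k
      proof -
        have "hom_part k (q * p) = (\<Sum>m\<in>Poly_Mapping.keys q. hom_part k (?s m * p))"
          by (subst poly_mapping_sum_single[of q]) (simp add: sum_distrib_right hom_part_sum)
        also have "\<dots> \<in> \<I>"
        proof (rule chow_ideal_sum)
          fix m assume "m \<in> Poly_Mapping.keys q"
          hence "?s m \<in> carrier R"
            using q by (simp add: chow_poly_def poly_carrier_single carrier_poly_ring)
          then show "hom_part k (?s m * p) \<in> \<I>"
            using p by (auto simp: hom_part_single_mult I_def chow_ideal_mult chow_ideal_zero)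
        qed
        finally show ?thesis .
      qed
      then show ?thesis using p q by (auto simp: I_def chow_poly_def poly_carrier_mult)
    qed
  qed
  moreover have "incomparable_products \<subseteq> I"
  proof
    fix p assume p: "p \<in> incomparable_products"
    then obtain F G where "p = var F * var G" by (auto simp: incomparable_products_def)
    hence "homogeneous (1 + 1) p" using homogeneous_mult[OF homogeneous_var homogeneous_var] by simp
    then show "p \<in> I" using p generators_in_chow_ideal(1) homog by blast
  qed
  moreover have "linear_forms \<subseteq> I"
  proof
    fix p assume p: "p \<in> linear_forms"
    hence "homogeneous 1 p"
      by (auto simp: linear_forms_def simp del: One_nat_def intro!: homogeneous_sum homogeneous_var)
    then show "p \<in> I" using p generators_in_chow_ideal(2) homog by blast
  qed
  ultimately have "\<I> \<subseteq> I" by (rule chow_ideal_least)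
  then show ?thesis using assms by (auto simp: I_def)
qed

lemma chow_component_class:
  assumes p: "p \<in> carrier R"
  shows "chow_component M k (chow_class M p) = chow_class M (hom_part k p)"
proof -
  have "chow_class M (hom_part k q) = chow_class M (hom_part k p)" if "q \<in> chow_class M p" for q
  proof -
    have qp: "q - p \<in> \<I>" using that mem_chow_class_iff[OF p] by simp
    have q: "q \<in> carrier R"
      using poly_carrier_add[of "q - p" "flats M" p] chow_ideal_subset[OF qp] p by (simp add: chow_poly_def)
    have "hom_part k q = hom_part k (q - p) + hom_part k p" by (simp flip: hom_part_add)
    hence "hom_part k q - hom_part k p \<in> \<I>" using chow_ideal_hom_part[OF qp] by simp
    then show ?thesis
      using p q by (subst chow_class_eq_iff) (simp_all add: chow_poly_def poly_carrier_hom_part)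
  qed
  moreover have "p \<in> chow_class M p" using mem_chow_class_iff[OF p] chow_ideal_zero by simp
  ultimately have "(\<lambda>q. chow_class M (hom_part k q)) ` chow_class M p = {chow_class M (hom_part k p)}"
    by blast
  then show ?thesis by (simp add: chow_component_def)
qed

end

context loopless_matroid
begin

section \<open>The Chow ring acts on balanced weights\<close>

text \<open>For the generators of \<open>J\<close> this is the linear relation of a coordinate, and for those of \<open>I\<close> it is
\<open>X_incomparable\<close>.\<close>

lemma poly_act_chow_ideal:
  assumes p: "p \<in> \<I>" and w: "balanced w"
  shows "poly_act p w = (\<lambda>_. 0)"
proof -
  define I where "I = {p \<in> carrier R. \<forall>w. balanced w \<longrightarrow> poly_act p w = (\<lambda>_. 0)}"
  have zero: "poly_act q (\<lambda>_. 0) = (\<lambda>_. 0)" for q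
    using poly_act_mult[OF w, of q 0] by (simp add: poly_act_zero)
  have "ideal I R" unfolding chow_poly_eq
  proof (rule ideal_poly_ringI)
    show "I \<subseteq> carrier (poly_ring (flats M))" by (auto simp: I_def chow_poly_def)
    show "0 \<in> I" using chow_ideal_subset[OF chow_ideal_zero] by (simp add: I_def poly_act_zero)
    show "p + q \<in> I" if "p \<in> I" "q \<in> I" for p q
      using that by (auto simp: I_def fun_eq_iff poly_act_add chow_poly_def poly_carrier_add)
    show "q * p \<in> I" if "p \<in> I" "q \<in> carrier (poly_ring (flats M))" for p q
      using that by (auto simp: I_def poly_act_mult zero chow_poly_def poly_carrier_mult)
  qed
  moreover have "incomparable_products \<subseteq> I"
  proof
    fix p assume p: "p \<in> incomparable_products"
    then obtain F G where "p = var F * var G" "\<not> F \<subseteq> G" "\<not> G \<subseteq> F"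
      by (auto simp: incomparable_products_def)
    then show "p \<in> I" using p generators_carrier(1)
      by (auto simp: I_def poly_act_mult poly_act_var X_incomparable)
  qed
  moreover have "linear_forms \<subseteq> I"
  proof
    fix p assume p: "p \<in> linear_forms"
    then obtain i where i: "i \<in> E" "p = (\<Sum>F\<in>{F \<in> L. i \<in> F}. var F)"
      by (auto simp: linear_forms_def)
    have "poly_act p w \<tau> = 0" if w: "balanced w" for w \<tau>
    proof -
      have "poly_act p w \<tau> = (\<Sum>F\<in>{F \<in> L. i \<in> F}. X F w \<tau>)"
        by (simp add: i poly_act_sum poly_act_var)
      also have "\<dots> = (\<Sum>F\<in>L. if i \<in> F then X F w \<tau> else 0)"
        using finite_flats by (intro sum.inter_filter)
      also have "\<dots> = (\<Sum>F\<in>L. sum (\<lambda>j. of_bool (j = i)) F * X F w \<tau>)"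
        by (intro sum.cong refl) (simp add: sum_unit_form flatsD)
      also have "\<dots> = 0" using X_linear_relation[OF w] .
      finally show ?thesis .
    qed
    then show "p \<in> I" using p generators_carrier(2) by (auto simp: I_def fun_eq_iff)
  qed
  ultimately have "\<I> \<subseteq> I" by (rule chow_ideal_least)
  then show ?thesis using p w by (auto simp: I_def)
qed

section \<open>Generators in top degree\<close>

lemma flags_iff: "\<F> \<in> flags M \<longleftrightarrow> insert E \<F> \<in> chains \<and> E \<notin> \<F>"
  using flatsD(3) ground_in_flats by (fastforce simp: flags_def chains_def proper_flats_def)

lemma finite_flag: "\<F> \<in> flags M \<Longrightarrow> finite \<F>"
  using chainsD(4) by (fastforce simp: flags_iff)

text \<open>If a rank were missing, closing up \<open>insert i F\<close> in the gap \<open>F \<subset> G\<close> at that rank, with \<open>i \<in> G - F\<close>,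
would give a flat extending the flag.\<close>

lemma maximal_flag_full:
  assumes max: "\<F> \<in> maximal_flags M"
  shows "r ` insert E \<F> = {1..r E}"
proof (rule ccontr)
  define \<tau> where "\<tau> = insert E \<F>"
  have \<tau>: "\<tau> \<in> chains" and E: "E \<notin> \<F>" using max by (auto simp: maximal_flags_def flags_iff \<tau>_def)
  assume "r ` insert E \<F> \<noteq> {1..r E}"
  hence "\<not> {1..r E} \<subseteq> r ` \<tau>"
    using rk_image_chain(1)[OF \<tau>] unfolding \<tau>_def by (metis subset_antisym)
  then obtain s where s: "s \<in> {1..r E}" "s \<notin> r ` \<tau>" by (metis subsetI)
  hence s': "0 < s" "s \<le> r E" by auto
  obtain F G where FG: "F \<in> insert {} \<tau>" "G \<in> \<tau>" "r F < s" "s \<le> r G" "F \<subset> G"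
    and below: "\<And>K. K \<in> insert {} \<tau> \<Longrightarrow> r K < s \<Longrightarrow> K \<subseteq> F"
    and above: "\<And>K. K \<in> insert {} \<tau> \<Longrightarrow> s \<le> r K \<Longrightarrow> G \<subseteq> K"
    by (rule chain_gap[OF \<tau> s']) blast
  have flF: "flat M F" using chain_flat[OF \<tau> FG(1)] .
  have flG: "flat M G" by (rule chain_flat[OF \<tau>]) (use FG(2) in simp)
  obtain i where i: "i \<in> G - F" using FG by auto
  define H where "H = cl (insert i F)"
  have iE: "i \<in> E - F" and sub: "insert i F \<subseteq> E"
    using i flat_subset[OF flG] flat_subset[OF flF] by auto
  have H: "flat M H" "insert i F \<subseteq> H" "H \<subseteq> G" "r H = Suc (r F)"
    using flat_cl[OF sub] subset_cl[OF sub] cl_least[OF flG, of "insert i F"] rk_cl_insert[OF flF iE] i FG(5)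
    by (auto simp: H_def)
  have HL: "H \<in> L" using H by (auto simp: flats_def)
  have "s \<noteq> r G" using s FG(2) by auto
  hence rH: "r H < r G" "r H \<le> s" using FG H by auto
  have "H \<notin> \<tau>"
  proof
    assume "H \<in> \<tau>"
    hence "r H \<noteq> s" using s by blast
    hence "H \<subseteq> F" using below[of H] \<open>H \<in> \<tau>\<close> rH by auto
    then show False using H i by auto
  qed
  moreover have "insert H \<tau> \<in> chains"
  proof -
    have "H \<subseteq> K \<or> K \<subseteq> H" if "K \<in> \<tau>" for K
      using below[of K] above[of K] that H by (cases "r K < s") auto
    then show ?thesis using HL insert_chains_iff[OF \<tau>] by blast
  qed
  ultimately have "insert H \<F> \<in> flags M" "H \<notin> \<F>" using E by (auto simp: flags_iff insert_commute \<tau>_def)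
  then show False using max by (auto simp: maximal_flags_def)
qed

lemma maximal_flag_exists: "\<exists>\<F>. \<F> \<in> maximal_flags M"
proof -
  have "flags M \<subseteq> Pow L" by (auto simp: flags_def proper_flats_def)
  hence fin: "finite (flags M)" using finite_flats by (simp add: finite_subset)
  have "{} \<in> flags M" by (simp add: flags_def)
  hence "flags M \<noteq> {}" by blast
  from finite_has_maximal[OF fin this] show ?thesis by (auto simp: maximal_flags_def)
qed

lemma chow_ideal_sum_containing: "i \<in> E \<Longrightarrow> (\<Sum>F\<in>{F \<in> L. i \<in> F}. var F) \<in> \<I>"
  using generators_in_chow_ideal(2) by (auto simp: linear_forms_def)

lemma var_carrier: "F \<in> L \<Longrightarrow> var F \<in> carrier R"
  by (simp add: chow_poly_def poly_carrier_var)

lemma carrier_mult: "p \<in> carrier R \<Longrightarrow> q \<in> carrier R \<Longrightarrow> p * q \<in> carrier R"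
  by (simp add: chow_poly_def poly_carrier_mult)

lemma carrier_of_int: "of_int c \<in> carrier R"
  by (simp add: chow_poly_def poly_carrier_of_int)

lemma carrier_prod_var: "S \<subseteq> L \<Longrightarrow> (\<Prod>F\<in>S. var F) \<in> carrier R"
  by (auto simp: chow_poly_def intro!: poly_carrier_prod poly_carrier_var)

lemma carrier_neg_var_ground: "(- var E) ^ n \<in> carrier R"
  using var_carrier[OF ground_in_flats]
  by (simp add: chow_poly_def poly_carrier_power poly_carrier_uminus)

text \<open>Choose \<open>i\<close> outside \<open>H\<close> and trade one factor \<open>- x\<^sub>E\<close> for the sum of the other \<open>x\<^sub>F\<close> with \<open>i \<in> F\<close>.  Next to
\<open>x\<^sub>H\<close> only flats strictly above \<open>H\<close> survive, so the rank goes up with every factor spent.\<close>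

lemma var_times_ground_power:
  assumes "H \<in> L" "H \<noteq> E" "r E - r H \<le> n"
  shows "(- var E) ^ n * var H \<in> \<I>"
  using assms
proof (induction n arbitrary: H)
  case 0
  have "r H < r E" using flat_rk_less[of H E] 0 flatsD[of H] by auto
  then show ?case using 0 by simp
next
  case (Suc n)
  obtain i where i: "i \<in> E - H" using Suc.prems flatsD(3)[of H] by auto
  let ?S = "{F \<in> L. i \<in> F} - {E}"
  have E: "E \<in> {F \<in> L. i \<in> F}" using i ground_in_flats by simp
  have "(- var E) ^ n * var H * (\<Sum>F\<in>{F \<in> L. i \<in> F}. var F) =
      (\<Sum>F\<in>?S. (- var E) ^ n * var H * var F) - (- var E) ^ Suc n * var H"
    using finite_flats by (simp add: sum.remove[OF _ E] distrib_left sum_distrib_left algebra_simps)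
  hence eq: "(- var E) ^ Suc n * var H = (\<Sum>F\<in>?S. (- var E) ^ n * var H * var F) -
      (- var E) ^ n * var H * (\<Sum>F\<in>{F \<in> L. i \<in> F}. var F)"
    by simp
  have "(- var E) ^ n * var H * var F \<in> \<I>" if F: "F \<in> ?S" for F
  proof (cases "F \<subseteq> H \<or> H \<subseteq> F")
    case True
    hence "H \<subset> F" using F i by auto
    hence "r H < r F" using flat_rk_less[of H F] flatsD Suc.prems(1) F by auto
    hence "(- var E) ^ n * var F \<in> \<I>" using Suc F by auto
    from chow_ideal_mult[OF this var_carrier[OF Suc.prems(1)]] show ?thesis by (simp add: ac_simps)
  next
    case False
    hence "var H * var F \<in> \<I>" using F Suc.prems by (intro chow_ideal_incomparable) auto
    from chow_ideal_mult[OF this carrier_neg_var_ground] show ?thesis by (simp add: ac_simps)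
  qed
  hence "(\<Sum>F\<in>?S. (- var E) ^ n * var H * var F) \<in> \<I>" by (rule chow_ideal_sum)
  moreover have "(- var E) ^ n * var H * (\<Sum>F\<in>{F \<in> L. i \<in> F}. var F) \<in> \<I>"
    using i Suc.prems
    by (intro chow_ideal_mult[OF chow_ideal_sum_containing] carrier_mult carrier_neg_var_ground var_carrier) auto
  ultimately show ?case unfolding eq by (rule chow_ideal_diff)
qed

text \<open>The flats of a full chain are built in one after the other, each at the cost of one factor \<open>- x\<^sub>E\<close>.
If \<open>F\<close> and \<open>G\<close> are the members of rank \<open>j\<close> and \<open>j + 1\<close> and \<open>i \<in> G - F\<close>, then \<open>- x\<^sub>E\<close> is the sum of
the other \<open>x\<^sub>H\<close> with \<open>i \<in> H\<close>.  Those compatible with \<open>F\<close> contain \<open>G\<close>, and the ones strictly above \<open>G\<close>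
are killed by the remaining power of \<open>x\<^sub>E\<close>.\<close>

lemma full_chain_product:
  assumes \<tau>: "\<tau> \<in> chains" and full: "r ` \<tau> = {1..r E}"
  shows "(\<Prod>F\<in>\<tau> - {E}. var F) - (- var E) ^ fan_dim M \<in> \<I>"
proof -
  let ?d = "fan_dim M"
  have d: "r E = Suc ?d" using rk_ground_pos by (simp add: fan_dim_def)
  have fin: "finite \<tau>" using chainsD(4)[OF \<tau>] .
  define P where "P j = (\<Prod>F\<in>{F \<in> \<tau>. r F \<le> j}. var F :: 'a set int_poly)" for j
  have Pcar: "P j \<in> carrier R" for j
    unfolding P_def using chainsD(1)[OF \<tau>] by (intro carrier_prod_var) auto
  have step: "(- var E) ^ (?d - j) * P j - (- var E) ^ (?d - Suc j) * P (Suc j) \<in> \<I>" if j: "j < ?d" for j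
  proof -
    have s: "0 < Suc j" "Suc j \<le> r E" using j d by auto
    obtain F G where FG: "F \<in> insert {} \<tau>" "G \<in> \<tau>" "r F < Suc j" "Suc j \<le> r G" "F \<subset> G"
      and below: "\<And>K. K \<in> insert {} \<tau> \<Longrightarrow> r K < Suc j \<Longrightarrow> K \<subseteq> F"
      and above: "\<And>K. K \<in> insert {} \<tau> \<Longrightarrow> Suc j \<le> r K \<Longrightarrow> G \<subseteq> K"
      by (rule chain_gap[OF \<tau> s]) blast
    have flF: "flat M F" using chain_flat[OF \<tau> FG(1)] .
    have GL: "G \<in> L" using FG(2) chainsD(1)[OF \<tau>] by auto
    have flG: "flat M G" using flatsD(1)[OF GL] .
    have rG: "r G = Suc j"
    proof -
      have "Suc j \<in> r ` \<tau>" using s by (simp add: full)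
      then obtain K where "K \<in> \<tau>" "r K = Suc j" by (metis imageE)
      then show ?thesis using above[of K] FG(4) chainsD(1)[OF \<tau>] flatsD(3)[of K] rk_mono[of G K] by auto
    qed
    have rF: "r F = j"
    proof (cases "j = 0")
      case False
      hence "j \<in> r ` \<tau>" using s by (simp add: full)
      then obtain K where "K \<in> \<tau>" "r K = j" by (metis imageE)
      then show ?thesis using below[of K] FG(3) flat_subset[OF flF] rk_mono[of K F] by auto
    qed (use FG(3) in simp)
    have PSuc: "P (Suc j) = var G * P j"
    proof -
      have "{F \<in> \<tau>. r F \<le> Suc j} = insert G {F \<in> \<tau>. r F \<le> j}"
      proof (intro equalityI subsetI)
        fix H assume H: "H \<in> {F \<in> \<tau>. r F \<le> Suc j}"
        show "H \<in> insert G {F \<in> \<tau>. r F \<le> j}"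
        proof (cases "r H = Suc j")
          case True
          then have "H = G" using inj_onD[OF chain_rk_inj[OF \<tau>], of H G] H FG(2) rG by auto
          then show ?thesis by simp
        qed (use H in auto)
      qed (use FG(2) rG in auto)
      then show ?thesis using fin rG by (simp add: P_def)
    qed
    obtain i where i: "i \<in> G - F" using FG by auto
    have GE: "G \<noteq> E" using rG j d by auto
    have iE: "i \<in> E" using i flatsD(3)[OF GL] by auto
    let ?A = "{F \<in> L. i \<in> F}" let ?S = "?A - {E} - {G}"
    have EG: "E \<in> ?A" "G \<in> ?A - {E}" using iE ground_in_flats GL GE i by auto
    have sum: "(\<Sum>F\<in>?A. var F) = var E + (var G + (\<Sum>F\<in>?S. var F :: 'a set int_poly))"
      using finite_flats sum.remove[OF _ EG(1), of var] sum.remove[OF _ EG(2), of var] by simp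
    let ?n = "?d - Suc j"
    have n: "?d - j = Suc ?n" using j by simp
    have eq: "(- var E) ^ (?d - j) * P j - (- var E) ^ ?n * P (Suc j) =
        (\<Sum>H\<in>?S. (- var E) ^ ?n * P j * var H) - (- var E) ^ ?n * P j * (\<Sum>F\<in>?A. var F)"
      unfolding n PSuc sum by (simp add: sum_distrib_left algebra_simps)
    have "(- var E) ^ ?n * P j * var H \<in> \<I>" if H: "H \<in> ?S" for H
    proof (cases "F \<subseteq> H \<or> H \<subseteq> F")
      case True
      hence FH: "F \<subset> H" using H i by auto
      have Gcl: "cl (insert i F) = G" using cl_insert_eq[OF flF flG] FG(5) rF rG i by auto
      have "G \<subseteq> H" using cl_least[of H "insert i F"] flatsD H FH by (auto simp: Gcl)
      hence "r G < r H" using flat_rk_less[OF flG, of H] H flatsD(3) by auto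
      hence "(- var E) ^ ?n * var H \<in> \<I>" using H rG d by (intro var_times_ground_power) auto
      from chow_ideal_mult[OF this Pcar[of j]] show ?thesis by (simp add: ac_simps)
    next
      case False
      hence F\<tau>: "F \<in> \<tau>" using FG(1) by auto
      hence FL: "F \<in> L" using chainsD(1)[OF \<tau>] by auto
      have "P j = var F * (\<Prod>F\<in>{F \<in> \<tau>. r F \<le> j} - {F}. var F)"
        unfolding P_def using fin F\<tau> rF by (intro prod.remove) auto
      hence "(- var E) ^ ?n * P j * var H =
          ((- var E) ^ ?n * (\<Prod>F\<in>{F \<in> \<tau>. r F \<le> j} - {F}. var F)) * (var F * var H)"
        by (simp add: ac_simps)
      also have "\<dots> \<in> \<I>"
        using False FL H chainsD(1)[OF \<tau>]
        by (intro chow_ideal_mult chow_ideal_incomparable carrier_mult carrier_neg_var_ground carrier_prod_var) auto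
      finally show ?thesis .
    qed
    hence "(\<Sum>H\<in>?S. (- var E) ^ ?n * P j * var H) \<in> \<I>" by (rule chow_ideal_sum)
    moreover have "(- var E) ^ ?n * P j * (\<Sum>F\<in>?A. var F) \<in> \<I>"
      by (intro chow_ideal_mult[OF chow_ideal_sum_containing[OF iE]] carrier_mult carrier_neg_var_ground Pcar)
    ultimately show ?thesis unfolding eq by (rule chow_ideal_diff)
  qed
  have "(- var E) ^ ?d - (- var E) ^ (?d - j) * P j \<in> \<I>" if "j \<le> ?d" for j
    using that
  proof (induction j)
    case 0
    have "{F \<in> \<tau>. r F \<le> 0} = {}" using rk_image_chain(1)[OF \<tau>] by fastforce
    hence "P 0 = 1" unfolding P_def by (simp only: prod.empty)
    then show ?case by (simp add: chow_ideal_zero)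
  next
    case (Suc j)
    then have "(- var E) ^ ?d - (- var E) ^ (?d - j) * P j \<in> \<I>" by simp
    from chow_ideal_add[OF this step[of j]] Suc.prems show ?case by simp
  qed
  from chow_ideal_uminus[OF this[of ?d]] have "P ?d - (- var E) ^ ?d \<in> \<I>" by simp
  moreover have "{F \<in> \<tau>. r F \<le> ?d} = \<tau> - {E}"
  proof (intro equalityI subsetI)
    fix F assume F: "F \<in> \<tau> - {E}"
    hence FL: "F \<in> L" using chainsD(1)[OF \<tau>] by auto
    have "r F < r E" using flat_rk_less[of F E] F flatsD[OF FL] by auto
    then show "F \<in> {F \<in> \<tau>. r F \<le> ?d}" using d F by auto
  qed (use d in auto)
  ultimately show ?thesis by (simp add: P_def)
qed

text \<open>Induction on the degree of the monomial.  A variable outside \<open>\<tau>\<close> enlarges the chain or gives zero, and a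
variable in \<open>\<tau>\<close> is replaced by variables outside \<open>\<tau>\<close> with the help of its dual form.\<close>

lemma square_free_reduction:
  assumes "\<tau> \<in> chains" "Poly_Mapping.keys m \<subseteq> L" "card \<tau> + mon_degree m = r E"
  shows "\<exists>c. (\<Prod>F\<in>\<tau> - {E}. var F) * Poly_Mapping.single m 1 - of_int c * (- var E) ^ fan_dim M \<in> \<I>"
  using assms
proof (induction "mon_degree m" arbitrary: \<tau> m)
  case 0
  have "m = 0"
  proof (rule poly_mapping_eqI)
    fix v
    show "Poly_Mapping.lookup m v = Poly_Mapping.lookup 0 v"
      using 0(1) count_mon_mset[of m v] by (simp add: mon_degree_size)
  qed
  moreover have "r ` \<tau> = {1..r E}" using 0 full_chain_iff[of \<tau>] by simp
  ultimately show ?case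
    using full_chain_product[OF 0(2)] by (intro exI[of _ 1]) simp
next
  case (Suc k)
  let ?P = "\<lambda>\<tau>. \<Prod>F\<in>\<tau> - {E}. var F :: 'a set int_poly"
  let ?u = "(- var E) ^ fan_dim M :: 'a set int_poly"
  note \<tau> = Suc.prems(1)
  have E: "E \<in> \<tau>" and sub: "\<tau> \<subseteq> L" and fin: "finite \<tau>" using chainsD[OF \<tau>] by auto
  obtain F where F: "F \<in> Poly_Mapping.keys m"
    using Suc(2) by (fastforce simp: mon_degree_def)
  define n where "n = m - Poly_Mapping.single F 1"
  have mn: "m = Poly_Mapping.single F 1 + n"
  proof (rule poly_mapping_eqI)
    fix v
    show "Poly_Mapping.lookup m v = Poly_Mapping.lookup (Poly_Mapping.single F 1 + n) v"
      using F by (cases "v = F") (auto simp: n_def lookup_add lookup_minus lookup_single in_keys_iff)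
  qed
  have deg: "mon_degree m = Suc (mon_degree n)"
    by (simp add: mn mon_degree_add mon_degree_single del: One_nat_def)
  have nL: "Poly_Mapping.keys n \<subseteq> L"
    using Suc.prems(2) by (auto simp: mn in_keys_iff lookup_add)
  hence ncar: "Poly_Mapping.single n 1 \<in> carrier R"
    by (simp add: chow_poly_def poly_carrier_single)
  have FL: "F \<in> L" using F Suc.prems by auto
  have Pcar: "?P \<tau> \<in> carrier R" using sub by (intro carrier_prod_var) auto
  have new: "\<exists>c. ?P \<tau> * var H * Poly_Mapping.single n 1 - of_int c * ?u \<in> \<I>" if H: "H \<in> L - \<tau>" for H
  proof (cases "insert H \<tau> \<in> chains")
    case True
    have "insert H \<tau> - {E} = insert H (\<tau> - {E})" using H E by auto
    hence "?P (insert H \<tau>) = ?P \<tau> * var H" using H fin by (simp add: mult.commute)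
    then show ?thesis
      using Suc.hyps(1)[OF _ True nL] Suc.hyps(2) Suc.prems(3) deg H fin by simp
  next
    case False
    then obtain G where G: "G \<in> \<tau>" "\<not> H \<subseteq> G" "\<not> G \<subseteq> H" using H insert_chains_iff[OF \<tau>] by auto
    hence "G \<in> \<tau> - {E}" using H flatsD(3) by auto
    hence "?P \<tau> = var G * (\<Prod>F\<in>\<tau> - {E} - {G}. var F)" using fin by (intro prod.remove) auto
    hence "?P \<tau> * var H * Poly_Mapping.single n 1 =
        (Poly_Mapping.single n 1 * (\<Prod>F\<in>\<tau> - {E} - {G}. var F)) * (var G * var H)"
      by (simp add: ac_simps)
    also have "\<dots> \<in> \<I>"
      using G H sub ncar by (intro chow_ideal_mult chow_ideal_incomparable carrier_mult carrier_prod_var) auto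
    finally show ?thesis by (intro exI[of _ 0]) simp
  qed
  have single: "Poly_Mapping.single m 1 = var F * (Poly_Mapping.single n 1 :: 'a set int_poly)"
    unfolding mn by (rule single_var_add)
  show ?case
  proof (cases "F \<in> \<tau>")
    case False
    then show ?thesis using new[of F] FL by (simp add: single ac_simps)
  next
    case True
    define a where "a = dual_form \<tau> F"
    obtain c where c: "\<And>H. H \<in> L - \<tau> \<Longrightarrow> ?P \<tau> * var H * Poly_Mapping.single n 1 - of_int (c H) * ?u \<in> \<I>"
      using new by metis
    have lin: "(\<Sum>H\<in>L. of_int (sum a H) * var H) = var F + (\<Sum>H\<in>L - \<tau>. of_int (sum a H) * (var H :: 'a set int_poly))"
    proof -
      have "(\<Sum>H\<in>\<tau>. of_int (sum a H) * (var H :: 'a set int_poly)) = (\<Sum>H\<in>\<tau>. if H = F then var H else 0)"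
        by (rule sum.cong) (auto simp: a_def dual_form[OF \<tau> True])
      also have "\<dots> = var F" using True fin by simp
      finally show ?thesis using sum.subset_diff[OF sub finite_flats, of "\<lambda>H. of_int (sum a H) * var H"]
        by (simp add: add.commute)
    qed
    have "?P \<tau> * Poly_Mapping.single m 1 - of_int (- (\<Sum>H\<in>L - \<tau>. sum a H * c H)) * ?u =
        (?P \<tau> * Poly_Mapping.single n 1) * (\<Sum>H\<in>L. of_int (sum a H) * var H) -
        (\<Sum>H\<in>L - \<tau>. of_int (sum a H) * (?P \<tau> * var H * Poly_Mapping.single n 1 - of_int (c H) * ?u))"
      unfolding lin single
      by (simp add: algebra_simps sum_distrib_left sum_distrib_right sum_subtractf sum.distrib
          del: of_int_sum) (simp add: sum_distrib_left sum_distrib_right algebra_simps)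
    also have "\<dots> \<in> \<I>"
      by (intro chow_ideal_diff chow_ideal_sum chow_ideal_mult[OF chow_ideal_linear] chow_ideal_mult[OF c] carrier_of_int carrier_mult Pcar ncar) auto
    finally show ?thesis by blast
  qed
qed

lemma top_degree_multiple:
  assumes p: "p \<in> carrier R" "homogeneous (fan_dim M) p"
  shows "\<exists>c. p - of_int c * (- var E) ^ fan_dim M \<in> \<I>"
proof -
  let ?u = "(- var E) ^ fan_dim M :: 'a set int_poly"
  have E: "{E} \<in> chains" using ground_in_flats by (simp add: chains_def)
  have "\<exists>c. Poly_Mapping.single m 1 - of_int c * ?u \<in> \<I>" if "m \<in> Poly_Mapping.keys p" for m
    using square_free_reduction[OF E, of m] that p rk_ground_pos
    by (auto simp: homogeneous_def fan_dim_def chow_poly_def carrier_poly_ring)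
  then obtain c where c: "\<And>m. m \<in> Poly_Mapping.keys p \<Longrightarrow> Poly_Mapping.single m 1 - of_int (c m) * ?u \<in> \<I>"
    by metis
  have single: "Poly_Mapping.single m x = of_int x * (Poly_Mapping.single m 1 :: 'a set int_poly)" for m x
    by (simp add: mult_single flip: single_zero_int)
  have "p = (\<Sum>m\<in>Poly_Mapping.keys p. of_int (Poly_Mapping.lookup p m) * Poly_Mapping.single m 1)"
    by (subst (1) poly_mapping_sum_single[of p]) (rule sum.cong[OF refl single])
  hence "p - of_int (\<Sum>m\<in>Poly_Mapping.keys p. Poly_Mapping.lookup p m * c m) * ?u =
     (\<Sum>m\<in>Poly_Mapping.keys p. of_int (Poly_Mapping.lookup p m) * (Poly_Mapping.single m 1 - of_int (c m) * ?u))"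
    by (simp add: right_diff_distrib sum_subtractf sum_distrib_right mult.assoc)
  also have "\<dots> \<in> \<I>" by (intro chow_ideal_sum chow_ideal_mult[OF c] carrier_of_int)
  finally show ?thesis by blast
qed

section \<open>The degree map and the cap product\<close>

text \<open>Each variable in turn is outside the chain at which it is evaluated.\<close>

lemma poly_act_prod_var:
  assumes w: "balanced w" and "finite S" "E \<in> \<tau>" "S \<inter> \<tau> = {}"
  shows "poly_act (\<Prod>F\<in>S. var F) w \<tau> = w (S \<union> \<tau>)"
  using assms(2-)
proof (induction S arbitrary: \<tau> rule: finite_induct)
  case empty
  then show ?case by (simp add: poly_act_one)
next
  case (insert F S)
  have "poly_act (\<Prod>F\<in>insert F S. var F) w \<tau> = X F (poly_act (\<Prod>F\<in>S. var F) w) \<tau>"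
    using insert.hyps by (simp add: poly_act_mult[OF w] poly_act_var)
  also have "\<dots> = poly_act (\<Prod>F\<in>S. var F) w (insert F \<tau>)"
    using insert.prems by (intro X_notin balanced_poly_act w) auto
  also have "\<dots> = w (S \<union> insert F \<tau>)" using insert.prems insert.hyps by (intro insert.IH) auto
  finally show ?case by simp
qed

lemma poly_act_flag:
  assumes w: "balanced w" and "\<F> \<in> flags M"
  shows "poly_act (\<Prod>F\<in>\<F>. var F) w {E} = w (insert E \<F>)"
  using poly_act_prod_var[OF w finite_flag[OF assms(2)], of "{E}"] assms(2) by (simp add: flags_iff)

definition degree_functional :: "'a set int_poly \<Rightarrow> int" where
  "degree_functional p = poly_act p unit_weight {E}"

lemma degree_functional_cong:
  "p - q \<in> \<I> \<Longrightarrow> degree_functional p = degree_functional q"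
  using poly_act_chow_ideal[OF _ balanced_unit_weight, of "p - q"]
  by (simp add: degree_functional_def fun_eq_iff poly_act_diff)

lemma degree_functional_maximal_flag:
  assumes "\<F> \<in> maximal_flags M"
  shows "degree_functional (\<Prod>F\<in>\<F>. var F) = 1"
proof -
  have fl: "\<F> \<in> flags M" using assms by (simp add: maximal_flags_def)
  then show ?thesis
    using poly_act_flag[OF balanced_unit_weight fl] maximal_flag_full[OF assms]
    by (simp add: degree_functional_def unit_weight_def flags_iff)
qed

lemma maximal_flag_product:
  assumes "\<F> \<in> maximal_flags M"
  shows "(\<Prod>F\<in>\<F>. var F) - (- var E) ^ fan_dim M \<in> \<I>"
    and "homogeneous (fan_dim M) (\<Prod>F\<in>\<F>. var F :: 'a set int_poly)"
    and "(\<Prod>F\<in>\<F>. var F) \<in> carrier R"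
proof -
  have fl: "insert E \<F> \<in> chains" "E \<notin> \<F>" and fin: "finite \<F>"
    using assms finite_flag by (auto simp: maximal_flags_def flags_iff)
  have full: "r ` insert E \<F> = {1..r E}" using maximal_flag_full[OF assms] .
  show "(\<Prod>F\<in>\<F>. var F) - (- var E) ^ fan_dim M \<in> \<I>"
    using full_chain_product[OF fl(1) full] fl(2) by simp
  have "card \<F> = fan_dim M"
    using full fl fin full_chain_iff[OF fl(1)] by (simp add: fan_dim_def)
  then show "homogeneous (fan_dim M) (\<Prod>F\<in>\<F>. var F :: 'a set int_poly)"
    using homogeneous_prod_var[OF fin] by simp
  show "(\<Prod>F\<in>\<F>. var F) \<in> carrier R" using chainsD(1)[OF fl(1)] by (intro carrier_prod_var) auto
qed

lemma degree_functional_top_class: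
  "degree_functional (of_int c * (- var E) ^ fan_dim M) = c"
proof -
  obtain \<F> where \<F>: "\<F> \<in> maximal_flags M" using maximal_flag_exists by auto
  have "degree_functional ((- var E) ^ fan_dim M) = 1"
    using degree_functional_maximal_flag[OF \<F>] degree_functional_cong[OF maximal_flag_product(1)[OF \<F>]]
    by simp
  then show ?thesis
    by (simp add: degree_functional_def poly_act_mult[OF balanced_unit_weight] poly_act_single mon_act_zero
        flip: single_zero_int)
qed

text \<open>Both the existence and the uniqueness of the degree map rest on the fact that the top degree part
consists of the multiples of the class of \<open>(- x\<^sub>E) ^ d\<close>: the functional is injective on them, and a
homomorphism to the integers is determined by its value at the generator, which is also the class
of every maximal flag.\<close>

lemma chow_deg_class:
  assumes p: "p \<in> carrier R" "homogeneous (fan_dim M) p"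
  shows "chow_deg M (chow_class M p) = degree_functional p"
proof -
  let ?A = "chow_graded M (fan_dim M)"
  let ?u = "(- var E) ^ fan_dim M :: 'a set int_poly"
  define f where "f = (\<lambda>\<alpha>\<in>?A. degree_functional (SOME p. p \<in> carrier R \<and> chow_class M p = \<alpha>))"
  have inA: "chow_class M p \<in> ?A" if "p \<in> carrier R" "homogeneous (fan_dim M) p" for p
    using that by (auto simp: chow_graded_def)
  have f: "f (chow_class M p) = degree_functional p"
    if p: "p \<in> carrier R" "homogeneous (fan_dim M) p" for p
  proof -
    let ?q = "SOME q. q \<in> carrier R \<and> chow_class M q = chow_class M p"
    have "?q \<in> carrier R \<and> chow_class M ?q = chow_class M p"
      by (rule someI[of _ p]) (use p in simp)
    hence "degree_functional ?q = degree_functional p"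
      using p chow_class_eq_iff by (intro degree_functional_cong) blast
    then show ?thesis using inA[OF p] by (simp add: f_def)
  qed
  have u: "of_int c * ?u \<in> carrier R" "homogeneous (fan_dim M) (of_int c * ?u)" for c
  proof -
    show "of_int c * ?u \<in> carrier R" by (intro carrier_mult carrier_of_int carrier_neg_var_ground)
    have "homogeneous 1 (- var E :: 'a set int_poly)"
      using homogeneous_mult[OF homogeneous_of_int[of "-1"] homogeneous_var[of E]] by simp
    from homogeneous_mult[OF homogeneous_of_int[of c] homogeneous_power[OF this, of "fan_dim M"]]
    show "homogeneous (fan_dim M) (of_int c * ?u)" by simp
  qed
  have rep: "\<exists>c. \<alpha> = chow_class M (of_int c * ?u)" if \<alpha>: "\<alpha> \<in> ?A" for \<alpha>
  proof -
    obtain p where p: "p \<in> carrier R" "homogeneous (fan_dim M) p" "\<alpha> = chow_class M p"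
      using \<alpha> by (auto simp: chow_graded_def)
    then obtain c where "p - of_int c * ?u \<in> \<I>" using top_degree_multiple by blast
    then show ?thesis using p u(1) chow_class_eq_iff by blast
  qed
  have fu: "f (chow_class M (of_int c * ?u)) = c" for c
    using f[OF u] degree_functional_top_class by simp
  have add: "chow_class M (of_int a * ?u) \<oplus>\<^bsub>chow_ring M\<^esub> chow_class M (of_int b * ?u) =
      chow_class M (of_int (a + b) * ?u)" for a b
    using chow_class_add[OF u(1) u(1), of a b] by (simp add: distrib_right)
  have iso: "f \<in> iso (chow_group M (fan_dim M)) integer_group"
  proof -
    have "f \<in> hom (chow_group M (fan_dim M)) integer_group"
    proof (rule homI)
      fix \<alpha> \<beta> assume "\<alpha> \<in> carrier (chow_group M (fan_dim M))" "\<beta> \<in> carrier (chow_group M (fan_dim M))"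
      then obtain a b where "\<alpha> = chow_class M (of_int a * ?u)" "\<beta> = chow_class M (of_int b * ?u)"
        using rep by (auto simp: chow_group_def) metis
      then show "f (\<alpha> \<otimes>\<^bsub>chow_group M (fan_dim M)\<^esub> \<beta>) = f \<alpha> \<otimes>\<^bsub>integer_group\<^esub> f \<beta>"
        by (simp add: chow_group_def add fu del: of_int_add)
    qed simp
    moreover have "bij_betw f ?A UNIV"
    proof (rule bij_betwI')
      fix \<alpha> \<beta> assume "\<alpha> \<in> ?A" "\<beta> \<in> ?A"
      then obtain a b where "\<alpha> = chow_class M (of_int a * ?u)" "\<beta> = chow_class M (of_int b * ?u)"
        using rep by metis
      then show "(f \<alpha> = f \<beta>) = (\<alpha> = \<beta>)" using fu by metis
    next
      fix c :: int
      show "\<exists>\<alpha>\<in>?A. c = f \<alpha>"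
        by (rule bexI[of _ "chow_class M (of_int c * ?u)"]) (simp_all only: fu inA[OF u])
    qed simp
    ultimately show ?thesis by (simp add: iso_def chow_group_def)
  qed
  have flag1: "\<forall>\<F>\<in>maximal_flags M. f (chow_class M (\<Prod>F\<in>\<F>. var F)) = 1"
    using f maximal_flag_product degree_functional_maximal_flag by simp
  have "chow_deg M = f"
    unfolding chow_deg_def
  proof (rule the_equality)
    show "f \<in> iso (chow_group M (fan_dim M)) integer_group \<and> f \<in> extensional ?A \<and>
      (\<forall>\<F>\<in>maximal_flags M. f (chow_class M (\<Prod>F\<in>\<F>. var F)) = 1)"
      using iso flag1 by (simp add: f_def)
  next
    fix g assume g: "g \<in> iso (chow_group M (fan_dim M)) integer_group \<and> g \<in> extensional ?A \<and>
      (\<forall>\<F>\<in>maximal_flags M. g (chow_class M (\<Prod>F\<in>\<F>. var F)) = 1)"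
    define h where "h c = g (chow_class M (of_int c * ?u))" for c
    have hadd: "h (a + b) = h a + h b" for a b
    proof -
      have "g \<in> hom (chow_group M (fan_dim M)) integer_group" using g by (simp add: iso_def)
      from hom_mult[OF this, of "chow_class M (of_int a * ?u)" "chow_class M (of_int b * ?u)"]
      show ?thesis using inA[OF u] add by (simp add: chow_group_def h_def)
    qed
    have h1: "h 1 = 1"
    proof -
      obtain \<F> where \<F>: "\<F> \<in> maximal_flags M" using maximal_flag_exists by auto
      have "chow_class M (\<Prod>F\<in>\<F>. var F) = chow_class M ?u"
        using maximal_flag_product[OF \<F>] carrier_neg_var_ground chow_class_eq_iff by blast
      moreover have "g (chow_class M (\<Prod>F\<in>\<F>. var F)) = 1" using g \<F> by blast
      ultimately show ?thesis by (simp add: h_def)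
    qed
    have h: "h c = c" for c
    proof (induction c rule: int_induct[of _ 0])
      case base
      show ?case using hadd[of 0 0] by simp
    next
      case (step1 i)
      then show ?case using hadd[of i 1] h1 by simp
    next
      case (step2 i)
      then show ?case using hadd[of "i - 1" 1] h1 by simp
    qed
    show "g = f"
    proof (rule extensionalityI[of _ ?A])
      fix \<alpha> assume "\<alpha> \<in> ?A"
      then obtain c where "\<alpha> = chow_class M (of_int c * ?u)" using rep by auto
      then show "g \<alpha> = f \<alpha>" using h fu by (simp add: h_def)
    qed (use g in \<open>simp_all add: f_def\<close>)
  qed
  then show ?thesis using f[OF p] by simp
qed

lemma cones_iff: "\<F> \<in> cones M k \<longleftrightarrow> \<F> \<in> flags M \<and> card \<F> = k"
  using loopless by (simp add: cones_def)

lemma card_flag_le: "\<F> \<in> flags M \<Longrightarrow> card \<F> \<le> fan_dim M"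
  using card_chain_le[of "insert E \<F>"] finite_flag[of \<F>] by (simp add: flags_iff fan_dim_def)

text \<open>Only one degree of \<open>p\<close> contributes at a given chain, because \<open>unit_weight\<close> lives in codimension \<open>0\<close>.\<close>

lemma poly_act_hom_part:
  assumes "card \<tau> + k = r E"
  shows "poly_act (hom_part k p) unit_weight \<tau> = poly_act p unit_weight \<tau>"
proof -
  have "Poly_Mapping.keys (hom_part k p) \<subseteq> Poly_Mapping.keys p"
    by (auto simp: in_keys_iff lookup_hom_part split: if_splits)
  hence "poly_act (hom_part k p) unit_weight \<tau> = (\<Sum>m\<in>Poly_Mapping.keys p.
      Poly_Mapping.lookup (hom_part k p) m * mon_act m unit_weight \<tau>)"
    by (intro poly_act_superset) auto
  also have "\<dots> = poly_act p unit_weight \<tau>"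
    unfolding poly_act_def
  proof (rule sum.cong[OF refl])
    fix m
    have "mon_act m unit_weight \<tau> = 0" if "mon_degree m \<noteq> k"
      using supported_fold_X[OF supported_unit_weight, of "mon_mset m"] that assms
      by (auto simp: supported_def mon_act_def mon_degree_size)
    then show "Poly_Mapping.lookup (hom_part k p) m * mon_act m unit_weight \<tau> =
        Poly_Mapping.lookup p m * mon_act m unit_weight \<tau>"
      by (auto simp: lookup_hom_part)
  qed
  finally show ?thesis .
qed

text \<open>On a flag of size \<open>k\<close> only the component of degree \<open>fan_dim M - k\<close> is capped.  Multiplying it by the
monomial of the flag moves the evaluation from \<open>{E}\<close> to the chain of the flag, after which the other
components may be added again since they contribute zero there.\<close>

lemma cap_chow_class:
  assumes p: "p \<in> carrier R"
  shows "cap M (chow_class M p) \<F> = (if \<F> \<in> flags M then poly_act p unit_weight (insert E \<F>) else 0)"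
proof (cases "\<F> \<in> flags M")
  case True
  define k where "k = fan_dim M - card \<F>"
  have c: "card \<F> \<le> fan_dim M" using card_flag_le[OF True] .
  have fin: "finite \<F>" and E: "E \<notin> \<F>" using True finite_flag by (auto simp: flags_iff)
  have other: "cap_graded M j \<alpha> \<F> = 0" if "j \<le> fan_dim M" "j \<noteq> k" for j \<alpha>
    using that c by (auto simp: cap_graded_def cones_iff k_def)
  let ?x = "\<Prod>F\<in>\<F>. var F :: 'a set int_poly"
  have xcar: "?x \<in> carrier R" using True by (intro carrier_prod_var) (auto simp: flags_def proper_flats_def)
  have hcar: "hom_part k p \<in> carrier R" using p by (simp add: chow_poly_def poly_carrier_hom_part)
  have hom: "homogeneous (fan_dim M) (hom_part k p * ?x)"
    using homogeneous_mult[OF homogeneous_hom_part homogeneous_prod_var[OF fin], of k p] c by (simp add: k_def)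
  have "cap M (chow_class M p) \<F> = (\<Sum>j\<le>fan_dim M. if j = k then cap_graded M k (chow_component M k (chow_class M p)) \<F> else 0)"
    unfolding cap_def by (intro sum.cong) (auto simp: other)
  also have "\<dots> = cap_graded M k (chow_component M k (chow_class M p)) \<F>"
    by (simp add: k_def)
  also have "\<dots> = chow_deg M (chow_class M (hom_part k p * ?x))"
    using True c by (simp add: cap_graded_def cones_iff k_def chow_component_class[OF p]
        chow_class_mult[OF hcar[unfolded k_def] xcar])
  also have "\<dots> = poly_act (?x * hom_part k p) unit_weight {E}"
    using chow_deg_class[OF carrier_mult[OF hcar xcar] hom] by (simp add: degree_functional_def mult.commute)
  also have "\<dots> = poly_act (hom_part k p) unit_weight (insert E \<F>)"
    using poly_act_flag[OF balanced_poly_act[OF balanced_unit_weight] True]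
    by (simp add: poly_act_mult[OF balanced_unit_weight])
  also have "\<dots> = poly_act p unit_weight (insert E \<F>)"
    using E fin c rk_ground_pos by (intro poly_act_hom_part) (simp add: k_def fan_dim_def)
  finally show ?thesis using True by simp
next
  case False
  then show ?thesis by (simp add: cap_def cap_graded_def cones_iff)
qed

section \<open>The staircase class acting on the unit weight\<close>

definition succ :: "'a set set \<Rightarrow> 'a set \<Rightarrow> 'a set" where
  "succ \<tau> F = \<Inter>{G \<in> \<tau>. F \<subset> G}"

lemma succ_eqI:
  assumes "G \<in> \<tau>" "F \<subset> G" "\<And>K. K \<in> \<tau> \<Longrightarrow> F \<subset> K \<Longrightarrow> G \<subseteq> K"
  shows "succ \<tau> F = G"
  using assms unfolding succ_def by blast

text \<open>The upper end of the gap at rank \<open>r F + 1\<close>.\<close>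

lemma succ_chain:
  assumes \<tau>: "\<tau> \<in> chains" and F: "F \<in> insert {} \<tau> - {E}"
  shows "succ \<tau> F \<in> \<tau>" "F \<subset> succ \<tau> F" "G \<in> \<tau> \<Longrightarrow> F \<subset> G \<Longrightarrow> succ \<tau> F \<subseteq> G"
proof -
  have flF: "flat M F" using chain_flat[OF \<tau>] F by simp
  have "r F < r E" using flat_rk_less[OF flF, of E] flat_subset[OF flF] F by auto
  hence s: "0 < Suc (r F)" "Suc (r F) \<le> r E" by auto
  obtain F' H where FG: "F' \<in> insert {} \<tau>" "H \<in> \<tau>" "r F' < Suc (r F)" "Suc (r F) \<le> r H" "F' \<subset> H"
    and below: "\<And>K. K \<in> insert {} \<tau> \<Longrightarrow> r K < Suc (r F) \<Longrightarrow> K \<subseteq> F'"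
    and above: "\<And>K. K \<in> insert {} \<tau> \<Longrightarrow> Suc (r F) \<le> r K \<Longrightarrow> H \<subseteq> K"
    by (rule chain_gap[OF \<tau> s]) blast
  have "F \<subset> H" using below[of F] F FG(5) by auto
  moreover have le: "H \<subseteq> K" if "K \<in> \<tau>" "F \<subset> K" for K
    using above[of K] chain_rk_less[OF \<tau>, of F K] that F by auto
  ultimately have eq: "succ \<tau> F = H" using FG(2) by (intro succ_eqI) auto
  show "succ \<tau> F \<in> \<tau>" "F \<subset> succ \<tau> F" "G \<in> \<tau> \<Longrightarrow> F \<subset> G \<Longrightarrow> succ \<tau> F \<subseteq> G"
    using eq FG(2) \<open>F \<subset> H\<close> le by auto
qed

text \<open>Every member of the chain is the upper end of one gap; this is what determines the total sign of a
product of beta invariants.\<close>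

lemma succ_bij:
  assumes \<tau>: "\<tau> \<in> chains"
  shows "bij_betw (succ \<tau>) (insert {} \<tau> - {E}) \<tau>"
proof -
  let ?A = "insert {} \<tau> - {E}"
  have fin: "finite \<tau>" and E: "E \<in> \<tau>" "{} \<notin> \<tau>" using chainsD[OF \<tau>] by auto
  have less: "succ \<tau> F \<noteq> succ \<tau> F'" if "F \<in> ?A" "F' \<in> ?A" "F \<subset> F'" for F F'
  proof -
    have "F' \<in> \<tau>" using that by auto
    then show ?thesis using succ_chain(3)[OF \<tau> that(1), of F'] succ_chain(2)[OF \<tau> that(2)] that(3) by auto
  qed
  have inj: "inj_on (succ \<tau>) ?A"
  proof (rule inj_onI)
    fix F F' assume FF': "F \<in> ?A" "F' \<in> ?A" "succ \<tau> F = succ \<tau> F'"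
    hence "F \<subseteq> F' \<or> F' \<subseteq> F" using chainsD(3)[OF \<tau>] by auto
    then show "F = F'" using less[of F F'] less[of F' F] FF' by auto
  qed
  have "card (insert {} \<tau>) = Suc (card \<tau>)" using fin E(2) by simp
  moreover have "card ?A = card (insert {} \<tau>) - 1" using E(1) by (intro card_Diff_singleton) simp
  ultimately have "card (succ \<tau> ` ?A) = card \<tau>" using card_image[OF inj] by simp
  moreover have "succ \<tau> ` ?A \<subseteq> \<tau>" using succ_chain(1)[OF \<tau>] by blast
  ultimately have "succ \<tau> ` ?A = \<tau>" using card_subset_eq[OF fin] by metis
  then show ?thesis using inj by (simp add: bij_betw_def)
qed

definition beta_product :: "nat \<Rightarrow> 'a set set \<Rightarrow> int" where
  "beta_product t \<tau> = (\<Prod>F\<in>{F \<in> insert {} \<tau> - {E}. t \<le> r F}. signed_beta F (succ \<tau> F))"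

text \<open>The weight obtained from \<open>unit_weight\<close> by the staircase factors of rank larger than \<open>t\<close>.  Where it does not
vanish, the gap that starts at rank \<open>t - 1\<close> contributes the factor \<open>1\<close>, however long it is.\<close>

definition partial_stair :: "nat \<Rightarrow> 'a set set \<Rightarrow> int" where
  "partial_stair t \<tau> =
     (if \<tau> \<in> chains \<and> {..<t} \<subseteq> r ` insert {} \<tau> then beta_product t \<tau> else 0)"

lemma partial_stair_top: "partial_stair (r E) = unit_weight"
proof
  fix \<tau>
  show "partial_stair (r E) \<tau> = unit_weight \<tau>"
  proof (cases "\<tau> \<in> chains")
    case True
    have E: "r E \<in> r ` \<tau>" using chainsD(2)[OF True] by simp
    have "{..<r E} \<subseteq> r ` insert {} \<tau> \<longleftrightarrow> {1..r E} \<subseteq> r ` \<tau>"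
    proof (intro iffI subsetI)
      fix x assume sub: "{..<r E} \<subseteq> r ` insert {} \<tau>" and x: "x \<in> {1..r E}"
      show "x \<in> r ` \<tau>"
      proof (cases "x = r E")
        case False
        hence "x \<in> {..<r E}" using x by simp
        hence "x \<in> r ` insert {} \<tau>" using sub by blast
        then show ?thesis using x by simp
      qed (use E in simp)
    next
      fix x assume sub: "{1..r E} \<subseteq> r ` \<tau>" and x: "x \<in> {..<r E}"
      show "x \<in> r ` insert {} \<tau>"
      proof (cases "x = 0")
        case False
        hence "x \<in> {1..r E}" using x by simp
        then show ?thesis using sub by blast
      qed simp
    qed
    hence "{..<r E} \<subseteq> r ` insert {} \<tau> \<longleftrightarrow> r ` \<tau> = {1..r E}"
      using rk_image_chain(1)[OF True] by (metis subset_antisym subset_refl)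
    moreover have "beta_product (r E) \<tau> = 1"
    proof -
      have "r F < r E" if "F \<in> insert {} \<tau> - {E}" for F
        using flat_rk_less[OF chain_flat[OF True], of F E] flat_subset[OF chain_flat[OF True], of F] that
        by auto
      hence none: "{F \<in> insert {} \<tau> - {E}. r E \<le> r F} = {}" by fastforce
      show ?thesis unfolding beta_product_def none by (rule prod.empty)
    qed
    ultimately show ?thesis using True by (simp add: partial_stair_def unit_weight_def)
  qed (simp add: partial_stair_def unit_weight_def)
qed

text \<open>Let \<open>F \<subset> G\<close> be the gap at rank \<open>t + 1\<close> and \<open>i \<in> G - F\<close>.  Subtracting the coordinate at \<open>i\<close> from the step
function of the factor leaves the flats \<open>H\<close> strictly between \<open>F\<close> and \<open>G\<close>, with coefficient \<open>1\<close> if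
\<open>r H > t\<close> and \<open>i \<notin> H\<close>, and \<open>-1\<close> if \<open>r H \<le> t\<close> and \<open>i \<in> H\<close>.  There are three cases.
If all ranks up to \<open>t\<close> occur in \<open>\<tau>\<close>, then \<open>r F = t\<close>, only coefficients \<open>1\<close> appear, and
\<open>sum_signed_beta\<close> produces the factor of the gap \<open>F \<subset> G\<close>.  If they occur only up to \<open>t - 1\<close>, then
\<open>r F = t - 1\<close>, and the only contribution is that of the flat spanned by \<open>F\<close> and \<open>i\<close>.  If a rank below
\<open>t\<close> is missing, everything vanishes.\<close>

lemma partial_stair_step:
  assumes t: "t < r E" and w: "balanced (partial_stair (Suc t))"
  shows "partial_stair (Suc t) \<tau> - (\<Sum>F\<in>{F \<in> L. Suc t \<le> r F}. X F (partial_stair (Suc t)) \<tau>)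
    = partial_stair t \<tau>"
proof (cases "\<tau> \<in> chains")
  case \<tau>: True
  let ?w = "partial_stair (Suc t)"
  define \<phi> where "\<phi> F = (of_bool (Suc t \<le> r F) :: int)" for F
  have fin: "finite \<tau>" using chainsD(4)[OF \<tau>] .
  have s: "0 < Suc t" "Suc t \<le> r E" using t by auto
  obtain F G where FG: "F \<in> insert {} \<tau>" "G \<in> \<tau>" "r F < Suc t" "Suc t \<le> r G" "F \<subset> G"
    and below: "\<And>K. K \<in> insert {} \<tau> \<Longrightarrow> r K < Suc t \<Longrightarrow> K \<subseteq> F"
    and above: "\<And>K. K \<in> insert {} \<tau> \<Longrightarrow> Suc t \<le> r K \<Longrightarrow> G \<subseteq> K"
    by (rule chain_gap[OF \<tau> s]) blast
  have flF: "flat M F" by (rule chain_flat[OF \<tau> FG(1)])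
  have flG: "flat M G" by (rule chain_flat[OF \<tau>]) (use FG(2) in simp)
  obtain i where i: "i \<in> G - F" using FG by auto
  have iE: "i \<in> E - F" and sub: "insert i F \<subseteq> E"
    using i flat_subset[OF flG] flat_subset[OF flF] by auto
  have F_E: "F \<noteq> E" using FG(5) flat_subset[OF flG] by auto
  define S where "S = (\<Sum>H\<in>L - \<tau>. (\<phi> H - of_bool (i \<in> H)) * ?w (insert H \<tau>))"
  have "(\<Sum>F\<in>{F \<in> L. Suc t \<le> r F}. X F ?w \<tau>) = (\<Sum>F\<in>L. if Suc t \<le> r F then X F ?w \<tau> else 0)"
    using finite_flats by (intro sum.inter_filter)
  also have "\<dots> = (\<Sum>F\<in>L. \<phi> F * X F ?w \<tau>)"
    by (intro sum.cong) (auto simp: \<phi>_def)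
  also have "\<dots> = (\<Sum>H\<in>L - \<tau>. (\<phi> H - sum (\<lambda>j. of_bool (j = i)) H) * ?w (insert H \<tau>))"
  proof (rule X_weighted_sum[OF w \<tau>])
    fix H assume H: "H \<in> \<tau>"
    have "i \<in> H \<longleftrightarrow> Suc t \<le> r H"
      using below[of H] above[of H] H i by (cases "Suc t \<le> r H") auto
    then show "sum (\<lambda>j. of_bool (j = i)) H = \<phi> H"
      using H chainsD(1)[OF \<tau>] flatsD(3) by (subst sum_unit_form) (auto simp: \<phi>_def)
  qed
  also have "\<dots> = S"
    unfolding S_def by (intro sum.cong refl) (simp add: sum_unit_form flatsD)
  finally have S: "(\<Sum>F\<in>{F \<in> L. Suc t \<le> r F}. X F ?w \<tau>) = S" .
  have between: "F \<subset> H \<and> H \<subset> G"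
    if H: "H \<in> L - \<tau>" and ch: "insert H \<tau> \<in> chains" and nz: "\<phi> H \<noteq> of_bool (i \<in> H)" for H
  proof -
    have HE: "H \<subseteq> E" and flH: "flat M H" using H flatsD by auto
    have "\<not> H \<subseteq> F"
    proof
      assume "H \<subseteq> F"
      hence "i \<notin> H" "r H \<le> r F" using i rk_mono[of H F] flat_subset[OF flF] by auto
      then show False using nz FG(3) by (simp add: \<phi>_def)
    qed
    moreover have "\<not> G \<subseteq> H"
    proof
      assume "G \<subseteq> H"
      hence "i \<in> H" "r G \<le> r H" using i rk_mono[of G H] HE by auto
      then show False using nz FG(4) by (simp add: \<phi>_def)
    qed
    moreover have "F \<subseteq> H \<or> H \<subseteq> F" using FG(1) chainsD(3)[OF ch, of F H] by auto
    moreover have "G \<subseteq> H \<or> H \<subseteq> G" using FG(2) chainsD(3)[OF ch, of G H] by auto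
    ultimately show ?thesis by auto
  qed
  have new: "H \<in> L - \<tau>" "insert H \<tau> \<in> chains"
    "beta_product (Suc t) (insert H \<tau>) =
       (if Suc t \<le> r H then signed_beta H G else 1) * beta_product (Suc t) \<tau>"
    if flH: "flat M H" and FH: "F \<subset> H" and HG: "H \<subset> G" for H
  proof -
    have HL: "H \<in> L" using flH FH by (auto simp: flats_def)
    moreover have notin: "H \<notin> \<tau>" using below[of H] above[of H] FH HG by (cases "r H < Suc t") auto
    ultimately show H: "H \<in> L - \<tau>" by simp
    have "H \<subseteq> K \<or> K \<subseteq> H" if "K \<in> \<tau>" for K
      using below[of K] above[of K] that FH HG by (cases "r K < Suc t") auto
    then show ch: "insert H \<tau> \<in> chains" using HL by (simp add: insert_chains_iff[OF \<tau>])
    have HE: "H \<noteq> E" using HG flat_subset[OF flG] by auto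
    have sH: "succ (insert H \<tau>) H = G"
    proof (rule succ_eqI)
      fix K assume K: "K \<in> insert H \<tau>" "H \<subset> K"
      then show "G \<subseteq> K" using below[of K] above[of K] FH by (cases "r K < Suc t") auto
    qed (use FG(2) HG in auto)
    define A where "A \<tau> = {F \<in> insert {} \<tau> - {E}. Suc t \<le> r F}" for \<tau>
    have bp: "beta_product (Suc t) \<sigma> = (\<Prod>F\<in>A \<sigma>. signed_beta F (succ \<sigma> F))" for \<sigma>
      by (simp only: beta_product_def A_def)
    have sK: "succ (insert H \<tau>) K = succ \<tau> K" if "K \<in> A \<tau>" for K
    proof -
      have "G \<subseteq> K" using above[of K] that by (auto simp: A_def)
      hence "{G \<in> insert H \<tau>. K \<subset> G} = {G \<in> \<tau>. K \<subset> G}" using HG by auto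
      then show ?thesis by (simp add: succ_def)
    qed
    have AH: "A (insert H \<tau>) = (if Suc t \<le> r H then insert H (A \<tau>) else A \<tau>)"
      using HE by (auto simp: A_def)
    have "H \<notin> A \<tau>" "finite (A \<tau>)" using H flatsD(2) fin by (auto simp: A_def)
    then show "beta_product (Suc t) (insert H \<tau>) =
       (if Suc t \<le> r H then signed_beta H G else 1) * beta_product (Suc t) \<tau>"
      using sK by (simp add: bp AH sH)
  qed
  have "?w \<tau> - S = partial_stair t \<tau>"
  proof (cases "{..<Suc t} \<subseteq> r ` insert {} \<tau>")
    case D: True
    hence "t \<in> r ` insert {} \<tau>" by auto
    then obtain K where K: "K \<in> insert {} \<tau>" "r K = t" by (metis imageE)
    hence rF: "r F = t" using below[of K] rk_mono[of K F] flat_subset[OF flF] FG(3) by auto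
    define N where "N = {H. flat M H \<and> F \<subseteq> H \<and> H \<subseteq> G \<and> i \<notin> H}"
    have finN: "finite N" unfolding N_def by (rule finite_subset[OF _ finite_flat]) auto
    have FN: "F \<in> N" using flF FG(5) i by (simp add: N_def)
    have inN: "flat M H \<and> F \<subset> H \<and> H \<subset> G \<and> t < r H" if "H \<in> N - {F}" for H
      using that i flat_rk_less[OF flF, of H] flat_subset[of H] rF by (auto simp: N_def)
    have "S = (\<Sum>H\<in>N - {F}. signed_beta H G * beta_product (Suc t) \<tau>)"
      unfolding S_def
    proof (rule sum.mono_neutral_cong_right)
      show "finite (L - \<tau>)" using finite_flats by simp
      show "N - {F} \<subseteq> L - \<tau>" using inN new(1) by blast
      show "\<forall>H\<in>L - \<tau> - (N - {F}). (\<phi> H - of_bool (i \<in> H)) * ?w (insert H \<tau>) = 0"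
      proof
        fix H assume H: "H \<in> L - \<tau> - (N - {F})"
        show "(\<phi> H - of_bool (i \<in> H)) * ?w (insert H \<tau>) = 0"
        proof (rule ccontr)
          assume nz: "(\<phi> H - of_bool (i \<in> H)) * ?w (insert H \<tau>) \<noteq> 0"
          hence "insert H \<tau> \<in> chains" by (auto simp: partial_stair_def split: if_splits)
          hence FHG: "F \<subset> H" "H \<subset> G" using between[of H] H nz by auto
          have HL: "flat M H" "H \<subseteq> E" using H flatsD by auto
          have "r F < r H" using flat_rk_less[OF flF FHG(1) HL(2)] .
          hence "i \<notin> H" using nz rF by (auto simp: \<phi>_def)
          then show False using FHG HL H by (auto simp: N_def)
        qed
      qed
    next
      fix H assume H: "H \<in> N - {F}"
      hence "\<phi> H - of_bool (i \<in> H) = 1" using inN[OF H] by (auto simp: \<phi>_def N_def)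
      moreover have "{..<Suc t} \<subseteq> r ` insert {} (insert H \<tau>)" using D by auto
      ultimately show "(\<phi> H - of_bool (i \<in> H)) * ?w (insert H \<tau>) = signed_beta H G * beta_product (Suc t) \<tau>"
        using inN[OF H] new[of H] by (simp add: partial_stair_def)
    qed
    also have "\<dots> = (1 - signed_beta F G) * beta_product (Suc t) \<tau>"
    proof -
      have "(\<Sum>H\<in>N. signed_beta H G) = 1"
        unfolding N_def using flF flG FG(5) i by (intro sum_signed_beta) auto
      hence "(\<Sum>H\<in>N - {F}. signed_beta H G) = 1 - signed_beta F G"
        using sum.remove[OF finN FN, of "\<lambda>H. signed_beta H G"] by simp
      then show ?thesis by (simp flip: sum_distrib_right)
    qed
    finally have "?w \<tau> - S = signed_beta F G * beta_product (Suc t) \<tau>"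
      using D \<tau> by (simp add: partial_stair_def algebra_simps)
    also have "\<dots> = beta_product t \<tau>"
    proof -
      let ?A = "{F \<in> insert {} \<tau> - {E}. Suc t \<le> r F}"
      have "{F \<in> insert {} \<tau> - {E}. t \<le> r F} = insert F ?A"
      proof (intro equalityI subsetI)
        fix H assume H: "H \<in> {F \<in> insert {} \<tau> - {E}. t \<le> r F}"
        show "H \<in> insert F ?A"
        proof (cases "r H = t")
          case True
          have "H = F" by (rule inj_onD[OF chain_rk_inj[OF \<tau>]]) (use H True rF FG(1) in auto)
          then show ?thesis by simp
        qed (use H in auto)
      qed (use FG(1) rF F_E in auto)
      moreover have "succ \<tau> F = G"
      proof (rule succ_eqI)
        fix K assume "K \<in> \<tau>" "F \<subset> K"
        then show "G \<subseteq> K" using below[of K] above[of K] by (cases "r K < Suc t") auto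
      qed (use FG in auto)
      moreover have "F \<notin> ?A" "finite ?A" using rF fin by auto
      ultimately show ?thesis by (simp add: beta_product_def)
    qed
    also have "\<dots> = partial_stair t \<tau>"
    proof -
      have "{..<t} \<subseteq> {..<Suc t}" by auto
      hence "{..<t} \<subseteq> r ` insert {} \<tau>" using D by (rule subset_trans)
      then show ?thesis using \<tau> by (simp add: partial_stair_def)
    qed
    finally show ?thesis .
  next
    case notD: False
    hence w0: "?w \<tau> = 0" by (simp add: partial_stair_def)
    show ?thesis
    proof (cases "{..<t} \<subseteq> r ` insert {} \<tau>")
      case D': True
      have t_notin: "t \<notin> r ` insert {} \<tau>" using notD D' by (auto simp: lessThan_Suc)
      hence "t \<noteq> 0" by auto
      hence "t - 1 \<in> {..<t}" by simp
      hence "t - 1 \<in> r ` insert {} \<tau>" using D' by blast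
      then obtain K where K: "K \<in> insert {} \<tau>" "r K = t - 1" by (metis imageE)
      hence "t - 1 \<le> r F" using below[of K] rk_mono[of K F] flat_subset[OF flF] by auto
      moreover have "r F \<noteq> t" using t_notin FG(1) by auto
      ultimately have rF: "Suc (r F) = t" using FG(3) \<open>t \<noteq> 0\<close> by simp
      define H0 where "H0 = cl (insert i F)"
      have H0: "flat M H0" "insert i F \<subseteq> H0" "H0 \<subseteq> G" "r H0 = t"
        using flat_cl[OF sub] subset_cl[OF sub] cl_least[OF flG, of "insert i F"]
          rk_cl_insert[OF flF iE] i FG(5) rF
        by (auto simp: H0_def)
      have H0': "F \<subset> H0" "H0 \<subset> G" using H0 i FG(4) by auto
      note newH0 = new[OF H0(1) H0']
      have "{..<Suc t} \<subseteq> r ` insert {} (insert H0 \<tau>)" using D' H0(4) by (auto simp: lessThan_Suc)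
      hence wH0: "?w (insert H0 \<tau>) = beta_product (Suc t) \<tau>"
        using newH0 H0(4) by (simp add: partial_stair_def)
      have "S = (\<Sum>H\<in>{H0}. - ?w (insert H \<tau>))"
        unfolding S_def
      proof (rule sum.mono_neutral_cong_right)
        show "finite (L - \<tau>)" using finite_flats by simp
        show "{H0} \<subseteq> L - \<tau>" using newH0(1) by simp
        show "\<forall>H\<in>L - \<tau> - {H0}. (\<phi> H - of_bool (i \<in> H)) * ?w (insert H \<tau>) = 0"
        proof
          fix H assume H: "H \<in> L - \<tau> - {H0}"
          show "(\<phi> H - of_bool (i \<in> H)) * ?w (insert H \<tau>) = 0"
          proof (rule ccontr)
            assume nz: "(\<phi> H - of_bool (i \<in> H)) * ?w (insert H \<tau>) \<noteq> 0"
            hence ch: "insert H \<tau> \<in> chains" and D: "{..<Suc t} \<subseteq> r ` insert {} (insert H \<tau>)"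
              by (auto simp: partial_stair_def split: if_splits)
            have FHG: "F \<subset> H" using between[of H] H nz ch by auto
            have "t \<in> insert (r H) (r ` insert {} \<tau>)" using D by auto
            hence rH: "r H = t" using t_notin by blast
            hence "i \<in> H" using nz by (auto simp: \<phi>_def)
            hence "H0 = H"
              unfolding H0_def using flF flatsD(1) H FHG rH rF i by (intro cl_insert_eq) auto
            then show False using H by simp
          qed
        qed
      next
        fix H assume "H \<in> {H0}"
        then show "(\<phi> H - of_bool (i \<in> H)) * ?w (insert H \<tau>) = - ?w (insert H \<tau>)"
          using H0 by (simp add: \<phi>_def)
      qed
      hence "?w \<tau> - S = beta_product (Suc t) \<tau>" using w0 wH0 by simp
      also have "\<dots> = beta_product t \<tau>"
      proof -
        have "{F \<in> insert {} \<tau> - {E}. Suc t \<le> r F} = {F \<in> insert {} \<tau> - {E}. t \<le> r F}"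
          using t_notin by (auto simp: Suc_le_eq le_less)
        then show ?thesis by (simp add: beta_product_def)
      qed
      finally show ?thesis using D' \<tau> by (simp add: partial_stair_def)
    next
      case notD': False
      then obtain j where j: "j < t" "j \<notin> r ` insert {} \<tau>" by (metis lessThan_iff subsetI)
      have "S = 0"
        unfolding S_def
      proof (rule sum.neutral, rule ballI, rule ccontr)
        fix H assume H: "H \<in> L - \<tau>" and nz: "(\<phi> H - of_bool (i \<in> H)) * ?w (insert H \<tau>) \<noteq> 0"
        hence ch: "insert H \<tau> \<in> chains" and D: "{..<Suc t} \<subseteq> r ` insert {} (insert H \<tau>)"
          by (auto simp: partial_stair_def split: if_splits)
        have "r ` insert {} (insert H \<tau>) = insert (r H) (r ` insert {} \<tau>)" by auto
        moreover have "j \<in> {..<Suc t}" "t \<in> {..<Suc t}" using j by auto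
        ultimately have "j \<in> insert (r H) (r ` insert {} \<tau>)" "t \<in> insert (r H) (r ` insert {} \<tau>)"
          using D by blast+
        hence rH: "r H = j" and "t \<in> r ` insert {} \<tau>" using j by auto
        then obtain K where K: "K \<in> insert {} \<tau>" "r K = t" by (metis imageE)
        have "t \<le> r F" using K below[of K] rk_mono[of K F] flat_subset[OF flF] by auto
        moreover have "F \<subset> H" using between[OF H ch] nz by auto
        hence "r F < r H" using flat_rk_less[OF flF] H flatsD(3) by auto
        ultimately show False using rH j by simp
      qed
      then show ?thesis using w0 notD' by (simp add: partial_stair_def)
    qed
  qed
  then show ?thesis by (simp only: S)
qed (simp add: partial_stair_def X_def)

definition stair_poly :: "nat \<Rightarrow> 'a set int_poly" where
  "stair_poly t = (\<Prod>s = Suc t..r E. 1 - (\<Sum>F\<in>{F \<in> L. s \<le> r F}. var F))"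

lemma stair_poly_act:
  assumes "t \<le> r E"
  shows "poly_act (stair_poly t) unit_weight = partial_stair t"
  using assms
proof (induction rule: inc_induct)
  case base
  show ?case by (simp add: stair_poly_def poly_act_one partial_stair_top)
next
  case (step t)
  have "{Suc t..r E} = insert (Suc t) {Suc (Suc t)..r E}" using step.hyps by auto
  hence sp: "stair_poly t = (1 - (\<Sum>F\<in>{F \<in> L. Suc t \<le> r F}. var F)) * stair_poly (Suc t)"
    by (simp add: stair_poly_def)
  have bal: "balanced (partial_stair (Suc t))"
    using balanced_poly_act[OF balanced_unit_weight, of "stair_poly (Suc t)"] step.IH by simp
  show ?case
  proof
    fix \<tau>
    have "poly_act (stair_poly t) unit_weight \<tau> =
        partial_stair (Suc t) \<tau> - (\<Sum>F\<in>{F \<in> L. Suc t \<le> r F}. X F (partial_stair (Suc t)) \<tau>)"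
      by (simp add: sp poly_act_mult[OF balanced_unit_weight] step.IH poly_act_diff poly_act_one
          poly_act_sum poly_act_var)
    also have "\<dots> = partial_stair t \<tau>" using step.hyps bal by (intro partial_stair_step)
    finally show "poly_act (stair_poly t) unit_weight \<tau> = partial_stair t \<tau>" .
  qed
qed

lemma balanced_partial_stair_zero: "balanced (partial_stair 0)"
  using balanced_poly_act[OF balanced_unit_weight, of "stair_poly 0"] stair_poly_act[of 0] by simp

section \<open>The Chern-Schwartz-MacPherson cycle\<close>

lemma stair_eq: "stair M = chow_class M (stair_poly 0)"
  using loopless by (simp add: stair_def stair_poly_def)

lemma stair_poly_carrier: "stair_poly t \<in> carrier R"
  unfolding stair_poly_def chow_poly_def
  by (intro poly_carrier_prod poly_carrier_diff poly_carrier_one poly_carrier_sum poly_carrier_var) auto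

text \<open>The exponents \<open>r F + r (succ F) + 1\<close> of the signs between \<open>beta\<close> and \<open>signed_beta\<close> add up, by
\<open>succ_bij\<close>, to a number of the same parity as \<open>fan_dim M - k\<close>.\<close>

lemma csm_k_eq: "csm_k M k \<F> = (if \<F> \<in> cones M k then partial_stair 0 (insert E \<F>) else 0)"
proof (cases "\<F> \<in> cones M k")
  case True
  let ?\<tau> = "insert E \<F>" and ?d = "fan_dim M"
  have fl: "\<F> \<in> flags M" and k: "card \<F> = k" using True by (auto simp: cones_iff)
  have \<tau>: "?\<tau> \<in> chains" and E: "E \<notin> \<F>" and fin: "finite \<F>" using fl finite_flag by (auto simp: flags_iff)
  have e: "{} \<notin> \<F>" using chainsD(5)[OF \<tau>] by simp
  have A: "insert {} ?\<tau> - {E} = insert {} \<F>" using E ground_nonempty by auto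
  have succ: "flag_succ M \<F> F = succ ?\<tau> F" for F by (simp add: flag_succ_def succ_def)
  let ?b = "\<lambda>F. beta (contraction (restriction M (succ ?\<tau> F)) F)"
  have B: "{F \<in> insert {} ?\<tau> - {E}. 0 \<le> r F} = insert {} \<F>" unfolding A by blast
  have "partial_stair 0 ?\<tau> = beta_product 0 ?\<tau>" using \<tau> by (simp add: partial_stair_def)
  also have "\<dots> = (\<Prod>F\<in>insert {} \<F>. signed_beta F (succ ?\<tau> F))"
    unfolding beta_product_def B ..
  also have "\<dots> = (\<Prod>F\<in>insert {} \<F>. (-1) ^ (r F + r (succ ?\<tau> F) + 1) * ?b F)"
  proof (rule prod.cong[OF refl])
    fix F assume "F \<in> insert {} \<F>"
    hence F: "F \<in> insert {} ?\<tau> - {E}" using A by simp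
    have "succ ?\<tau> F \<subseteq> E" using succ_chain(1)[OF \<tau> F] chainsD(1)[OF \<tau>] flatsD(3) by blast
    then show "signed_beta F (succ ?\<tau> F) = (-1) ^ (r F + r (succ ?\<tau> F) + 1) * ?b F"
      using succ_chain(2)[OF \<tau> F] by (intro signed_beta_eq[symmetric])
  qed
  also have "\<dots> = (-1) ^ (\<Sum>F\<in>insert {} \<F>. r F + r (succ ?\<tau> F) + 1) * (\<Prod>F\<in>insert {} \<F>. ?b F)"
    by (simp only: prod.distrib power_sum)
  also have "(-1::int) ^ (\<Sum>F\<in>insert {} \<F>. r F + r (succ ?\<tau> F) + 1) = (-1) ^ (?d - k)"
  proof -
    have "(\<Sum>F\<in>insert {} \<F>. r (succ ?\<tau> F)) = (\<Sum>G\<in>?\<tau>. r G)"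
      using sum.reindex_bij_betw[OF succ_bij[OF \<tau>], of r] A by simp
    moreover have "(\<Sum>F\<in>insert {} \<F>. r F + r (succ ?\<tau> F) + 1) =
        (\<Sum>F\<in>insert {} \<F>. r F) + (\<Sum>F\<in>insert {} \<F>. r (succ ?\<tau> F)) + card (insert {} \<F>)"
      by (simp only: sum.distrib card_eq_sum)
    ultimately have "(\<Sum>F\<in>insert {} \<F>. r F + r (succ ?\<tau> F) + 1) = 2 * (\<Sum>F\<in>\<F>. r F) + r E + (k + 1)"
      using fin E e k by simp
    also have "\<dots> = 2 * (\<Sum>F\<in>\<F>. r F) + 2 * (k + 1) + (?d - k)"
      using rk_ground_pos card_flag_le[OF fl] k by (simp add: fan_dim_def)
    finally show ?thesis by (simp add: power_add)
  qed
  finally show ?thesis using True by (simp add: csm_k_def succ)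
qed (simp add: csm_k_def)

lemma csm_eq: "csm M \<F> = (if \<F> \<in> flags M then partial_stair 0 (insert E \<F>) else 0)"
proof (cases "\<F> \<in> flags M")
  case True
  have "csm M \<F> = (\<Sum>k\<le>fan_dim M. if k = card \<F> then partial_stair 0 (insert E \<F>) else 0)"
    unfolding csm_def using True by (intro sum.cong) (auto simp: csm_k_eq cones_iff)
  then show ?thesis using True card_flag_le[OF True] by simp
qed (simp add: csm_def csm_k_eq cones_iff)

text \<open>The linear relation of the coordinate \<open>i\<close> at the chain of \<open>\<tau>\<close> is the \<open>i\<close>-th coordinate of the balancing
condition; the coefficients of the span are the values of the divisors of the flats in the chain.\<close>

lemma csm_k_in_MW: "csm_k M k \<in> MW M k"
  unfolding MW_def
proof (intro CollectI conjI allI impI)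
  show "csm_k M k \<sigma> = 0" if "\<sigma> \<notin> cones M k" for \<sigma>
    using that by (simp add: csm_k_eq)
next
  fix j \<tau> assume jk: "Suc j = k" and "\<tau> \<in> cones M j"
  hence fl: "\<tau> \<in> flags M" and card: "card \<tau> = j" by (auto simp: cones_iff)
  define T where "T = insert E \<tau>"
  define w where "w = partial_stair 0"
  have w: "balanced w" unfolding w_def by (rule balanced_partial_stair_zero)
  have T: "T \<in> chains" and E: "E \<notin> \<tau>" and fin: "finite \<tau>"
    using fl finite_flag by (auto simp: flags_iff T_def)
  have TL: "T \<subseteq> L" using chainsD(1)[OF T] .
  define A where "A = {H \<in> L - T. insert H T \<in> chains}"
  have bij: "bij_betw (\<lambda>H. insert H \<tau>) A {\<sigma> \<in> cones M k. \<tau> \<subseteq> \<sigma>}"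
  proof (rule bij_betw_imageI)
    show "inj_on (\<lambda>H. insert H \<tau>) A"
      by (rule inj_onI) (auto simp: A_def T_def)
    show "(\<lambda>H. insert H \<tau>) ` A = {\<sigma> \<in> cones M k. \<tau> \<subseteq> \<sigma>}"
    proof (intro equalityI subsetI)
      fix \<sigma> assume "\<sigma> \<in> (\<lambda>H. insert H \<tau>) ` A"
      then show "\<sigma> \<in> {\<sigma> \<in> cones M k. \<tau> \<subseteq> \<sigma>}"
        using fin card jk E by (auto simp: A_def T_def cones_iff flags_iff insert_commute)
    next
      fix \<sigma> assume \<sigma>: "\<sigma> \<in> {\<sigma> \<in> cones M k. \<tau> \<subseteq> \<sigma>}"
      hence fs: "\<sigma> \<in> flags M" "card \<sigma> = k" "\<tau> \<subseteq> \<sigma>" by (auto simp: cones_iff)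
      hence "card (\<sigma> - \<tau>) = 1" using card_Diff_subset[OF fin] card jk by simp
      then obtain H where H: "\<sigma> - \<tau> = {H}" by (auto simp: card_1_singleton_iff)
      hence \<sigma>H: "\<sigma> = insert H \<tau>" "H \<notin> \<tau>" using fs(3) by auto
      have "H \<in> A" using fs(1) \<sigma>H chainsD(1)[of "insert E \<sigma>"]
        by (auto simp: A_def T_def flags_iff insert_commute)
      then show "\<sigma> \<in> (\<lambda>H. insert H \<tau>) ` A" using \<sigma>H(1) by blast
    qed
  qed
  show "balanced_at M k (csm_k M k) \<tau>"
    unfolding balanced_at_def
  proof (intro exI ballI)
    fix i assume i: "i \<in> E"
    have "(\<Sum>\<sigma>\<in>{\<sigma> \<in> cones M k. \<tau> \<subseteq> \<sigma>}. of_int (csm_k M k \<sigma>) * indicator (the_elem (\<sigma> - \<tau>)) i) =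
        (\<Sum>H\<in>A. of_int (csm_k M k (insert H \<tau>)) * (indicator (the_elem (insert H \<tau> - \<tau>)) i :: real))"
      by (rule sum.reindex_bij_betw[OF bij, symmetric])
    also have "\<dots> = (\<Sum>H\<in>A. of_int (of_bool (i \<in> H) * w (insert H T)))"
    proof (rule sum.cong[OF refl])
      fix H assume H: "H \<in> A"
      hence "insert H \<tau> \<in> cones M k" using bij_betwE[OF bij] by blast
      moreover have "insert H \<tau> - \<tau> = {H}" using H by (auto simp: A_def T_def)
      ultimately show "of_int (csm_k M k (insert H \<tau>)) * (indicator (the_elem (insert H \<tau> - \<tau>)) i :: real) =
          of_int (of_bool (i \<in> H) * w (insert H T))"
        by (simp add: csm_k_eq w_def T_def insert_commute indicator_def)
    qed
    also have "\<dots> = of_int (\<Sum>H\<in>L - T. of_bool (i \<in> H) * w (insert H T))"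
      unfolding of_int_sum
    proof (rule sum.mono_neutral_left)
      show "finite (L - T)" using finite_flats by simp
      show "A \<subseteq> L - T" by (auto simp: A_def)
      show "\<forall>H\<in>L - T - A. (of_int (of_bool (i \<in> H) * w (insert H T)) :: real) = 0"
      proof
        fix H assume "H \<in> L - T - A"
        hence "w (insert H T) = 0" by (intro balanced_support[OF w]) (auto simp: A_def)
        then show "(of_int (of_bool (i \<in> H) * w (insert H T)) :: real) = 0" by simp
      qed
    qed
    also have "(\<Sum>H\<in>L - T. of_bool (i \<in> H) * w (insert H T)) = - (\<Sum>F\<in>T. of_bool (i \<in> F) * X F w T)"
    proof -
      have "(\<Sum>F\<in>L. of_bool (i \<in> F) * X F w T) = (\<Sum>F\<in>L. sum (\<lambda>j. of_bool (j = i)) F * X F w T)"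
        by (intro sum.cong refl) (simp add: sum_unit_form flatsD)
      also have "\<dots> = 0" by (rule X_linear_relation[OF w])
      finally have "(\<Sum>F\<in>L - T. of_bool (i \<in> F) * X F w T) + (\<Sum>F\<in>T. of_bool (i \<in> F) * X F w T) = 0"
        using sum.subset_diff[OF TL finite_flats, of "\<lambda>F. of_bool (i \<in> F) * X F w T"] by simp
      moreover have "(\<Sum>F\<in>L - T. of_bool (i \<in> F) * X F w T) = (\<Sum>H\<in>L - T. of_bool (i \<in> H) * w (insert H T))"
        using chainsD(2)[OF T] by (intro sum.cong refl) (simp add: X_notin[OF w])
      ultimately show ?thesis by simp
    qed
    also have "of_int \<dots> = (\<Sum>G\<in>\<tau>. - of_int (X G w T) * indicator G i) +
        - of_int (X E w T) * (indicator E i :: real)"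
      using fin E i by (simp add: T_def indicator_def sum_negf mult.commute)
    finally show "(\<Sum>\<sigma>\<in>{\<sigma> \<in> cones M k. \<tau> \<subseteq> \<sigma>}. of_int (csm_k M k \<sigma>) * indicator (the_elem (\<sigma> - \<tau>)) i) =
        (\<Sum>G\<in>\<tau>. - of_int (X G w T) * indicator G i) + - of_int (X E w T) * (indicator E i :: real)" .
  qed
qed

lemma cap_stair: "cap M (stair M) = csm M"
  by (rule ext) (simp add: stair_eq cap_chow_class[OF stair_poly_carrier] stair_poly_act csm_eq)

end

theorem theorem4p2:
  fixes M :: "'a matroid"
  assumes "matroid M"
    and "ground M \<noteq> {}"
  shows "stair M \<in> carrier (chow_ring M) \<and> csm M \<in> MW_star M \<and>
         cap M (stair M) = csm M"
proof (cases "loopless M")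
  case True
  then interpret loopless_matroid M
    using assms by (intro loopless_matroid.intro loopless_matroid_axioms.intro)
  have "stair M \<in> carrier (chow_ring M)"
    unfolding stair_eq by (intro chow_class_carrier stair_poly_carrier)
  moreover have "csm M \<in> MW_star M"
    using csm_k_in_MW unfolding MW_star_def csm_def by blast
  ultimately show ?thesis using cap_stair by blast
next
  case False
  interpret matroid M by fact
  have cones: "cones M k = {}" for k using False by (simp add: cones_def)
  have csm: "csm M = (\<lambda>_. 0)" by (rule ext) (simp add: csm_def csm_k_def cones)
  have "stair M = \<zero>\<^bsub>chow_ring M\<^esub>" using False by (simp add: stair_def)
  also have "\<dots> = chow_class M 0" by (rule chow_ring_zero)
  also have "\<dots> \<in> carrier (chow_ring M)" by (rule chow_class_carrier[OF chow_ideal_subset[OF chow_ideal_zero]])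
  finally have "stair M \<in> carrier (chow_ring M)" .
  moreover have "csm M \<in> MW_star M"
    unfolding MW_star_def csm by (intro CollectI exI[of _ "\<lambda>_ _. 0"]) (simp add: MW_def cones)
  moreover have "cap M (stair M) = csm M"
    by (rule ext) (simp add: csm cap_def cap_graded_def cones)
  ultimately show ?thesis by blast
qed

end
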